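(* Let $X$ be a second-countable locally compact Hausdorff space and $\kappa$ a perfect kernel on $X$. Let $A\subset X$ be a set with $c_*(A)>0$ such that $\mathcal E^+(A)$ is closed in the strong topology, and let $\omega\in\mathfrak M$, $\omega\neq0$, be a signed Radon measure such that either $\omega\in\mathcal E$, or all of the following (a)--(c) hold: (a) $\omega^+(X)<\infty$; (b) for every compact $K\subset A$ the restriction $U^{\omega^+}|_K$ is upper semicontinuous, and $M_A:=\sup_{x\in A}U^{|\omega|}(x)<\infty$; (c) $\kappa$ satisfies the $h$-Ugaheri maximum principle for some $h\in[1,\infty)$. Put $f:=-U^\omega$. Then there is one and the same measure $\widehat{\omega}^A\in\mathcal E^+_f(A)$ (called the inner pseudo-balayage of $\omega$ onto $A$) that satisfies each of the following three assertions (so that each of them characterizes it uniquely): (i$_1$) $\widehat{\omega}^A$ is the unique solution of the problem of minimizing $I_f$ over $\mathcal E^+_f(A)$, that is, $\widehat{\omega}^A$ is the unique measure in $\mathcal E^+_f(A)$ with $$I_f(\widehat{\omega}^A)=\min_{\mu\in\mathcal E^+_f(A)}I_f(\mu)=\widehat{w}_f(A)\in(-\infty,0].$$ (ii$_1$) $\widehat{\omega}^A$ is the only measure in $\mathcal E^+_f(A)$ having the two properties $$\int U^{\widehat{\omega}^A-\omega}\,d\mu\geqslant0\ \text{ for all }\mu\in\mathcal E^+_f(A),\qquad \int U^{\widehat{\omega}^A-\omega}\,d\widehat{\omega}^A=0.$$ (iii$_1$) $\widehat{\omega}^A$ is the only measure in $\mathcal E^+_f(A)$ having the two properties $$U^{\widehat{\omega}^A}\geqslant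 U^\omega\ \text{ n.e. on }A,\qquad U^{\widehat{\omega}^A}=U^\omega\ \ \widehat{\omega}^A\text{-a.e.}$$
   Context: $\mathfrak M$ is the space of all real-valued (signed) Radon measures on $X$ with the vague topology (pointwise convergence on continuous functions of compact support), and $\mathfrak M^+$ is its cone of positive measures. For $\omega\in\mathfrak M$, $\omega^\pm$ are its positive and negative parts (Hahn--Jordan decomposition) and $|\omega|=\omega^++\omega^-$. A kernel is a symmetric lower semicontinuous function $\kappa:X\times X\to[0,\infty]$. For $\mu,\nu\in\mathfrak M$: the mutual energy is $I(\mu,\nu)=\int\kappa\,d(\mu\otimes\nu)$, the potential is $U^\mu(x)=\int\kappa(x,y)\,d\mu(y)$, and the energy is $I(\mu)=I(\mu,\mu)$, each whenever well defined as a finite number or $\pm\infty$. The kernel is perfect if: (1) it is strictly positive definite, i.e. $I(\mu)\geqslant0$ for all signed $\mu\in\mathfrak M$ (for which $I(\mu)$ is well defined), with $I(\mu)=0$ only for $\mu=0$; then the set $\mathcal E$ of all signed measures of finite energy is a pre-Hilbert space with inner product $I(\mu,\nu)$ and norm $\|\mu\|=\sqrt{I(\mu)}$, whose topology is called strong; and (2) it is consistent, i.e. $\mathcal E^+:=\mathcal E\cap\mathfrak M^+$ is complete in the induced strong topology, and the strong topology on $\mathcal E^+$ is finer than the vague topology on $\mathcal E^+$. $h$-Ugaheri's maximum principle: for each $\mu\in\mathcal E^+$ with $U^\mu\leqslant c_\mu$ $\mu$-a.e., where $c_\mu\in(0,\infty)$, one has $U^\mu\leqslant hc_\mu$ on all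 of $X$. For $A\subset X$, $\mathfrak M^+(A)$ is the set of $\mu\in\mathfrak M^+$ concentrated on $A$, i.e. such that $X\setminus A$ is $\mu$-negligible, and $\mathcal E^+(A)=\mathcal E\cap\mathfrak M^+(A)$. With $f=-U^\omega$: $\mathcal E^+_f(A)$ is the set of $\mu\in\mathcal E^+(A)$ for which $f$ is $\mu$-integrable; for these the Gauss functional is $I_f(\mu)=\|\mu\|^2+2\int f\,d\mu=\|\mu\|^2-2\int U^\omega\,d\mu$; and $\widehat w_f(A)=\inf_{\mu\in\mathcal E^+_f(A)}I_f(\mu)$. (If $\omega\in\mathcal E$, $U^\omega$ is well defined and finite outside a set of outer capacity zero.) Capacities: for compact $K$, $c(K)=1/\inf\{I(\mu):\mu\in\mathcal E^+(K),\ \mu(K)=1\}$ (with $c(K)=0$ if there is no such $\mu$); the inner capacity is $c_*(E)=\sup\{c(K): K\subset E\text{ compact}\}$; the outer capacity is $c^*(E)=\inf\{c_*(G):G\supset E\text{ open}\}$. A property holds n.e. (nearly everywhere) on $A$ if the set of points of $A$ where it fails has inner capacity zero. *)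

theory Defs
  imports "HOL-Analysis.Analysis"
begin

definition radon :: "'a::topological_space measure \<Rightarrow> bool" where
  "radon \<mu> \<longleftrightarrow> sets \<mu> = sets borel \<and>
     (\<forall>K. compact K \<longrightarrow> emeasure \<mu> K < \<infinity>) \<and>
     (\<forall>B\<in>sets borel. emeasure \<mu> B = (SUP K\<in>{K. compact K \<and> K \<subseteq> B}. emeasure \<mu> K))"

definition mutually_singular :: "'a::topological_space measure \<Rightarrow> 'a measure \<Rightarrow> bool" where
  "mutually_singular \<mu> \<nu> \<longleftrightarrow> (\<exists>B\<in>sets borel. emeasure \<mu> B = 0 \<and> emeasure \<nu> (- B) = 0)"

text \<open>
  A signed Radon measure is represented by its Hahn--Jordan decomposition: the pair of its positive
  and negative parts. Both parts may have infinite total mass, so a signed Radon measure need not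
  be a set function on all Borel sets. The pair is unique, so equality of pairs is equality of
  signed measures.
\<close>

type_synonym 'a signed = "'a measure \<times> 'a measure"

abbreviation pos_part :: "'a signed \<Rightarrow> 'a measure" where "pos_part \<sigma> \<equiv> fst \<sigma>"
abbreviation neg_part :: "'a signed \<Rightarrow> 'a measure" where "neg_part \<sigma> \<equiv> snd \<sigma>"

definition signed_radon :: "'a::topological_space signed set" where
  "signed_radon =
     {\<sigma>. radon (pos_part \<sigma>) \<and> radon (neg_part \<sigma>) \<and> mutually_singular (pos_part \<sigma>) (neg_part \<sigma>)}"

definition of_pos :: "'a::topological_space measure \<Rightarrow> 'a signed" where
  "of_pos \<mu> = (\<mu>, null_measure borel)"

definition zero_signed :: "'a::topological_space signed" where
  "zero_signed = (null_measure borel, null_measure borel)"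

definition msum :: "'a::topological_space measure \<Rightarrow> 'a measure \<Rightarrow> 'a measure" where
  "msum \<mu> \<nu> = measure_of UNIV (sets borel) (\<lambda>B. emeasure \<mu> B + emeasure \<nu> B)"

definition total_variation :: "'a::topological_space signed \<Rightarrow> 'a measure" where
  "total_variation \<sigma> = msum (pos_part \<sigma>) (neg_part \<sigma>)"

text \<open>
  \<open>radon_diff \<alpha> \<beta>\<close> is the signed measure \<open>\<alpha> - \<beta>\<close>, i.e. the Hahn--Jordan pair \<open>\<sigma>\<close> with
  \<open>\<alpha> - \<beta> = \<sigma>\<^sup>+ - \<sigma>\<^sup>-\<close>; the equation is written without subtraction because of infinite values.
\<close>

definition radon_diff :: "'a::topological_space measure \<Rightarrow> 'a measure \<Rightarrow> 'a signed" where
  "radon_diff \<alpha> \<beta> =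
     (THE \<sigma>. \<sigma> \<in> signed_radon \<and> msum \<alpha> (neg_part \<sigma>) = msum \<beta> (pos_part \<sigma>))"

definition signed_diff :: "'a::topological_space signed \<Rightarrow> 'a signed \<Rightarrow> 'a signed" where
  "signed_diff \<sigma> \<tau> =
     radon_diff (msum (pos_part \<sigma>) (neg_part \<tau>)) (msum (neg_part \<sigma>) (pos_part \<tau>))"

definition compactly_supported :: "('a::topological_space \<Rightarrow> real) set" where
  "compactly_supported = {\<phi>. continuous_on UNIV \<phi> \<and> compact (closure {x. \<phi> x \<noteq> 0})}"

definition vague_topology :: "'a::topological_space signed topology" where
  "vague_topology =
     pullback_topology signed_radon
       (\<lambda>\<sigma>. \<lambda>\<phi>\<in>compactly_supported.
          (\<integral>x. \<phi> x \<partial>pos_part \<sigma>) - (\<integral>x. \<phi> x \<partial>neg_part \<sigma>))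
       (product_topology (\<lambda>_. euclideanreal) compactly_supported)"

definition kernel :: "('a::topological_space \<Rightarrow> 'a \<Rightarrow> ennreal) \<Rightarrow> bool" where
  "kernel \<kappa> \<longleftrightarrow> (\<forall>x y. \<kappa> x y = \<kappa> y x) \<and> (\<forall>t. open {p. t < \<kappa> (fst p) (snd p)})"

definition pos_potential :: "('a \<Rightarrow> 'a \<Rightarrow> ennreal) \<Rightarrow> 'a measure \<Rightarrow> 'a \<Rightarrow> ennreal" where
  "pos_potential \<kappa> \<mu> x = (\<integral>\<^sup>+ y. \<kappa> x y \<partial>\<mu>)"

definition potential_defined :: "('a \<Rightarrow> 'a \<Rightarrow> ennreal) \<Rightarrow> 'a signed \<Rightarrow> 'a \<Rightarrow> bool" where
  "potential_defined \<kappa> \<sigma> x \<longleftrightarrow>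
     pos_potential \<kappa> (pos_part \<sigma>) x < \<infinity> \<or> pos_potential \<kappa> (neg_part \<sigma>) x < \<infinity>"

text \<open>
  Where the potential is undefined, \<open>potential\<close> takes the value \<open>\<infinity> - \<infinity> = \<infinity>\<close> of type \<^typ>\<open>ereal\<close>.
  Hence finiteness of \<open>potential \<kappa> \<sigma> x\<close> always includes that the potential is defined at \<open>x\<close>.
\<close>

definition potential :: "('a \<Rightarrow> 'a \<Rightarrow> ennreal) \<Rightarrow> 'a signed \<Rightarrow> 'a \<Rightarrow> ereal" where
  "potential \<kappa> \<sigma> x =
     enn2ereal (pos_potential \<kappa> (pos_part \<sigma>) x) - enn2ereal (pos_potential \<kappa> (neg_part \<sigma>) x)"

definition pos_energy :: "('a \<Rightarrow> 'a \<Rightarrow> ennreal) \<Rightarrow> 'a measure \<Rightarrow> 'a measure \<Rightarrow> ennreal" where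
  "pos_energy \<kappa> \<mu> \<nu> = (\<integral>\<^sup>+ p. \<kappa> (fst p) (snd p) \<partial>(\<mu> \<Otimes>\<^sub>M \<nu>))"

text \<open>
  The integrals of the kernel against the positive and the negative part of the signed product
  measure \<open>\<sigma> \<otimes> \<sigma>\<close>, namely \<open>\<sigma>\<^sup>+ \<otimes> \<sigma>\<^sup>+ + \<sigma>\<^sup>- \<otimes> \<sigma>\<^sup>-\<close> and \<open>\<sigma>\<^sup>+ \<otimes> \<sigma>\<^sup>- + \<sigma>\<^sup>- \<otimes> \<sigma>\<^sup>+\<close>.
\<close>

definition energy_plus :: "('a \<Rightarrow> 'a \<Rightarrow> ennreal) \<Rightarrow> 'a signed \<Rightarrow> ennreal" where
  "energy_plus \<kappa> \<sigma> =
     pos_energy \<kappa> (pos_part \<sigma>) (pos_part \<sigma>) + pos_energy \<kappa> (neg_part \<sigma>) (neg_part \<sigma>)"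

definition energy_minus :: "('a \<Rightarrow> 'a \<Rightarrow> ennreal) \<Rightarrow> 'a signed \<Rightarrow> ennreal" where
  "energy_minus \<kappa> \<sigma> =
     pos_energy \<kappa> (pos_part \<sigma>) (neg_part \<sigma>) + pos_energy \<kappa> (neg_part \<sigma>) (pos_part \<sigma>)"

definition energy_defined :: "('a \<Rightarrow> 'a \<Rightarrow> ennreal) \<Rightarrow> 'a signed \<Rightarrow> bool" where
  "energy_defined \<kappa> \<sigma> \<longleftrightarrow> energy_plus \<kappa> \<sigma> < \<infinity> \<or> energy_minus \<kappa> \<sigma> < \<infinity>"

definition energy :: "('a \<Rightarrow> 'a \<Rightarrow> ennreal) \<Rightarrow> 'a signed \<Rightarrow> ereal" where
  "energy \<kappa> \<sigma> = enn2ereal (energy_plus \<kappa> \<sigma>) - enn2ereal (energy_minus \<kappa> \<sigma>)"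

definition strictly_positive_definite :: "('a::topological_space \<Rightarrow> 'a \<Rightarrow> ennreal) \<Rightarrow> bool" where
  "strictly_positive_definite \<kappa> \<longleftrightarrow>
     (\<forall>\<sigma>\<in>signed_radon. energy_defined \<kappa> \<sigma> \<longrightarrow>
        0 \<le> energy \<kappa> \<sigma> \<and> (energy \<kappa> \<sigma> = 0 \<longrightarrow> \<sigma> = zero_signed))"

definition finite_energy :: "('a::topological_space \<Rightarrow> 'a \<Rightarrow> ennreal) \<Rightarrow> 'a signed set" where
  "finite_energy \<kappa> = {\<sigma>\<in>signed_radon. energy_defined \<kappa> \<sigma> \<and> \<bar>energy \<kappa> \<sigma>\<bar> \<noteq> \<infinity>}"

definition finite_energy_pos :: "('a::topological_space \<Rightarrow> 'a \<Rightarrow> ennreal) \<Rightarrow> 'a measure set" where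
  "finite_energy_pos \<kappa> = {\<mu>. radon \<mu> \<and> of_pos \<mu> \<in> finite_energy \<kappa>}"

definition finite_energy_on ::
    "('a::topological_space \<Rightarrow> 'a \<Rightarrow> ennreal) \<Rightarrow> 'a set \<Rightarrow> 'a measure set" where
  "finite_energy_on \<kappa> A = {\<mu>\<in>finite_energy_pos \<kappa>. AE x in \<mu>. x \<in> A}"

definition strong_norm :: "('a \<Rightarrow> 'a \<Rightarrow> ennreal) \<Rightarrow> 'a signed \<Rightarrow> real" where
  "strong_norm \<kappa> \<sigma> = sqrt (real_of_ereal (energy \<kappa> \<sigma>))"

text \<open>
  The value outside \<open>finite_energy \<kappa>\<close> is immaterial; it is fixed because \<^locale>\<open>Metric_space\<close> asks
  for nonnegativity and symmetry everywhere.
\<close>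

definition strong_dist ::
    "('a::topological_space \<Rightarrow> 'a \<Rightarrow> ennreal) \<Rightarrow> 'a signed \<Rightarrow> 'a signed \<Rightarrow> real" where
  "strong_dist \<kappa> \<sigma> \<tau> =
     (if \<sigma> \<in> finite_energy \<kappa> \<and> \<tau> \<in> finite_energy \<kappa> then strong_norm \<kappa> (signed_diff \<sigma> \<tau>) else 0)"

definition strong_topology ::
    "('a::topological_space \<Rightarrow> 'a \<Rightarrow> ennreal) \<Rightarrow> 'a signed topology" where
  "strong_topology \<kappa> = Metric_space.mtopology (finite_energy \<kappa>) (strong_dist \<kappa>)"

definition consistent :: "('a::topological_space \<Rightarrow> 'a \<Rightarrow> ennreal) \<Rightarrow> bool" where
  "consistent \<kappa> \<longleftrightarrow>
     Metric_space.mcomplete (of_pos ` finite_energy_pos \<kappa>) (strong_dist \<kappa>) \<and>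
     (\<forall>U. openin (subtopology vague_topology (of_pos ` finite_energy_pos \<kappa>)) U \<longrightarrow>
          openin (subtopology (strong_topology \<kappa>) (of_pos ` finite_energy_pos \<kappa>)) U)"

definition perfect :: "('a::topological_space \<Rightarrow> 'a \<Rightarrow> ennreal) \<Rightarrow> bool" where
  "perfect \<kappa> \<longleftrightarrow> kernel \<kappa> \<and> strictly_positive_definite \<kappa> \<and> consistent \<kappa>"

definition ugaheri_principle ::
    "('a::topological_space \<Rightarrow> 'a \<Rightarrow> ennreal) \<Rightarrow> real \<Rightarrow> bool" where
  "ugaheri_principle \<kappa> h \<longleftrightarrow>
     (\<forall>\<mu>\<in>finite_energy_pos \<kappa>. \<forall>c>0.
        (AE x in \<mu>. pos_potential \<kappa> \<mu> x \<le> ennreal c) \<longrightarrow>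
        (\<forall>x. pos_potential \<kappa> \<mu> x \<le> ennreal (h * c)))"

text \<open>The infimum over the empty set is \<open>\<infinity>\<close>, and \<open>1 / \<infinity> = 0\<close> in \<^typ>\<open>ennreal\<close>.\<close>

definition compact_capacity ::
    "('a::topological_space \<Rightarrow> 'a \<Rightarrow> ennreal) \<Rightarrow> 'a set \<Rightarrow> ennreal" where
  "compact_capacity \<kappa> K =
     1 / (INF \<mu>\<in>{\<mu>\<in>finite_energy_on \<kappa> K. emeasure \<mu> K = 1}. pos_energy \<kappa> \<mu> \<mu>)"

definition inner_capacity ::
    "('a::topological_space \<Rightarrow> 'a \<Rightarrow> ennreal) \<Rightarrow> 'a set \<Rightarrow> ennreal" where
  "inner_capacity \<kappa> E = (SUP K\<in>{K. compact K \<and> K \<subseteq> E}. compact_capacity \<kappa> K)"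

definition nearly_everywhere ::
    "('a::topological_space \<Rightarrow> 'a \<Rightarrow> ennreal) \<Rightarrow> 'a set \<Rightarrow> ('a \<Rightarrow> bool) \<Rightarrow> bool" where
  "nearly_everywhere \<kappa> A P \<longleftrightarrow> inner_capacity \<kappa> {x\<in>A. \<not> P x} = 0"

definition usc_on :: "'a::topological_space set \<Rightarrow> ('a \<Rightarrow> ennreal) \<Rightarrow> bool" where
  "usc_on K u \<longleftrightarrow> (\<forall>t. openin (top_of_set K) {x\<in>K. u x < t})"

definition ext_integrable :: "'a measure \<Rightarrow> ('a \<Rightarrow> ereal) \<Rightarrow> bool" where
  "ext_integrable \<mu> g \<longleftrightarrow>
     (AE x in \<mu>. \<bar>g x\<bar> \<noteq> \<infinity>) \<and> integrable \<mu> (\<lambda>x. real_of_ereal (g x))"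

definition ext_integral :: "'a measure \<Rightarrow> ('a \<Rightarrow> ereal) \<Rightarrow> real" where
  "ext_integral \<mu> g = (\<integral>x. real_of_ereal (g x) \<partial>\<mu>)"

definition gauss_class ::
    "('a::topological_space \<Rightarrow> 'a \<Rightarrow> ennreal) \<Rightarrow> ('a \<Rightarrow> ereal) \<Rightarrow> 'a set \<Rightarrow> 'a measure set" where
  "gauss_class \<kappa> f A = {\<mu>\<in>finite_energy_on \<kappa> A. ext_integrable \<mu> f}"

definition gauss ::
    "('a::topological_space \<Rightarrow> 'a \<Rightarrow> ennreal) \<Rightarrow> ('a \<Rightarrow> ereal) \<Rightarrow> 'a measure \<Rightarrow> real" where
  "gauss \<kappa> f \<mu> = (strong_norm \<kappa> (of_pos \<mu>))\<^sup>2 + 2 * ext_integral \<mu> f"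

definition gauss_inf ::
    "('a::topological_space \<Rightarrow> 'a \<Rightarrow> ennreal) \<Rightarrow> ('a \<Rightarrow> ereal) \<Rightarrow> 'a set \<Rightarrow> ereal" where
  "gauss_inf \<kappa> f A = (INF \<mu>\<in>gauss_class \<kappa> f A. ereal (gauss \<kappa> f \<mu>))"

end

theory Submission
  imports Defs
begin

text \<open>
  Let \<open>p\<close> and \<open>q\<close> be the potentials of \<open>\<omega>\<^sup>+\<close> and \<open>\<omega>\<^sup>-\<close>, so that the Gauss functional is
  \<open>J(\<mu>) = I(\<mu>, \<mu>) - 2 \<integral>p d\<mu> + 2 \<integral>q d\<mu>\<close>. Abstractly the theorem is the projection onto a closed convex
  cone in a pre-Hilbert space: by the parallelogram identity a minimizing sequence is Cauchy, and
  completeness of the cone of positive measures together with closedness of the measures on \<open>A\<close>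
  provides its limit. The first variation of \<open>J\<close> characterizes the minimizer by the variational
  inequality of the second assertion, and strict convexity yields uniqueness (\<open>unique_minimizer\<close>).
  The variational inequality is equivalent to the comparison of potentials in the third assertion,
  because measures of finite energy do not charge sets of inner capacity zero and, conversely, a set of
  positive inner capacity carries a measure against which it can be tested
  (\<open>variational_iff_potential\<close>).

  What has to be proved about the external field is isolated in the locale \<open>gauss_problem\<close>: the
  integrals \<open>\<integral>p d\<mu>\<close> are bounded by a multiple of the norm of \<open>\<mu>\<close>, and they are upper semicontinuous along strongly
  convergent sequences. For the repulsive part \<open>q\<close>, lower semicontinuity is enough, since strong
  convergence implies vague convergence. If \<open>\<omega>\<close> has finite energy, both properties are instances of
  the Cauchy--Schwarz inequality.

  In the other case \<open>p\<close> may be the potential of a measure of infinite energy. On a compact \<open>K \<subseteq> A\<close> the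
  problem with field \<open>- p\<close> has a minimizer \<open>\<nu>\<close>, as \<open>p\<close> is bounded and upper semicontinuous there. The
  potential of \<open>\<nu>\<close> equals \<open>p\<close> almost everywhere with respect to \<open>\<nu>\<close>, so the maximum principle bounds it
  everywhere, and integrating this bound against the finite measure \<open>\<omega>\<^sup>+\<close> bounds the norm of \<open>\<nu>\<close>
  independently of \<open>K\<close>. Hence the norm bound holds with one constant on all compact subsets of \<open>A\<close>
  (\<open>potential_integral_bound_compact\<close>), and then on \<open>A\<close>. Upper semicontinuity on the arbitrary
  set \<open>A\<close> follows from \<open>strong_tightness\<close>: along a subsequence, all members of a strongly convergent
  sequence have small energy outside one compact subset of \<open>A\<close>.

  Signed measures are pairs of positive ones whose values may be infinite. Therefore differences are
  handled by bilinear expressions in positive measures throughout, and only \<open>energy_radon_diff\<close> and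
  \<open>potential_signed_diff\<close> evaluate an actual Jordan decomposition.
\<close>

section \<open>Locally compact Hausdorff spaces with a countable base\<close>

lemma Hausdorff_space_euclidean_t2: "Hausdorff_space (euclidean :: 'a::t2_space topology)"
  unfolding Hausdorff_space_def
proof (intro allI impI)
  fix x y :: 'a
  assume "x \<in> topspace euclidean \<and> y \<in> topspace euclidean \<and> x \<noteq> y"
  then obtain U V where "open U" "open V" "x \<in> U" "y \<in> V" "U \<inter> V = {}"
    using hausdorff[of x y] by metis
  then show "\<exists>U V. openin euclidean U \<and> openin euclidean V \<and> x \<in> U \<and> y \<in> V \<and> disjnt U V"
    unfolding disjnt_def by (intro exI[of _ U] exI[of _ V]) simp
qed

lemma second_countable_euclidean:
  "second_countable (euclidean :: 'a::second_countable_topology topology)"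
proof -
  obtain B :: "'a set set" where "countable B" "topological_basis B"
    using ex_countable_basis by auto
  have 1: "openin euclidean V" if "V \<in> B" for V
    using that \<open>topological_basis B\<close> by (simp add: topological_basis_open)
  have 2: "\<exists>V\<in>B. x \<in> V \<and> V \<subseteq> U" if U: "openin euclidean U" "x \<in> U" for U and x :: 'a
  proof -
    have "open U" using U(1) by simp
    then show ?thesis using U(2) \<open>topological_basis B\<close> by (metis topological_basisE)
  qed
  from 1 2 show ?thesis
    unfolding second_countable_def using \<open>countable B\<close> by blast
qed

lemma normal_space_euclidean_lc:
  assumes "locally_compact_space (euclidean :: 'a::{t2_space, second_countable_topology} topology)"
  shows "normal_space (euclidean :: 'a::{t2_space, second_countable_topology} topology)"
  using assms Hausdorff_space_euclidean_t2 second_countable_euclidean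
    locally_compact_Hausdorff_imp_regular_space regular_second_countable_imp_hereditarily_normal_space
    hereditarily_inc by blast

lemma sigma_compact_lc:
  assumes lc: "locally_compact_space (euclidean :: 'a::{t2_space, second_countable_topology} topology)"
  shows "\<exists>K :: nat \<Rightarrow> 'a set. (\<forall>n. compact (K n)) \<and> incseq K \<and> (\<Union>n. K n) = UNIV"
proof -
  have "\<exists>U K. open U \<and> compact K \<and> x \<in> U \<and> U \<subseteq> K" for x :: 'a
    using lc unfolding locally_compact_space_def by simp
  then obtain U C where UC: "\<And>x::'a. open (U x) \<and> compact (C x) \<and> x \<in> U x \<and> U x \<subseteq> C x"
    by metis
  obtain \<F> where \<F>: "\<F> \<subseteq> range U" "countable \<F>" "\<Union>\<F> = \<Union>(range U)"
    using Lindelof[of "range U"] UC by (metis imageE)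
  then obtain X where X: "countable X" "\<F> = U ` X"
    by (metis countable_subset_image)
  have ne: "X \<noteq> {}" using \<F> X UC by auto
  define K where "K n = (\<Union>i\<le>n. C (from_nat_into X i))" for n
  show ?thesis
  proof (intro exI[of _ K] conjI allI)
    show "compact (K n)" for n unfolding K_def using UC by auto
    show "incseq K" unfolding K_def incseq_def by (auto intro: order_trans)
    have "x \<in> (\<Union>n. K n)" for x
    proof -
      have "x \<in> \<Union>\<F>" unfolding \<F>(3) using UC[of x] by auto
      then obtain y where y: "y \<in> X" "x \<in> U y" using X by auto
      then obtain n where "from_nat_into X n = y" using X(1) ne by (metis from_nat_into_surj)
      then show ?thesis using y UC K_def by force
    qed
    then show "(\<Union>n. K n) = UNIV" by auto
  qed
qed

lemma bump_function:
  fixes C :: "'a::{t2_space, second_countable_topology} set"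
  assumes lc: "locally_compact_space (euclidean :: 'a topology)"
    and "compact C" "open G" "C \<subseteq> G"
  obtains \<phi> where "\<phi> \<in> compactly_supported" "\<And>x. 0 \<le> \<phi> x" "\<And>x. \<phi> x \<le> 1"
    "\<And>x. x \<in> C \<Longrightarrow> \<phi> x = 1" "\<And>x. x \<notin> G \<Longrightarrow> \<phi> x = 0"
proof -
  have "\<exists>U L. open U \<and> compact L \<and> closed L \<and> C \<subseteq> U \<and> U \<subseteq> L"
    using lc \<open>compact C\<close>
      locally_compact_space_compact_closed_compact[OF disjI1[OF Hausdorff_space_euclidean_t2[where 'a='a]]]
    by simp
  then obtain U L where UL: "open U" "compact L" "closed L" "C \<subseteq> U" "U \<subseteq> L"
    by blast
  have clC: "closed C" using \<open>compact C\<close> compact_imp_closed by blast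
  obtain \<psi> where \<psi>: "continuous_map euclidean (top_of_set {0..1::real}) \<psi>"
      "\<psi> ` (- (G \<inter> U)) \<subseteq> {0}" "\<psi> ` C \<subseteq> {1}"
    by (rule Urysohn_lemma[OF normal_space_euclidean_lc[OF lc], of "- (G \<inter> U)" C 0 1])
       (use clC UL assms in \<open>auto simp: closed_closedin[symmetric] disjnt_def\<close>)
  have cont: "continuous_on UNIV \<psi>" and rng: "\<And>x. \<psi> x \<in> {0..1}"
    using \<psi>(1) by (auto simp: continuous_map_in_subtopology)
  have "closure {x. \<psi> x \<noteq> 0} \<subseteq> L"
    using \<psi>(2) UL by (intro closure_minimal) auto
  then have "compact (closure {x. \<psi> x \<noteq> 0})"
    using UL(2) compact_closure compact_Int_closed[of L "closure {x. \<psi> x \<noteq> 0}"] by (simp add: Int_absorb1)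
  then show thesis
    using that[of \<psi>] cont rng \<psi> unfolding compactly_supported_def by fastforce
qed

text \<open>
  Only countably many finite unions of base sets cover \<open>K\<close>, and each neighbourhood of \<open>K\<close> contains
  one of them; \<open>G i\<close> is the intersection of the first \<open>i + 1\<close> of them.
\<close>

lemma compact_nhds_base:
  fixes K :: "'a::second_countable_topology set"
  assumes "compact K"
  obtains G :: "nat \<Rightarrow> 'a set" where "\<And>i. open (G i)" "\<And>i. K \<subseteq> G i"
    "\<And>V. open V \<Longrightarrow> K \<subseteq> V \<Longrightarrow> \<exists>i. \<forall>j\<ge>i. G j \<subseteq> V"
proof -
  obtain B :: "'a set set" where B: "countable B" "topological_basis B"
    using ex_countable_basis by auto
  define \<F> where "\<F> = {F. finite F \<and> F \<subseteq> B \<and> K \<subseteq> \<Union>F}"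
  have cF: "countable \<F>"
    unfolding \<F>_def using countable_Collect_finite_subset[OF B(1)]
    by (rule countable_subset[rotated]) auto
  have key: "\<exists>F\<in>\<F>. \<Union>F \<subseteq> V" if V: "open V" "K \<subseteq> V" for V
  proof -
    obtain B' where B': "B' \<subseteq> B" "\<Union>B' = V" using B(2) V(1) unfolding topological_basis_def by blast
    have "\<And>b. b \<in> B' \<Longrightarrow> open b" using B' B(2) topological_basis_open by blast
    then obtain F where "F \<subseteq> B'" "finite F" "K \<subseteq> \<Union>F"
      using compactE[OF assms, of B'] B' V by metis
    then have "F \<in> \<F>" "\<Union>F \<subseteq> V" using B' unfolding \<F>_def by auto
    then show ?thesis by blast
  qed
  have ne: "\<F> \<noteq> {}" using key[of UNIV] by auto
  define G where "G n = (\<Inter>i\<le>n. \<Union>(from_nat_into \<F> i))" for n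
  have fn: "from_nat_into \<F> i \<in> \<F>" for i using ne by (rule from_nat_into)
  show thesis
  proof
    have "open (\<Union>(from_nat_into \<F> i))" for i
      using fn[of i] B(2) topological_basis_open unfolding \<F>_def by blast
    then show "open (G i)" for i unfolding G_def by blast
    show "K \<subseteq> G i" for i using fn unfolding G_def \<F>_def by blast
    fix V assume "open V" "K \<subseteq> V"
    then obtain F where F: "F \<in> \<F>" "\<Union>F \<subseteq> V" using key[of V] by metis
    then obtain i where "from_nat_into \<F> i = F" using from_nat_into_surj[OF cF] by metis
    then have "G j \<subseteq> V" if "i \<le> j" for j
      using F(2) that unfolding G_def by (auto dest: bspec[of _ _ i])
    then show "\<exists>i. \<forall>j\<ge>i. G j \<subseteq> V" by blast
  qed
qed

text \<open>
  A finite subcover of \<open>K\<close> already covers all but finitely many of the sets \<open>H i\<close>.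
\<close>

lemma compact_Un_shrinking:
  fixes K :: "'a::topological_space set"
  assumes K: "compact K" and H: "\<And>i::nat. compact (H i)" "\<And>i. H i \<subseteq> G i"
    and G: "\<And>V. open V \<Longrightarrow> K \<subseteq> V \<Longrightarrow> \<exists>i. \<forall>j\<ge>i. G j \<subseteq> V"
  shows "compact (K \<union> (\<Union>i. H i))"
proof (rule compactI)
  fix \<C> :: "'a set set"
  assume \<C>: "\<forall>t\<in>\<C>. open t" and cov: "K \<union> (\<Union>i. H i) \<subseteq> \<Union>\<C>"
  obtain F where F: "F \<subseteq> \<C>" "finite F" "K \<subseteq> \<Union>F"
    using compactE[OF K, of \<C>] \<C> cov by (metis Un_subset_iff)
  then obtain i where i: "\<And>j. j \<ge> i \<Longrightarrow> G j \<subseteq> \<Union>F"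
    using G[of "\<Union>F"] \<C> by blast
  have "compact (\<Union>j<i. H j)" using H by blast
  then obtain F' where F': "F' \<subseteq> \<C>" "finite F'" "(\<Union>j<i. H j) \<subseteq> \<Union>F'"
    using compactE[of "\<Union>j<i. H j" \<C>] \<C> cov by (smt (verit, best) Sup_subset_mono UNIV_I Un_subset_iff image_mono subset_UNIV order_trans)
  have "H j \<subseteq> \<Union>(F \<union> F')" for j
    using i[of j] H(2)[of j] F'(3) by (cases "j < i") (auto simp: not_less)
  then have "K \<union> (\<Union>i. H i) \<subseteq> \<Union>(F \<union> F')" using F(3) by blast
  then show "\<exists>\<C>'\<subseteq>\<C>. finite \<C>' \<and> K \<union> (\<Union>i. H i) \<subseteq> \<Union>\<C>'"
    using F F' by (metis finite_Un Un_least)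
qed

section \<open>Radon measures\<close>

lemma sets_radon: "radon \<mu> \<Longrightarrow> sets \<mu> = sets borel"
  and compact_finite_radon: "radon \<mu> \<Longrightarrow> compact K \<Longrightarrow> emeasure \<mu> K < \<infinity>"
  unfolding radon_def by auto

lemma space_radon: "radon \<mu> \<Longrightarrow> space \<mu> = UNIV"
  using sets_eq_imp_space_eq[OF sets_radon] by simp

lemma sets_msum [simp, measurable_cong]: "sets (msum \<mu> \<nu>) = sets borel"
  unfolding msum_def using sets.sigma_sets_eq[of borel] by (simp add: sets_measure_of_conv)

lemma space_msum [simp]: "space (msum \<mu> \<nu>) = UNIV"
  unfolding msum_def by (simp add: space_measure_of_conv)

lemma emeasure_msum:
  assumes s: "sets \<mu> = sets borel" "sets \<nu> = sets borel" and B: "B \<in> sets borel"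
  shows "emeasure (msum \<mu> \<nu>) B = emeasure \<mu> B + emeasure \<nu> B"
proof (rule emeasure_measure_of[OF msum_def])
  show "countably_additive (sets (msum \<mu> \<nu>)) (\<lambda>B. emeasure \<mu> B + emeasure \<nu> B)"
  proof (rule countably_additiveI)
    fix A :: "nat \<Rightarrow> 'a set"
    assume A: "range A \<subseteq> sets (msum \<mu> \<nu>)" "disjoint_family A"
    show "(\<Sum>i. emeasure \<mu> (A i) + emeasure \<nu> (A i)) = emeasure \<mu> (\<Union> (range A)) + emeasure \<nu> (\<Union> (range A))"
      using A s by (simp add: suminf_add[symmetric] suminf_emeasure)
  qed
qed (use B in \<open>auto simp: positive_def sets.space_closed\<close>)

lemma nn_integral_msum:
  assumes s: "sets \<mu> = sets borel" "sets \<nu> = sets borel" and f: "f \<in> borel_measurable borel"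
  shows "(\<integral>\<^sup>+x. f x \<partial>msum \<mu> \<nu>) = (\<integral>\<^sup>+x. f x \<partial>\<mu>) + (\<integral>\<^sup>+x. f x \<partial>\<nu>)"
  using f
proof (induction rule: borel_measurable_induct)
  case (cong f g)
  then show ?case by (simp cong: nn_integral_cong)
next
  case (set A)
  then show ?case using s by (simp add: emeasure_msum)
next
  case (mult u c)
  have [measurable]: "u \<in> borel_measurable \<mu>" "u \<in> borel_measurable \<nu>" "u \<in> borel_measurable (msum \<mu> \<nu>)"
    using mult s by (auto cong: measurable_cong_sets)
  show ?case using mult.IH by (simp add: nn_integral_cmult distrib_left)
next
  case (add u v)
  have [measurable]: "u \<in> borel_measurable \<mu>" "u \<in> borel_measurable \<nu>" "u \<in> borel_measurable (msum \<mu> \<nu>)"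
      "v \<in> borel_measurable \<mu>" "v \<in> borel_measurable \<nu>" "v \<in> borel_measurable (msum \<mu> \<nu>)"
    using add s by (auto cong: measurable_cong_sets)
  show ?case using add.IH by (simp add: nn_integral_add add_ac)
next
  case (seq U)
  have [measurable]: "U i \<in> borel_measurable \<mu>" "U i \<in> borel_measurable \<nu>" "U i \<in> borel_measurable (msum \<mu> \<nu>)" for i
    using seq s by (auto cong: measurable_cong_sets)
  have inc: "incseq (\<lambda>i. integral\<^sup>N \<mu> (U i))" "incseq (\<lambda>i. integral\<^sup>N \<nu> (U i))"
    using \<open>incseq U\<close> by (auto simp: incseq_def le_fun_def intro!: nn_integral_mono)
  have "(\<integral>\<^sup>+x. (SUP i. U i) x \<partial>N) = (SUP i. integral\<^sup>N N (U i))" if "\<And>i. U i \<in> borel_measurable N" for N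
    using nn_integral_monotone_convergence_SUP[OF \<open>incseq U\<close> that] by (simp add: image_comp)
  then show ?case
    using seq.IH inc by (simp add: ennreal_SUP_add)
qed

text \<open>
  On a set of finite \<open>\<gamma>\<close>-measure, a compact subset that leaves little \<open>\<gamma>\<close>-mass leaves little
  \<open>\<nu>\<close>-mass; a general Borel set is exhausted by sets of that kind since the space is \<open>\<sigma>\<close>-compact.
  Hence restrictions and the parts of a Jordan decomposition are Radon measures.
\<close>

lemma radon_le:
  fixes \<gamma> :: "'a::{t2_space, second_countable_topology} measure"
  assumes lc: "locally_compact_space (euclidean :: 'a topology)"
    and \<gamma>: "radon \<gamma>" and s: "sets \<nu> = sets borel"
    and le: "\<And>B. B \<in> sets borel \<Longrightarrow> emeasure \<nu> B \<le> emeasure \<gamma> B"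
  shows "radon \<nu>"
  unfolding radon_def
proof (intro conjI s ballI allI impI)
  fix K :: "'a set" assume "compact K"
  then show "emeasure \<nu> K < \<infinity>"
    using compact_finite_radon[OF \<gamma>] le[of K] borel_compact by (metis le_less_trans)
next
  obtain C :: "nat \<Rightarrow> 'a set" where C: "\<And>n. compact (C n)" "incseq C" "(\<Union>n. C n) = UNIV"
    using sigma_compact_lc[OF lc] by metis
  fix B :: "'a set" assume B: "B \<in> sets borel"
  let ?S = "SUP K\<in>{K. compact K \<and> K \<subseteq> B}. emeasure \<nu> K"
  have Cb: "C n \<in> sets borel" for n using C(1) borel_compact by blast
  have part: "emeasure \<nu> (B \<inter> C n) \<le> ?S" for n
  proof (rule ennreal_le_epsilon)
    fix e :: real assume "0 < e"
    let ?B = "B \<inter> C n"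
    have Bb: "?B \<in> sets borel" using B Cb by auto
    have "emeasure \<gamma> ?B \<le> emeasure \<gamma> (C n)"
      using Cb sets_radon[OF \<gamma>] by (intro emeasure_mono) auto
    then have fin: "emeasure \<gamma> ?B < \<infinity>"
      using compact_finite_radon[OF \<gamma> C(1)] by (metis le_less_trans)
    have "\<exists>K\<in>{K. compact K \<and> K \<subseteq> ?B}. emeasure \<gamma> ?B < emeasure \<gamma> K + ennreal e"
    proof (rule SUP_approx_ennreal[OF \<open>0 < e\<close>])
      show "{K. compact K \<and> K \<subseteq> ?B} \<noteq> {}" by (auto intro: exI[of _ "{}"])
      show "emeasure \<gamma> ?B = (SUP K\<in>{K. compact K \<and> K \<subseteq> ?B}. emeasure \<gamma> K)"
        using \<gamma> Bb unfolding radon_def by blast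
      show "emeasure \<gamma> ?B \<noteq> \<infinity>" using fin by auto
    qed
    then obtain K where K: "compact K" "K \<subseteq> ?B" "emeasure \<gamma> ?B < emeasure \<gamma> K + ennreal e"
      by auto
    have Kb: "K \<in> sets borel" using K borel_compact by blast
    have "emeasure \<gamma> ?B = emeasure \<gamma> K + emeasure \<gamma> (?B - K)"
      using Kb Bb K(2) sets_radon[OF \<gamma>] by (subst plus_emeasure) (auto simp: Un_absorb1 intro!: arg_cong2[where f=emeasure])
    moreover have "emeasure \<gamma> K < \<infinity>" using K compact_finite_radon[OF \<gamma>] by blast
    ultimately have "emeasure \<gamma> (?B - K) \<le> ennreal e" using K(3)
      by (simp add: less_top)
    then have 1: "emeasure \<nu> (?B - K) \<le> ennreal e" using le[of "?B - K"] Kb Bb by (auto intro: order_trans)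
    have "emeasure \<nu> ?B = emeasure \<nu> K + emeasure \<nu> (?B - K)"
      using Kb Bb K(2) s by (subst plus_emeasure) (auto simp: Un_absorb1 intro!: arg_cong2[where f=emeasure])
    also have "\<dots> \<le> ?S + ennreal e"
      using K 1 by (intro add_mono SUP_upper) auto
    finally show "emeasure \<nu> ?B \<le> ?S + ennreal e" .
  qed
  have "emeasure \<nu> B = emeasure \<nu> (\<Union>n. B \<inter> C n)" using C(3) by (simp add: Int_UN_distrib[symmetric])
  also have "\<dots> = (SUP n. emeasure \<nu> (B \<inter> C n))"
    using C(2) B Cb s by (intro SUP_emeasure_incseq[symmetric]) (auto simp: incseq_def)
  also have "\<dots> \<le> ?S" using part by (intro SUP_least)
  finally show "emeasure \<nu> B = ?S"
    using B s by (intro antisym SUP_least emeasure_mono) auto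
qed

lemma radon_null: "radon (null_measure borel)"
  unfolding radon_def by (auto intro!: antisym simp: SUP_constant)

lemma radon_scale:
  assumes "radon \<mu>"
  shows "radon (scale_measure (ennreal t) \<mu>)"
  using assms unfolding radon_def
  by (auto simp: SUP_mult_left_ennreal ennreal_mult_less_top)

lemma radon_msum:
  fixes \<mu> \<nu> :: "'a::t2_space measure"
  assumes \<mu>: "radon \<mu>" and \<nu>: "radon \<nu>"
  shows "radon (msum \<mu> \<nu>)"
  unfolding radon_def
proof (intro conjI ballI allI impI)
  note s = sets_radon[OF \<mu>] sets_radon[OF \<nu>]
  show "sets (msum \<mu> \<nu>) = sets borel" by simp
  show "emeasure (msum \<mu> \<nu>) K < \<infinity>" if "compact K" for K
    using that compact_finite_radon[OF \<mu> that] compact_finite_radon[OF \<nu> that]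
    by (simp add: emeasure_msum[OF s] borel_compact)
  fix B :: "'a set" assume B: "B \<in> sets borel"
  let ?\<K> = "{K. compact K \<and> K \<subseteq> B}"
  have "(SUP K\<in>?\<K>. emeasure \<mu> K + emeasure \<nu> K)
      = (SUP K\<in>?\<K>. emeasure \<mu> K) + (SUP K\<in>?\<K>. emeasure \<nu> K)"
  proof (rule SUP_add_directed_ennreal)
    fix K L assume KL: "K \<in> ?\<K>" "L \<in> ?\<K>"
    show "\<exists>M\<in>?\<K>. emeasure \<mu> K + emeasure \<nu> L \<le> emeasure \<mu> M + emeasure \<nu> M"
      using KL s by (intro bexI[of _ "K \<union> L"] add_mono emeasure_mono) (auto simp: borel_compact)
  qed
  moreover have "emeasure \<mu> B = (SUP K\<in>?\<K>. emeasure \<mu> K)" "emeasure \<nu> B = (SUP K\<in>?\<K>. emeasure \<nu> K)"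
    using \<mu> \<nu> B unfolding radon_def by blast+
  ultimately have "emeasure \<mu> B + emeasure \<nu> B = (SUP K\<in>?\<K>. emeasure \<mu> K + emeasure \<nu> K)" by simp
  also have "\<dots> = (SUP K\<in>?\<K>. emeasure (msum \<mu> \<nu>) K)"
    by (intro SUP_cong) (auto simp: emeasure_msum[OF s] borel_compact)
  finally show "emeasure (msum \<mu> \<nu>) B = (SUP K\<in>?\<K>. emeasure (msum \<mu> \<nu>) K)"
    using B by (simp add: emeasure_msum[OF s])
qed

lemma radon_density_le:
  fixes \<gamma> :: "'a::{t2_space, second_countable_topology} measure"
  assumes lc: "locally_compact_space (euclidean :: 'a topology)"
    and \<gamma>: "radon \<gamma>" and f: "f \<in> borel_measurable borel" and le: "\<And>x. f x \<le> 1"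
  shows "radon (density \<gamma> f)"
proof (rule radon_le[OF lc \<gamma>])
  note s = sets_radon[OF \<gamma>]
  have [measurable]: "f \<in> borel_measurable \<gamma>" using f s by (simp cong: measurable_cong_sets)
  show "sets (density \<gamma> f) = sets borel" using s by simp
  fix B :: "'a set" assume B: "B \<in> sets borel"
  have "emeasure (density \<gamma> f) B = (\<integral>\<^sup>+x. f x * indicator B x \<partial>\<gamma>)"
    using B s by (simp add: emeasure_density)
  also have "\<dots> \<le> (\<integral>\<^sup>+x. indicator B x \<partial>\<gamma>)"
    using le by (intro nn_integral_mono) (auto simp: indicator_def)
  finally show "emeasure (density \<gamma> f) B \<le> emeasure \<gamma> B" using B s by simp
qed

lemma sigma_finite_radon:
  fixes \<mu> :: "'a::{t2_space, second_countable_topology} measure"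
  assumes lc: "locally_compact_space (euclidean :: 'a topology)" and \<mu>: "radon \<mu>"
  shows "sigma_finite_measure \<mu>"
proof -
  obtain C :: "nat \<Rightarrow> 'a set" where C: "\<And>n. compact (C n)" "(\<Union>n. C n) = UNIV"
    using sigma_compact_lc[OF lc] by metis
  show ?thesis
  proof
    show "\<exists>A. countable A \<and> A \<subseteq> sets \<mu> \<and> \<Union> A = space \<mu> \<and> (\<forall>a\<in>A. emeasure \<mu> a \<noteq> \<infinity>)"
      using C compact_finite_radon[OF \<mu> C(1)] sets_radon[OF \<mu>] space_radon[OF \<mu>]
      by (intro exI[of _ "range C"]) (auto simp: borel_compact less_top)
  qed
qed

lemma msum_commute:
  assumes "sets \<mu> = sets borel" "sets \<nu> = sets borel"
  shows "msum \<mu> \<nu> = msum \<nu> \<mu>"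
  using assms by (intro measure_eqI) (auto simp: emeasure_msum add.commute)

lemma msum_null_right: "sets \<mu> = sets borel \<Longrightarrow> msum \<mu> (null_measure borel) = \<mu>"
  by (intro measure_eqI) (auto simp: emeasure_msum)

lemma msum_null_left: "sets \<mu> = sets borel \<Longrightarrow> msum (null_measure borel) \<mu> = \<mu>"
  by (intro measure_eqI) (auto simp: emeasure_msum)

lemma measure_eqI_sigma_compact:
  fixes \<mu> \<nu> :: "'a::{t2_space, second_countable_topology} measure"
  assumes lc: "locally_compact_space (euclidean :: 'a topology)"
    and s: "sets \<mu> = sets borel" "sets \<nu> = sets borel"
    and eq: "\<And>B K. B \<in> sets borel \<Longrightarrow> compact K \<Longrightarrow> B \<subseteq> K \<Longrightarrow> emeasure \<mu> B = emeasure \<nu> B"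
  shows "\<mu> = \<nu>"
proof (rule measure_eqI)
  obtain C :: "nat \<Rightarrow> 'a set" where C: "\<And>n. compact (C n)" "incseq C" "(\<Union>n. C n) = UNIV"
    using sigma_compact_lc[OF lc] by metis
  have Cb: "C n \<in> sets borel" for n using C(1) borel_compact by blast
  fix B assume "B \<in> sets \<mu>"
  then have B: "B \<in> sets borel" using s by simp
  have "emeasure M B = (SUP n. emeasure M (B \<inter> C n))" if "sets M = sets borel" for M
    using C(2,3) B Cb that by (subst SUP_emeasure_incseq) (auto simp: incseq_def Int_UN_distrib[symmetric])
  moreover have "emeasure \<mu> (B \<inter> C n) = emeasure \<nu> (B \<inter> C n)" for n
    using B Cb C(1) by (intro eq[of _ "C n"]) auto
  ultimately show "emeasure \<mu> B = emeasure \<nu> B"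
    using s by simp
qed (use s in simp)

section \<open>The Jordan decomposition of a difference of Radon measures\<close>

text \<open>
  Uniqueness of the Jordan decomposition. The equation \<open>\<sigma> = \<tau>\<close> is written as an equation between
  sums of positive measures, because infinite values admit no subtraction.
\<close>

lemma signed_eqI:
  assumes \<sigma>: "\<sigma> \<in> signed_radon" and \<tau>: "\<tau> \<in> signed_radon"
    and eq: "msum (pos_part \<sigma>) (neg_part \<tau>) = msum (neg_part \<sigma>) (pos_part \<tau>)"
  shows "\<sigma> = \<tau>"
proof -
  have s: "sets (pos_part \<sigma>) = sets borel" "sets (neg_part \<sigma>) = sets borel"
    "sets (pos_part \<tau>) = sets borel" "sets (neg_part \<tau>) = sets borel"
    using \<sigma> \<tau> sets_radon unfolding signed_radon_def by auto
  have e: "emeasure (pos_part \<sigma>) B + emeasure (neg_part \<tau>) B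
      = emeasure (neg_part \<sigma>) B + emeasure (pos_part \<tau>) B" if "B \<in> sets borel" for B
    using arg_cong[OF eq, of "\<lambda>M. emeasure M B"] that by (simp add: emeasure_msum s)
  \<comment> \<open>If \<open>p\<close> is carried by a set where \<open>n\<close> vanishes, then \<open>p + n' = n + p'\<close> forces \<open>p \<le> p'\<close>.\<close>
  have dom: "emeasure p B \<le> emeasure p' B"
    if sing: "mutually_singular p n" and ss: "sets p = sets borel" "sets n = sets borel" "sets p' = sets borel"
      and e: "\<And>B. B \<in> sets borel \<Longrightarrow> emeasure p B + emeasure n' B = emeasure n B + emeasure p' B"
      and B: "B \<in> sets borel" for p n p' n' :: "'a measure" and B
  proof -
    obtain P where P: "P \<in> sets borel" "emeasure p P = 0" "emeasure n (- P) = 0"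
      using sing unfolding mutually_singular_def by blast
    have Pb: "B - P \<in> sets borel" "B \<inter> P \<in> sets borel" using B P by auto
    have 0: "emeasure p (B \<inter> P) = 0" using P ss Pb by (metis Int_lower2 emeasure_mono le_zero_eq)
    have "- P \<in> sets n" using P ss by (metis borel_comp)
    then have n0: "emeasure n (B - P) = 0"
      using P(3) emeasure_mono[of "B - P" "- P" n] by auto
    have "emeasure p B = emeasure p (B \<inter> P) + emeasure p (B - P)"
      using Pb ss by (subst plus_emeasure) (auto intro!: arg_cong2[where f=emeasure])
    also have "\<dots> \<le> emeasure p (B - P) + emeasure n' (B - P)" using 0 by simp
    also have "\<dots> = emeasure p' (B - P)" using e[OF Pb(1)] n0 by simp
    also have "\<dots> \<le> emeasure p' B" using B ss by (intro emeasure_mono) auto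
    finally show ?thesis .
  qed
  have sing: "mutually_singular (pos_part \<sigma>) (neg_part \<sigma>)" "mutually_singular (pos_part \<tau>) (neg_part \<tau>)"
    using \<sigma> \<tau> unfolding signed_radon_def by auto
  have sing': "mutually_singular n p" if "mutually_singular p n" "sets p = sets borel" for n p :: "'a measure"
    using that unfolding mutually_singular_def by (metis borel_comp double_complement)
  have e': "emeasure (pos_part \<tau>) B + emeasure (neg_part \<sigma>) B
      = emeasure (neg_part \<tau>) B + emeasure (pos_part \<sigma>) B"
    and e1: "emeasure (neg_part \<sigma>) B + emeasure (pos_part \<tau>) B
      = emeasure (pos_part \<sigma>) B + emeasure (neg_part \<tau>) B"
    and e2: "emeasure (neg_part \<tau>) B + emeasure (pos_part \<sigma>) B
      = emeasure (pos_part \<tau>) B + emeasure (neg_part \<sigma>) B" if "B \<in> sets borel" for B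
    using e[OF that] by (simp_all add: add.commute)
  have "emeasure (pos_part \<sigma>) B = emeasure (pos_part \<tau>) B" if "B \<in> sets borel" for B
    using dom[OF sing(1) s(1,2,3) e that] dom[OF sing(2) s(3,4,1) e' that] by (rule antisym)
  moreover have "emeasure (neg_part \<sigma>) B = emeasure (neg_part \<tau>) B" if "B \<in> sets borel" for B
    using dom[OF sing'[OF sing(1) s(1)] s(2,1,4) e1 that] dom[OF sing'[OF sing(2) s(3)] s(4,3,2) e2 that]
    by (rule antisym)
  ultimately have "pos_part \<sigma> = pos_part \<tau>" and "neg_part \<sigma> = neg_part \<tau>"
    using measure_eqI[of "pos_part \<sigma>" "pos_part \<tau>"] measure_eqI[of "neg_part \<sigma>" "neg_part \<tau>"]
    unfolding s by blast+
  then show ?thesis by (simp add: prod_eq_iff)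
qed

text \<open>
  Within a compact set all values are finite, so that \<open>\<alpha>\<close> and \<open>\<beta>\<close> can be cancelled there.
\<close>

lemma radon_diff_unique:
  fixes \<alpha> \<beta> :: "'a::{t2_space, second_countable_topology} measure"
  assumes lc: "locally_compact_space (euclidean :: 'a topology)"
    and \<alpha>: "radon \<alpha>" and \<beta>: "radon \<beta>"
    and \<sigma>: "\<sigma> \<in> signed_radon" "msum \<alpha> (neg_part \<sigma>) = msum \<beta> (pos_part \<sigma>)"
    and \<tau>: "\<tau> \<in> signed_radon" "msum \<alpha> (neg_part \<tau>) = msum \<beta> (pos_part \<tau>)"
  shows "\<sigma> = \<tau>"
proof (rule signed_eqI[OF \<sigma>(1) \<tau>(1)])
  have r: "radon (pos_part \<sigma>)" "radon (neg_part \<sigma>)" "radon (pos_part \<tau>)" "radon (neg_part \<tau>)"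
    using \<sigma>(1) \<tau>(1) unfolding signed_radon_def by auto
  note s = sets_radon[OF \<alpha>] sets_radon[OF \<beta>] r[THEN sets_radon]
  show "msum (pos_part \<sigma>) (neg_part \<tau>) = msum (neg_part \<sigma>) (pos_part \<tau>)"
  proof (rule measure_eqI_sigma_compact[OF lc])
    fix B K :: "'a set" assume B: "B \<in> sets borel" and K: "compact K" "B \<subseteq> K"
    have "emeasure M B < \<infinity>" if "radon M" for M
    proof -
      have "emeasure M B \<le> emeasure M K"
        using sets_radon[OF that] K borel_compact by (intro emeasure_mono) auto
      then show ?thesis using compact_finite_radon[OF that K(1)] by (rule le_less_trans)
    qed
    then have fin: "emeasure \<alpha> B + emeasure \<beta> B \<noteq> \<infinity>" using \<alpha> \<beta> by (simp add: less_top[symmetric])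
    have "emeasure \<alpha> B + emeasure (neg_part \<sigma>) B = emeasure \<beta> B + emeasure (pos_part \<sigma>) B"
      and "emeasure \<alpha> B + emeasure (neg_part \<tau>) B = emeasure \<beta> B + emeasure (pos_part \<tau>) B"
      using arg_cong[OF \<sigma>(2), of "\<lambda>M. emeasure M B"] arg_cong[OF \<tau>(2), of "\<lambda>M. emeasure M B"] B
      by (simp_all add: emeasure_msum s)
    then have "(emeasure \<alpha> B + emeasure \<beta> B) + (emeasure (pos_part \<sigma>) B + emeasure (neg_part \<tau>) B)
        = (emeasure \<alpha> B + emeasure \<beta> B) + (emeasure (neg_part \<sigma>) B + emeasure (pos_part \<tau>) B)"
      by (metis (no_types, opaque_lifting) add.assoc add.commute)
    then show "emeasure (msum (pos_part \<sigma>) (neg_part \<tau>)) B = emeasure (msum (neg_part \<sigma>) (pos_part \<tau>)) B"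
      using fin B by (simp add: emeasure_msum s ennreal_add_left_cancel)
  qed auto
qed

text \<open>
  Let \<open>a\<close> and \<open>b\<close> be the densities of \<open>\<alpha>\<close> and \<open>\<beta>\<close> with respect to their sum. Subtraction of extended
  nonnegative reals is truncated at \<open>0\<close>, so \<open>a - b\<close> and \<open>b - a\<close> are the densities of the two parts,
  and \<open>min a b\<close> is the density of the mass that cancels. The common part \<open>m\<close> is recorded because it
  lets energies and potentials of \<open>\<alpha> - \<beta>\<close> be computed from those of \<open>\<alpha>\<close> and \<open>\<beta>\<close>.
\<close>

lemma jordan_decomposition_ex:
  fixes \<alpha> \<beta> :: "'a::{t2_space, second_countable_topology} measure"
  assumes lc: "locally_compact_space (euclidean :: 'a topology)"
    and \<alpha>: "radon \<alpha>" and \<beta>: "radon \<beta>"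
  shows "\<exists>\<sigma>\<in>signed_radon. \<exists>m. radon m \<and> \<alpha> = msum (pos_part \<sigma>) m \<and> \<beta> = msum (neg_part \<sigma>) m"
proof -
  define \<gamma> where "\<gamma> = msum \<alpha> \<beta>"
  note s = sets_radon[OF \<alpha>] sets_radon[OF \<beta>]
  have s\<gamma>: "sets \<gamma> = sets borel" unfolding \<gamma>_def by simp
  have \<gamma>: "radon \<gamma>" unfolding \<gamma>_def by (rule radon_msum[OF \<alpha> \<beta>])
  interpret \<gamma>: sigma_finite_measure \<gamma> by (rule sigma_finite_radon[OF lc \<gamma>])
  have dens: "\<exists>f\<in>borel_measurable \<gamma>. density \<gamma> f = \<mu> \<and> (AE x in \<gamma>. f x \<noteq> \<infinity>)"
    if \<mu>: "radon \<mu>" and le: "\<And>B. B \<in> sets borel \<Longrightarrow> emeasure \<mu> B \<le> emeasure \<gamma> B" for \<mu>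
  proof -
    have "absolutely_continuous \<gamma> \<mu>"
      unfolding absolutely_continuous_def null_sets_def using le sets_radon[OF \<mu>] s\<gamma>
      by auto (metis le_zero_eq)
    then obtain f where f: "f \<in> borel_measurable \<gamma>" "density \<gamma> f = \<mu>"
      using \<gamma>.Radon_Nikodym[of \<mu>] sets_radon[OF \<mu>] s\<gamma> by auto
    moreover have "AE x in \<gamma>. f x \<noteq> \<infinity>"
      using \<gamma>.sigma_finite_iff_density_finite[OF f(1)] f(2) sigma_finite_radon[OF lc \<mu>] by simp
    ultimately show ?thesis by blast
  qed
  obtain a where a: "a \<in> borel_measurable \<gamma>" "density \<gamma> a = \<alpha>" "AE x in \<gamma>. a x \<noteq> \<infinity>"
    using dens[OF \<alpha>] by (auto simp: \<gamma>_def emeasure_msum s)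
  obtain b where b: "b \<in> borel_measurable \<gamma>" "density \<gamma> b = \<beta>" "AE x in \<gamma>. b x \<noteq> \<infinity>"
    using dens[OF \<beta>] by (auto simp: \<gamma>_def emeasure_msum s)
  note [measurable] = a(1) b(1)
  define p n m where "p = density \<gamma> (\<lambda>x. a x - b x)" and "n = density \<gamma> (\<lambda>x. b x - a x)"
    and "m = density \<gamma> (\<lambda>x. min (a x) (b x))"
  have sp: "sets p = sets borel" "sets n = sets borel" "sets m = sets borel"
    unfolding p_def n_def m_def using s\<gamma> by simp_all
  have am: "(a x - b x) + min (a x) (b x) = a x" and bm: "(b x - a x) + min (a x) (b x) = b x" for x
    by (auto simp: min_def diff_add_cancel_ennreal diff_eq_0_iff_ennreal ennreal_minus_eq_0 not_le top_add less_top
        intro: antisym)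
  have \<alpha>eq: "\<alpha> = msum p m"
  proof (rule measure_eqI)
    fix B assume "B \<in> sets \<alpha>"
    then have B: "B \<in> sets \<gamma>" "B \<in> sets borel" using s s\<gamma> by auto
    show "emeasure \<alpha> B = emeasure (msum p m) B"
      unfolding emeasure_msum[OF sp(1,3) B(2)] unfolding a(2)[symmetric] p_def m_def
      using emeasure_density_add[OF B(1), of "\<lambda>x. a x - b x" "\<lambda>x. min (a x) (b x)"] by (simp add: am)
  qed (use s in simp)
  have \<beta>eq: "\<beta> = msum n m"
  proof (rule measure_eqI)
    fix B assume "B \<in> sets \<beta>"
    then have B: "B \<in> sets \<gamma>" "B \<in> sets borel" using s s\<gamma> by auto
    show "emeasure \<beta> B = emeasure (msum n m) B"
      unfolding emeasure_msum[OF sp(2,3) B(2)] unfolding b(2)[symmetric] n_def m_def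
      using emeasure_density_add[OF B(1), of "\<lambda>x. b x - a x" "\<lambda>x. min (a x) (b x)"] by (simp add: bm)
  qed (use s in simp)
  have "radon p"
    by (rule radon_le[OF lc \<alpha> sp(1)]) (simp add: \<alpha>eq emeasure_msum sp)
  moreover have "radon n"
    by (rule radon_le[OF lc \<beta> sp(2)]) (simp add: \<beta>eq emeasure_msum sp)
  moreover have "radon m"
    by (rule radon_le[OF lc \<alpha> sp(3)]) (simp add: \<alpha>eq emeasure_msum sp)
  moreover have "mutually_singular p n"
    unfolding mutually_singular_def
  proof (intro bexI conjI)
    let ?B = "{x \<in> space \<gamma>. a x \<le> b x}"
    have sp\<gamma>: "space \<gamma> = UNIV" by (rule space_radon[OF \<gamma>])
    have B0: "?B \<in> sets \<gamma>" by measurable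
    then have B: "?B \<in> sets \<gamma>" "- ?B \<in> sets \<gamma>"
      using s\<gamma> borel_comp by auto
    then show "?B \<in> sets borel" using s\<gamma> by simp
    have "emeasure p ?B = (\<integral>\<^sup>+x. (a x - b x) * indicator ?B x \<partial>\<gamma>)"
      unfolding p_def using B by (simp add: emeasure_density)
    also have "\<dots> = (\<integral>\<^sup>+x. 0 \<partial>\<gamma>)"
      using a(3) by (intro nn_integral_cong_AE, eventually_elim)
         (auto simp: indicator_def diff_eq_0_iff_ennreal ennreal_minus_eq_0 less_top)
    finally show "emeasure p ?B = 0" by simp
    have "emeasure n (- ?B) = (\<integral>\<^sup>+x. (b x - a x) * indicator (- ?B) x \<partial>\<gamma>)"
      unfolding n_def using B by (simp add: emeasure_density)
    also have "\<dots> = (\<integral>\<^sup>+x. 0 \<partial>\<gamma>)"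
      using b(3) by (intro nn_integral_cong_AE, eventually_elim)
         (auto simp: indicator_def diff_eq_0_iff_ennreal ennreal_minus_eq_0 less_top sp\<gamma>)
    finally show "emeasure n (- ?B) = 0" by simp
  qed
  ultimately show ?thesis
    using \<alpha>eq \<beta>eq unfolding signed_radon_def by (intro bexI[of _ "(p, n)"]) auto
qed

lemma radon_diff_jordan:
  fixes \<alpha> \<beta> :: "'a::{t2_space, second_countable_topology} measure"
  assumes lc: "locally_compact_space (euclidean :: 'a topology)"
    and \<alpha>: "radon \<alpha>" and \<beta>: "radon \<beta>"
  shows "radon_diff \<alpha> \<beta> \<in> signed_radon"
    and "\<exists>m. radon m \<and> \<alpha> = msum (pos_part (radon_diff \<alpha> \<beta>)) m \<and> \<beta> = msum (neg_part (radon_diff \<alpha> \<beta>)) m"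
proof -
  obtain \<sigma> m where \<sigma>: "\<sigma> \<in> signed_radon" "radon m" "\<alpha> = msum (pos_part \<sigma>) m" "\<beta> = msum (neg_part \<sigma>) m"
    using jordan_decomposition_ex[OF lc \<alpha> \<beta>] by blast
  have s: "sets (pos_part \<sigma>) = sets borel" "sets (neg_part \<sigma>) = sets borel" "sets m = sets borel"
    using \<sigma>(1,2) sets_radon unfolding signed_radon_def by auto
  have eq: "msum \<alpha> (neg_part \<sigma>) = msum \<beta> (pos_part \<sigma>)"
    unfolding \<sigma>(3,4) using s by (intro measure_eqI) (auto simp: emeasure_msum ac_simps)
  have "radon_diff \<alpha> \<beta> = \<sigma>"
    unfolding radon_diff_def
    using \<sigma>(1) eq radon_diff_unique[OF lc \<alpha> \<beta>] by (intro the_equality) auto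
  then show "radon_diff \<alpha> \<beta> \<in> signed_radon"
    and "\<exists>m. radon m \<and> \<alpha> = msum (pos_part (radon_diff \<alpha> \<beta>)) m \<and> \<beta> = msum (neg_part (radon_diff \<alpha> \<beta>)) m"
    using \<sigma> by auto
qed

section \<open>Energies of positive measures\<close>

lemma nn_integral_null_measure_borel [simp]: "(\<integral>\<^sup>+x. f x \<partial>null_measure borel) = 0"
  by (simp add: nn_integral_null_measure)

lemma nn_integral_le_measure:
  assumes "sets \<mu> = sets \<nu>" "\<And>B. B \<in> sets \<nu> \<Longrightarrow> emeasure \<nu> B \<le> emeasure \<mu> B"
  shows "(\<integral>\<^sup>+x. f x \<partial>\<nu>) \<le> (\<integral>\<^sup>+x. f x \<partial>\<mu>)"
  using assms by (intro nn_integral_mono_measure) (auto simp: le_measure)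

abbreviation restrict_to :: "'a::topological_space measure \<Rightarrow> 'a set \<Rightarrow> 'a measure" where
  "restrict_to \<mu> B \<equiv> density \<mu> (indicator B)"

lemma emeasure_restrict_to:
  assumes "sets \<mu> = sets borel" "B \<in> sets borel" "C \<in> sets borel"
  shows "emeasure (restrict_to \<mu> B) C = emeasure \<mu> (B \<inter> C)"
  using assms by (simp add: emeasure_density indicator_inter_arith[symmetric])

lemma nn_integral_restrict_to:
  assumes "sets \<mu> = sets borel" "B \<in> sets borel" "f \<in> borel_measurable borel"
  shows "(\<integral>\<^sup>+x. f x \<partial>restrict_to \<mu> B) = (\<integral>\<^sup>+x. indicator B x * f x \<partial>\<mu>)"
  using assms by (intro nn_integral_density) (auto cong: measurable_cong_sets)

lemma msum_restrict_to:
  assumes "sets \<mu> = sets borel" "B \<in> sets borel"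
  shows "msum (restrict_to \<mu> B) (restrict_to \<mu> (- B)) = \<mu>"
proof (rule measure_eqI)
  fix C assume "C \<in> sets (msum (restrict_to \<mu> B) (restrict_to \<mu> (- B)))"
  then have C: "C \<in> sets borel" by simp
  have "B \<inter> C \<union> - B \<inter> C = C" by blast
  then show "emeasure (msum (restrict_to \<mu> B) (restrict_to \<mu> (- B))) C = emeasure \<mu> C"
    using assms C by (simp add: emeasure_msum emeasure_restrict_to borel_comp plus_emeasure)
qed (use assms in simp)

locale perfect_kernel =
  fixes \<kappa> :: "'a::{t2_space, second_countable_topology} \<Rightarrow> 'a \<Rightarrow> ennreal"
  assumes lc: "locally_compact_space (euclidean :: 'a topology)"
    and perf: "perfect \<kappa>"
begin

abbreviation \<E> where "\<E> \<equiv> finite_energy_pos \<kappa>"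
abbreviation \<E>_on where "\<E>_on \<equiv> finite_energy_on \<kappa>"
abbreviation \<U> where "\<U> \<equiv> pos_potential \<kappa>"
abbreviation \<I> where "\<I> \<equiv> pos_energy \<kappa>"

lemma kernel_sym: "\<kappa> x y = \<kappa> y x"
  and kernel_lsc: "open {p. t < \<kappa> (fst p) (snd p)}"
  using perf unfolding perfect_def kernel_def by auto

lemma kernel_measurable_borel: "(\<lambda>p. \<kappa> (fst p) (snd p)) \<in> borel_measurable borel"
  by (rule borel_measurableI_greater) (simp add: borel_open kernel_lsc)

lemma kernel_measurable:
  assumes "sets \<mu> = sets borel" "sets \<nu> = sets borel"
  shows "(\<lambda>p. \<kappa> (fst p) (snd p)) \<in> borel_measurable (\<mu> \<Otimes>\<^sub>M \<nu>)"
  using kernel_measurable_borel unfolding measurable_cong_sets[OF sets_pair_measure_cong[OF assms] refl] borel_prod .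

lemma kernel_section_measurable: "\<kappa> x \<in> borel_measurable borel"
  using measurable_compose[OF measurable_Pair1'[of x borel borel] kernel_measurable[OF refl refl]] by simp

lemma kernel_section_lsc: "open {y. t < \<kappa> x y}"
proof -
  have "{y. t < \<kappa> x y} = (\<lambda>y. (x, y)) -` {p. t < \<kappa> (fst p) (snd p)}" by auto
  then show ?thesis
    using open_vimage[OF kernel_lsc, of "\<lambda>y. (x, y)"] by (simp add: continuous_intros)
qed

text \<open>Fatou's lemma makes a potential inherit the lower semicontinuity of the kernel.\<close>

lemma pos_potential_lsc:
  assumes \<mu>: "radon \<mu>"
  shows "open {x. t < \<U> \<mu> x}"
proof -
  have "closed {x. \<U> \<mu> x \<le> t}"
    unfolding closed_sequential_limits
  proof (intro allI impI, elim conjE)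
    fix X and l :: 'a assume X: "\<forall>n. X n \<in> {x. \<U> \<mu> x \<le> t}" and lim: "X \<longlonglongrightarrow> l"
    have "\<kappa> l y \<le> liminf (\<lambda>n. \<kappa> (X n) y)" for y
      unfolding le_Liminf_iff
    proof (intro allI impI)
      fix s assume "s < \<kappa> l y"
      then have "l \<in> {x. s < \<kappa> y x}" by (simp add: kernel_sym)
      then show "\<forall>\<^sub>F n in sequentially. s < \<kappa> (X n) y"
        using lim kernel_section_lsc[of s y] unfolding tendsto_def by (force simp: kernel_sym elim: eventually_mono)
    qed
    then have "\<U> \<mu> l \<le> (\<integral>\<^sup>+y. liminf (\<lambda>n. \<kappa> (X n) y) \<partial>\<mu>)"
      unfolding pos_potential_def by (intro nn_integral_mono)
    also have "\<dots> \<le> liminf (\<lambda>n. \<U> \<mu> (X n))"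
      unfolding pos_potential_def using kernel_section_measurable sets_radon[OF \<mu>]
      by (intro nn_integral_liminf) (simp cong: measurable_cong_sets)
    also have "\<dots> \<le> t" using X by (intro Liminf_le) auto
    finally show "l \<in> {x. \<U> \<mu> x \<le> t}" by simp
  qed
  moreover have "{x. t < \<U> \<mu> x} = - {x. \<U> \<mu> x \<le> t}" by auto
  ultimately show ?thesis by (simp add: open_Compl)
qed

lemma pos_potential_measurable:
  assumes "radon \<mu>" shows "\<U> \<mu> \<in> borel_measurable borel"
  by (rule borel_measurableI_greater) (simp add: borel_open pos_potential_lsc[OF assms])

lemma pos_potential_measurable':
  assumes "radon \<mu>" "sets \<nu> = sets borel" shows "\<U> \<mu> \<in> borel_measurable \<nu>"
  using pos_potential_measurable[OF assms(1)] assms(2) by (simp cong: measurable_cong_sets)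

lemma pos_energy_eq:
  assumes \<mu>: "radon \<mu>" and \<nu>: "radon \<nu>"
  shows "\<I> \<mu> \<nu> = (\<integral>\<^sup>+x. \<U> \<nu> x \<partial>\<mu>)"
  using sigma_finite_measure.nn_integral_fst[OF sigma_finite_radon[OF lc \<nu>]
      kernel_measurable[OF sets_radon[OF \<mu>] sets_radon[OF \<nu>]]]
  unfolding pos_energy_def pos_potential_def by simp

lemma pos_energy_commute:
  assumes \<mu>: "radon \<mu>" and \<nu>: "radon \<nu>"
  shows "\<I> \<mu> \<nu> = \<I> \<nu> \<mu>"
proof -
  interpret pair_sigma_finite \<mu> \<nu>
    using sigma_finite_radon[OF lc] \<mu> \<nu> by (simp add: pair_sigma_finite_def)
  have "case_prod \<kappa> \<in> borel_measurable (\<mu> \<Otimes>\<^sub>M \<nu>)"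
    using kernel_measurable[OF sets_radon[OF \<mu>] sets_radon[OF \<nu>]] by (simp add: case_prod_beta')
  from Fubini'[OF this] show ?thesis
    unfolding pos_energy_eq[OF \<mu> \<nu>] pos_energy_eq[OF \<nu> \<mu>] pos_potential_def
    by (simp add: kernel_sym)
qed

lemma pos_potential_msum:
  assumes "radon \<mu>" "radon \<nu>"
  shows "\<U> (msum \<mu> \<nu>) x = \<U> \<mu> x + \<U> \<nu> x"
  unfolding pos_potential_def using assms kernel_section_measurable by (intro nn_integral_msum) (auto simp: sets_radon)

lemma pos_energy_msum_left:
  assumes "radon \<mu>" "radon \<nu>" "radon \<rho>"
  shows "\<I> (msum \<mu> \<nu>) \<rho> = \<I> \<mu> \<rho> + \<I> \<nu> \<rho>"
  using assms by (simp add: pos_energy_eq radon_msum nn_integral_msum sets_radon pos_potential_measurable)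

lemma pos_energy_msum_right:
  assumes "radon \<mu>" "radon \<nu>" "radon \<rho>"
  shows "\<I> \<rho> (msum \<mu> \<nu>) = \<I> \<rho> \<mu> + \<I> \<rho> \<nu>"
  using assms by (metis pos_energy_commute pos_energy_msum_left radon_msum)

lemma pos_energy_scale_left:
  assumes "radon \<mu>" "radon \<nu>"
  shows "\<I> (scale_measure (ennreal t) \<mu>) \<nu> = ennreal t * \<I> \<mu> \<nu>"
  using assms by (simp add: pos_energy_eq radon_scale nn_integral_scale_measure pos_potential_measurable' sets_radon)

lemma pos_energy_scale_right:
  assumes "radon \<mu>" "radon \<nu>"
  shows "\<I> \<nu> (scale_measure (ennreal t) \<mu>) = ennreal t * \<I> \<nu> \<mu>"
  using assms by (metis pos_energy_commute pos_energy_scale_left radon_scale)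

lemma pos_energy_null [simp]:
  assumes "radon \<mu>"
  shows "\<I> (null_measure borel) \<mu> = 0" "\<I> \<mu> (null_measure borel) = 0"
  using assms by (simp_all add: pos_energy_eq radon_null pos_potential_def)

lemma of_pos_signed_radon: "radon \<mu> \<Longrightarrow> of_pos \<mu> \<in> signed_radon"
  unfolding signed_radon_def of_pos_def mutually_singular_def
  by (auto simp: radon_null intro!: bexI[of _ "{}"])

lemma finite_energy_pos_iff: "\<mu> \<in> \<E> \<longleftrightarrow> radon \<mu> \<and> \<I> \<mu> \<mu> < \<infinity>"
proof (cases "radon \<mu>")
  case True
  then have "energy_plus \<kappa> (of_pos \<mu>) = \<I> \<mu> \<mu>" "energy_minus \<kappa> (of_pos \<mu>) = 0"
    unfolding energy_plus_def energy_minus_def of_pos_def by (simp_all add: radon_null)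
  then show ?thesis using True of_pos_signed_radon[OF True]
    unfolding finite_energy_pos_def finite_energy_def energy_defined_def energy_def
    by (cases "\<I> \<mu> \<mu>") (auto simp: zero_ennreal.rep_eq)
qed (simp add: finite_energy_pos_def)

lemma radon_finite_energy_pos: "\<mu> \<in> \<E> \<Longrightarrow> radon \<mu>"
  by (simp add: finite_energy_pos_iff)

lemma finite_energy_parts:
  assumes "\<sigma> \<in> finite_energy \<kappa>"
  shows "pos_part \<sigma> \<in> \<E>" "neg_part \<sigma> \<in> \<E>"
proof -
  have "\<sigma> \<in> signed_radon" and d: "energy_defined \<kappa> \<sigma>" and f: "\<bar>energy \<kappa> \<sigma>\<bar> \<noteq> \<infinity>"
    using assms unfolding finite_energy_def by auto
  then have r: "radon (pos_part \<sigma>)" "radon (neg_part \<sigma>)" unfolding signed_radon_def by auto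
  have "energy_plus \<kappa> \<sigma> < \<infinity>"
    using d f unfolding energy_defined_def energy_def
    by (cases "energy_plus \<kappa> \<sigma>"; cases "energy_minus \<kappa> \<sigma>") auto
  then show "pos_part \<sigma> \<in> \<E>" "neg_part \<sigma> \<in> \<E>"
    unfolding finite_energy_pos_iff energy_plus_def using r by (auto simp: less_top)
qed

lemma finite_energy_pos_msum_imp:
  assumes "radon \<mu>" "radon \<nu>" "msum \<mu> \<nu> \<in> \<E>"
  shows "\<I> \<mu> \<mu> < \<infinity>" "\<I> \<mu> \<nu> < \<infinity>" "\<I> \<nu> \<mu> < \<infinity>" "\<I> \<nu> \<nu> < \<infinity>"
  using assms by (auto simp: finite_energy_pos_iff pos_energy_msum_left pos_energy_msum_right radon_msum less_top)

lemma finite_energy_pos_le: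
  assumes \<mu>: "\<mu> \<in> \<E>" and s: "sets \<nu> = sets borel"
    and le: "\<And>B. B \<in> sets borel \<Longrightarrow> emeasure \<nu> B \<le> emeasure \<mu> B"
  shows "\<nu> \<in> \<E>"
proof -
  have r\<mu>: "radon \<mu>" using \<mu> by (rule radon_finite_energy_pos)
  have r: "radon \<nu>" by (rule radon_le[OF lc r\<mu> s le])
  have le': "(\<integral>\<^sup>+x. f x \<partial>\<nu>) \<le> (\<integral>\<^sup>+x. f x \<partial>\<mu>)" for f
    using s sets_radon[OF r\<mu>] le by (intro nn_integral_le_measure) auto
  have "\<I> \<nu> \<nu> \<le> \<I> \<nu> \<mu>"
    unfolding pos_energy_eq[OF r r] pos_energy_eq[OF r r\<mu>] pos_potential_def
    by (intro nn_integral_mono le')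
  also have "\<dots> \<le> \<I> \<mu> \<mu>"
    unfolding pos_energy_eq[OF r r\<mu>] pos_energy_eq[OF r\<mu> r\<mu>] by (rule le')
  finally show ?thesis using \<mu> r by (auto simp: finite_energy_pos_iff intro: le_less_trans)
qed

lemma finite_energy_pos_restrict:
  assumes \<mu>: "\<mu> \<in> \<E>" and B: "B \<in> sets borel"
  shows "restrict_to \<mu> B \<in> \<E>"
proof (rule finite_energy_pos_le[OF \<mu>])
  note s = sets_radon[OF radon_finite_energy_pos[OF \<mu>]]
  show "sets (restrict_to \<mu> B) = sets borel" using s by simp
  show "emeasure (restrict_to \<mu> B) C \<le> emeasure \<mu> C" if "C \<in> sets borel" for C
    using that s B by (auto simp: emeasure_restrict_to intro: emeasure_mono)
qed

section \<open>The pre-Hilbert structure of measures of finite energy\<close>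

definition mutual :: "'a measure \<Rightarrow> 'a measure \<Rightarrow> real" where
  "mutual \<mu> \<nu> = enn2real (\<I> \<mu> \<nu>)"

text \<open>
  The squared norm of \<open>\<mu> - \<nu>\<close>, expanded so that no signed measure has to be formed.
\<close>

definition sqdist :: "'a measure \<Rightarrow> 'a measure \<Rightarrow> real" where
  "sqdist \<mu> \<nu> = mutual \<mu> \<mu> + mutual \<nu> \<nu> - 2 * mutual \<mu> \<nu>"

lemma mutual_nonneg: "0 \<le> mutual \<mu> \<nu>"
  by (simp add: mutual_def)

text \<open>
  Positive definiteness only speaks about signed measures whose energy is defined, so the finiteness
  of the mutual energy of \<open>\<mu>\<close> and \<open>\<nu>\<close> is part of the claim. It is read off from the Jordan
  decomposition \<open>\<mu> = p + m\<close>, \<open>\<nu> = n + m\<close> of the difference: \<open>p\<close>, \<open>n\<close> and \<open>m\<close> have finite energy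
  because they are dominated by \<open>\<mu>\<close> or \<open>\<nu>\<close>, hence the energy of \<open>p - n\<close> is defined, and an infinite
  mutual energy of \<open>p\<close> and \<open>n\<close> would make it \<open>-\<infinity>\<close>.
\<close>

lemma energy_radon_diff:
  assumes \<mu>: "\<mu> \<in> \<E>" and \<nu>: "\<nu> \<in> \<E>"
  shows "\<I> \<mu> \<nu> < \<infinity>"
    and "energy \<kappa> (radon_diff \<mu> \<nu>) = ereal (sqdist \<mu> \<nu>)"
    and "0 \<le> sqdist \<mu> \<nu>"
    and "sqdist \<mu> \<nu> = 0 \<Longrightarrow> \<mu> = \<nu>"
proof -
  have r\<mu>: "radon \<mu>" and r\<nu>: "radon \<nu>" using \<mu> \<nu> by (simp_all add: finite_energy_pos_iff)
  define \<sigma> where "\<sigma> = radon_diff \<mu> \<nu>"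
  define p n where "p = pos_part \<sigma>" and "n = neg_part \<sigma>"
  obtain m where m: "radon m" "\<mu> = msum p m" "\<nu> = msum n m"
    using radon_diff_jordan(2)[OF lc r\<mu> r\<nu>] unfolding p_def n_def \<sigma>_def by blast
  have \<sigma>: "\<sigma> \<in> signed_radon" unfolding \<sigma>_def by (rule radon_diff_jordan(1)[OF lc r\<mu> r\<nu>])
  then have rp: "radon p" and rn: "radon n" unfolding signed_radon_def p_def n_def by auto
  note fp = finite_energy_pos_msum_imp[OF rp m(1) \<mu>[unfolded m(2)]]
  note fn = finite_energy_pos_msum_imp[OF rn m(1) \<nu>[unfolded m(3)]]
  have ep: "energy_plus \<kappa> \<sigma> = \<I> p p + \<I> n n"
    and em: "energy_minus \<kappa> \<sigma> = \<I> p n + \<I> n p"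
    unfolding energy_plus_def energy_minus_def p_def n_def by simp_all
  have fin: "energy_plus \<kappa> \<sigma> < \<infinity>" using fp fn unfolding ep by simp
  then have d: "energy_defined \<kappa> \<sigma>" unfolding energy_defined_def by simp
  have spd: "0 \<le> energy \<kappa> \<sigma>" "energy \<kappa> \<sigma> = 0 \<Longrightarrow> \<sigma> = zero_signed"
    using perf \<sigma> d unfolding perfect_def strictly_positive_definite_def by auto
  have "energy_minus \<kappa> \<sigma> < \<infinity>"
    using spd(1) fin unfolding energy_def by (cases "energy_plus \<kappa> \<sigma>"; cases "energy_minus \<kappa> \<sigma>") auto
  then have pn: "\<I> p n < \<infinity>" unfolding em by simp
  have I: "\<I> \<mu> \<nu> = \<I> p n + \<I> p m + (\<I> m n + \<I> m m)"
    "\<I> \<mu> \<mu> = \<I> p p + \<I> p m + (\<I> p m + \<I> m m)"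
    "\<I> \<nu> \<nu> = \<I> n n + \<I> m n + (\<I> m n + \<I> m m)"
    unfolding m(2,3) using rp rn m(1)
    by (simp_all add: pos_energy_msum_left pos_energy_msum_right radon_msum pos_energy_commute[of m p] pos_energy_commute[of n m])
  show "\<I> \<mu> \<nu> < \<infinity>" unfolding I using pn fp fn by simp
  have real: "\<I> a b = ennreal (mutual a b)" if "\<I> a b < \<infinity>" for a b
    using that unfolding mutual_def by simp
  have "mutual \<mu> \<nu> = mutual p n + mutual p m + (mutual m n + mutual m m)"
    "mutual \<mu> \<mu> = mutual p p + mutual p m + (mutual p m + mutual m m)"
    "mutual \<nu> \<nu> = mutual n n + mutual m n + (mutual m n + mutual m m)"
    unfolding mutual_def I using pn fp fn by (simp_all add: enn2real_plus less_top)
  then have sq: "sqdist \<mu> \<nu> = mutual p p + mutual n n - 2 * mutual p n"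
    unfolding sqdist_def by simp
  have "energy \<kappa> \<sigma> = ereal (mutual p p + mutual n n - 2 * mutual p n)"
    unfolding energy_def ep em pos_energy_commute[OF rn rp] using fp fn pn
    by (simp add: real ennreal_plus[symmetric] mutual_nonneg del: ennreal_plus)
  then show e: "energy \<kappa> (radon_diff \<mu> \<nu>) = ereal (sqdist \<mu> \<nu>)" using sq \<sigma>_def by simp
  then show "0 \<le> sqdist \<mu> \<nu>" using spd(1) \<sigma>_def by simp
  assume "sqdist \<mu> \<nu> = 0"
  then have "\<sigma> = zero_signed" using spd(2) e \<sigma>_def by (simp add: zero_ereal_def)
  then have "p = n" unfolding p_def n_def zero_signed_def by simp
  then show "\<mu> = \<nu>" using m by simp
qed

lemma pos_energy_mutual:
  "\<mu> \<in> \<E> \<Longrightarrow> \<nu> \<in> \<E> \<Longrightarrow> \<I> \<mu> \<nu> = ennreal (mutual \<mu> \<nu>)"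
  using energy_radon_diff(1) unfolding mutual_def by simp

lemma mutual_commute:
  "\<mu> \<in> \<E> \<Longrightarrow> \<nu> \<in> \<E> \<Longrightarrow> mutual \<mu> \<nu> = mutual \<nu> \<mu>"
  unfolding mutual_def using pos_energy_commute radon_finite_energy_pos by metis

lemma finite_energy_pos_msum:
  assumes "\<mu> \<in> \<E>" "\<nu> \<in> \<E>"
  shows "msum \<mu> \<nu> \<in> \<E>"
proof -
  have r: "radon \<mu>" "radon \<nu>" using assms by (auto simp: finite_energy_pos_iff)
  then show ?thesis using assms energy_radon_diff(1)[OF assms] energy_radon_diff(1)[OF assms(2,1)]
    by (simp add: finite_energy_pos_iff radon_msum pos_energy_msum_left pos_energy_msum_right)
qed

lemma finite_energy_pos_scale:
  assumes "\<mu> \<in> \<E>"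
  shows "scale_measure (ennreal t) \<mu> \<in> \<E>"
  using assms
  by (simp add: finite_energy_pos_iff radon_scale pos_energy_scale_left pos_energy_scale_right ennreal_mult_less_top)

lemma finite_energy_pos_null: "null_measure borel \<in> \<E>"
  by (simp add: finite_energy_pos_iff radon_null)

lemma mutual_msum:
  assumes "\<mu> \<in> \<E>" "\<nu> \<in> \<E>" "\<rho> \<in> \<E>"
  shows "mutual (msum \<mu> \<nu>) \<rho> = mutual \<mu> \<rho> + mutual \<nu> \<rho>"
    and "mutual \<rho> (msum \<mu> \<nu>) = mutual \<rho> \<mu> + mutual \<rho> \<nu>"
  using assms energy_radon_diff(1)
  by (simp_all add: mutual_def pos_energy_msum_left pos_energy_msum_right radon_finite_energy_pos enn2real_plus less_top)

lemma mutual_scale: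
  assumes "\<mu> \<in> \<E>" "\<rho> \<in> \<E>" "0 \<le> t"
  shows "mutual (scale_measure (ennreal t) \<mu>) \<rho> = t * mutual \<mu> \<rho>"
    and "mutual \<rho> (scale_measure (ennreal t) \<mu>) = t * mutual \<rho> \<mu>"
  using assms
  by (simp_all add: mutual_def pos_energy_scale_left pos_energy_scale_right radon_finite_energy_pos enn2real_mult)

lemma mutual_null [simp]:
  assumes "\<mu> \<in> \<E>"
  shows "mutual (null_measure borel) \<mu> = 0" "mutual \<mu> (null_measure borel) = 0"
  using assms by (simp_all add: mutual_def radon_finite_energy_pos)

lemma sqdist_commute:
  "\<mu> \<in> \<E> \<Longrightarrow> \<nu> \<in> \<E> \<Longrightarrow> sqdist \<mu> \<nu> = sqdist \<nu> \<mu>"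
  unfolding sqdist_def by (simp add: mutual_commute)

lemma abs_le_of_quadratic_nonneg:
  fixes x b z :: real
  assumes "\<And>t. 0 \<le> t \<Longrightarrow> 0 \<le> x * t\<^sup>2 - 2 * b * t + z" and "0 \<le> b" "0 \<le> x"
  shows "b\<^sup>2 \<le> x * z"
proof (cases "x = 0")
  case True
  have z: "0 \<le> z" using assms(1)[of 0] by simp
  have "b = 0"
  proof (rule ccontr)
    assume "b \<noteq> 0"
    then have "0 \<le> - 2 * b * ((z + 1) / b) + z" using assms(1)[of "(z + 1) / b"] assms(2) z True by simp
    then show False using \<open>b \<noteq> 0\<close> z by simp
  qed
  then show ?thesis using True by simp
next
  case False
  then have x: "0 < x" using assms(3) by simp
  have "0 \<le> x * (b / x)\<^sup>2 - 2 * b * (b / x) + z" using assms(1)[of "b / x"] assms(2) x by simp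
  also have "\<dots> = z - b\<^sup>2 / x" using x by (simp add: power2_eq_square field_simps)
  finally show ?thesis using x by (simp add: field_simps)
qed

text \<open>
  The discriminant argument for the signed measures \<open>a - b\<close> and \<open>c - d\<close>. Positive measures can only
  be multiplied by nonnegative scalars, so a negative parameter is replaced by swapping \<open>c\<close> and \<open>d\<close>.
\<close>

lemma Cauchy_Schwarz_pairs:
  assumes a: "a \<in> \<E>" and b: "b \<in> \<E>"
    and c: "c \<in> \<E>" and d: "d \<in> \<E>"
  shows "(mutual a c - mutual a d - mutual b c + mutual b d)\<^sup>2 \<le> sqdist a b * sqdist c d"
proof -
  have key: "0 \<le> sqdist a b * t\<^sup>2 + 2 * (mutual a u - mutual a v - mutual b u + mutual b v) * t + sqdist u v"
    if t: "0 \<le> t" and u: "u \<in> \<E>" and v: "v \<in> \<E>" for t u v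
  proof -
    define at' bt where "at' = scale_measure (ennreal t) a" and "bt = scale_measure (ennreal t) b"
    have E: "at' \<in> \<E>" "bt \<in> \<E>"
      unfolding at'_def bt_def using a b by (auto intro: finite_energy_pos_scale)
    have m: "mutual at' w = t * mutual a w" "mutual bt w = t * mutual b w"
        "mutual w at' = t * mutual w a" "mutual w bt = t * mutual w b" if "w \<in> \<E>" for w
      unfolding at'_def bt_def using a b t that by (auto simp: mutual_scale)
    have "0 \<le> sqdist (msum at' u) (msum bt v)"
      using E u v by (intro energy_radon_diff(3) finite_energy_pos_msum)
    also have "\<dots> = sqdist a b * t\<^sup>2 + 2 * (mutual a u - mutual a v - mutual b u + mutual b v) * t + sqdist u v"
      unfolding sqdist_def using E u v a b
      by (simp add: mutual_msum finite_energy_pos_msum m mutual_commute[of u a] mutual_commute[of v b]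
          mutual_commute[of u b] mutual_commute[of v a] mutual_commute[of b a] algebra_simps power2_eq_square)
    finally show ?thesis .
  qed
  define B where "B = mutual a c - mutual a d - mutual b c + mutual b d"
  have "\<bar>B\<bar>\<^sup>2 \<le> sqdist a b * sqdist c d"
  proof (rule abs_le_of_quadratic_nonneg)
    fix t :: real assume t: "0 \<le> t"
    show "0 \<le> sqdist a b * t\<^sup>2 - 2 * \<bar>B\<bar> * t + sqdist c d"
      using key[OF t c d] key[OF t d c] sqdist_commute[OF c d] unfolding B_def
      by (auto simp: abs_if algebra_simps)
  qed (use energy_radon_diff(3)[OF a b] in auto)
  then show ?thesis unfolding B_def by simp
qed

lemma Cauchy_Schwarz:
  assumes "a \<in> \<E>" "b \<in> \<E>"
  shows "(mutual a b)\<^sup>2 \<le> mutual a a * mutual b b"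
  using Cauchy_Schwarz_pairs[OF assms(1) finite_energy_pos_null assms(2) finite_energy_pos_null] assms
  by (simp add: sqdist_def finite_energy_pos_null)

lemma mutual_diff_bound:
  assumes "a \<in> \<E>" "b \<in> \<E>" "c \<in> \<E>"
  shows "\<bar>mutual a c - mutual b c\<bar> \<le> sqrt (sqdist a b) * sqrt (mutual c c)"
proof -
  have "(mutual a c - mutual b c)\<^sup>2 \<le> sqdist a b * mutual c c"
    using Cauchy_Schwarz_pairs[OF assms(1,2,3) finite_energy_pos_null] assms
    by (simp add: sqdist_def finite_energy_pos_null)
  then have "sqrt ((mutual a c - mutual b c)\<^sup>2) \<le> sqrt (sqdist a b * mutual c c)"
    by (rule real_sqrt_le_mono)
  then show ?thesis by (simp add: real_sqrt_mult)
qed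

lemma strong_dist_eq:
  assumes \<sigma>: "\<sigma> \<in> finite_energy \<kappa>" and \<tau>: "\<tau> \<in> finite_energy \<kappa>"
  shows "strong_dist \<kappa> \<sigma> \<tau>
    = sqrt (sqdist (msum (pos_part \<sigma>) (neg_part \<tau>)) (msum (neg_part \<sigma>) (pos_part \<tau>)))"
  using assms energy_radon_diff(2) finite_energy_pos_msum finite_energy_parts[OF \<sigma>] finite_energy_parts[OF \<tau>]
  unfolding strong_dist_def strong_norm_def signed_diff_def by simp

lemma Metric_space_strong: "Metric_space (finite_energy \<kappa>) (strong_dist \<kappa>)"
proof
  fix \<sigma> \<tau> \<rho> :: "'a signed"
  have part: "pos_part \<sigma> \<in> \<E>" "neg_part \<sigma> \<in> \<E>"
    if "\<sigma> \<in> finite_energy \<kappa>" for \<sigma> using finite_energy_parts[OF that] .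
  note ms = finite_energy_pos_msum
  show "0 \<le> strong_dist \<kappa> \<sigma> \<tau>"
    using strong_dist_eq[of \<sigma> \<tau>] energy_radon_diff(3) part ms
    by (cases "\<sigma> \<in> finite_energy \<kappa> \<and> \<tau> \<in> finite_energy \<kappa>") (auto simp: strong_dist_def[of _ \<sigma>])
  show "strong_dist \<kappa> \<sigma> \<tau> = strong_dist \<kappa> \<tau> \<sigma>"
  proof (cases "\<sigma> \<in> finite_energy \<kappa> \<and> \<tau> \<in> finite_energy \<kappa>")
    case True
    then show ?thesis
      using part[of \<sigma>] part[of \<tau>] ms
      by (simp add: strong_dist_eq sqdist_commute[of "msum (pos_part \<sigma>) (neg_part \<tau>)"]
          msum_commute[OF sets_radon[OF radon_finite_energy_pos] sets_radon[OF radon_finite_energy_pos], of "pos_part \<tau>"]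
          msum_commute[OF sets_radon[OF radon_finite_energy_pos] sets_radon[OF radon_finite_energy_pos], of "neg_part \<tau>"])
  qed (auto simp: strong_dist_def)
  assume \<sigma>: "\<sigma> \<in> finite_energy \<kappa>" and \<tau>: "\<tau> \<in> finite_energy \<kappa>"
  show "strong_dist \<kappa> \<sigma> \<tau> = 0 \<longleftrightarrow> \<sigma> = \<tau>"
  proof
    assume "strong_dist \<kappa> \<sigma> \<tau> = 0"
    then have "msum (pos_part \<sigma>) (neg_part \<tau>) = msum (neg_part \<sigma>) (pos_part \<tau>)"
      using part[OF \<sigma>] part[OF \<tau>] ms by (intro energy_radon_diff(4)) (auto simp: strong_dist_eq[OF \<sigma> \<tau>])
    then show "\<sigma> = \<tau>" using \<sigma> \<tau> signed_eqI unfolding finite_energy_def by blast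
  next
    assume "\<sigma> = \<tau>"
    then show "strong_dist \<kappa> \<sigma> \<tau> = 0"
      using part[OF \<tau>] \<tau>
      by (simp add: strong_dist_eq sqdist_def
          msum_commute[OF sets_radon[OF radon_finite_energy_pos] sets_radon[OF radon_finite_energy_pos], of "pos_part \<tau>"])
  qed
  assume \<rho>: "\<rho> \<in> finite_energy \<kappa>"
  \<comment> \<open>The pairs \<open>(a, b)\<close>, \<open>(c, d)\<close> and \<open>(e, f)\<close> represent \<open>\<sigma> - \<tau>\<close>, \<open>\<tau> - \<rho>\<close> and their sum \<open>\<sigma> - \<rho>\<close>.\<close>
  define a b c d e f where "a = msum (pos_part \<sigma>) (neg_part \<tau>)" and "b = msum (neg_part \<sigma>) (pos_part \<tau>)"
    and "c = msum (pos_part \<tau>) (neg_part \<rho>)" and "d = msum (neg_part \<tau>) (pos_part \<rho>)"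
    and "e = msum (pos_part \<sigma>) (neg_part \<rho>)" and "f = msum (neg_part \<sigma>) (pos_part \<rho>)"
  have E: "a \<in> \<E>" "b \<in> \<E>" "c \<in> \<E>"
      "d \<in> \<E>" "e \<in> \<E>" "f \<in> \<E>"
    unfolding a_def b_def c_def d_def e_def f_def using part \<sigma> \<tau> \<rho> ms by auto
  define B where "B = mutual a c - mutual a d - mutual b c + mutual b d"
  note p = part[OF \<sigma>] part[OF \<tau>] part[OF \<rho>]
  have "sqdist e f = sqdist a b + sqdist c d + 2 * B"
    unfolding sqdist_def B_def unfolding a_def b_def c_def d_def e_def f_def using p
    by (simp add: mutual_msum ms mutual_commute)
  moreover have "B \<le> sqrt (sqdist a b) * sqrt (sqdist c d)"
    using Cauchy_Schwarz_pairs[OF E(1,2,3,4)] real_le_rsqrt unfolding B_def real_sqrt_mult[symmetric] by blast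
  ultimately have "sqdist e f \<le> (sqrt (sqdist a b) + sqrt (sqdist c d))\<^sup>2"
    using energy_radon_diff(3)[OF E(1,2)] energy_radon_diff(3)[OF E(3,4)] by (simp add: power2_sum)
  then have "sqrt (sqdist e f) \<le> sqrt (sqdist a b) + sqrt (sqdist c d)"
    using energy_radon_diff(3)[OF E(1,2)] energy_radon_diff(3)[OF E(3,4)] by (intro real_le_lsqrt) auto
  then show "strong_dist \<kappa> \<sigma> \<rho> \<le> strong_dist \<kappa> \<sigma> \<tau> + strong_dist \<kappa> \<tau> \<rho>"
    unfolding strong_dist_eq[OF \<sigma> \<tau>] strong_dist_eq[OF \<sigma> \<rho>] strong_dist_eq[OF \<tau> \<rho>]
      a_def b_def c_def d_def e_def f_def .
qed

end

section \<open>Strong convergence and the vague topology\<close>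

lemma radon_inner_sigma_compact:
  fixes \<mu> :: "'a::{t2_space, second_countable_topology} measure"
  assumes lc: "locally_compact_space (euclidean :: 'a topology)"
    and \<mu>: "radon \<mu>" and B: "B \<in> sets borel"
  obtains C :: "nat \<Rightarrow> 'a set"
  where "\<And>n. compact (C n)" "\<And>n. C n \<subseteq> B" "incseq C" "AE x in \<mu>. x \<in> B \<longrightarrow> x \<in> (\<Union>n. C n)"
proof -
  obtain X :: "nat \<Rightarrow> 'a set" where X: "\<And>n. compact (X n)" "incseq X" "(\<Union>n. X n) = UNIV"
    using sigma_compact_lc[OF lc] by metis
  have Xb: "X n \<in> sets borel" for n using X(1) borel_compact by blast
  note s = sets_radon[OF \<mu>]
  have fin: "emeasure \<mu> (B \<inter> X k) < \<infinity>" for k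
    using emeasure_mono[of "B \<inter> X k" "X k" \<mu>] Xb s compact_finite_radon[OF \<mu> X(1)[of k]] by auto
  have "\<exists>K. compact K \<and> K \<subseteq> B \<inter> X k \<and> emeasure \<mu> (B \<inter> X k) < emeasure \<mu> K + ennreal (1 / Suc j)" for k j
  proof -
    have "\<exists>K\<in>{K. compact K \<and> K \<subseteq> B \<inter> X k}. emeasure \<mu> (B \<inter> X k) < emeasure \<mu> K + ennreal (1 / Suc j)"
    proof (rule SUP_approx_ennreal)
      show "{K. compact K \<and> K \<subseteq> B \<inter> X k} \<noteq> {}" by (auto intro: exI[of _ "{}"])
      show "emeasure \<mu> (B \<inter> X k) = (SUP K\<in>{K. compact K \<and> K \<subseteq> B \<inter> X k}. emeasure \<mu> K)"
        using \<mu> B Xb unfolding radon_def by blast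
    qed (use fin[of k] in auto)
    then show ?thesis by blast
  qed
  then obtain K where K: "\<And>k j. compact (K k j)" "\<And>k j. K k j \<subseteq> B \<inter> X k"
      "\<And>k j. emeasure \<mu> (B \<inter> X k) < emeasure \<mu> (K k j) + ennreal (1 / Suc j)"
    by metis
  have Kb: "K k j \<in> sets borel" for k j using K(1) borel_compact by blast
  define C where "C n = (\<Union>k\<le>n. \<Union>j\<le>n. K k j)" for n
  show thesis
  proof
    show "compact (C n)" for n unfolding C_def using K(1) by auto
    show "C n \<subseteq> B" for n unfolding C_def using K(2) by blast
    show "incseq C" unfolding C_def incseq_def by (auto intro: order_trans)
    have Cb: "(\<Union>n. C n) \<in> sets borel" unfolding C_def using Kb by auto
    have null: "emeasure \<mu> (B \<inter> X k - (\<Union>n. C n)) = 0" for k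
    proof (rule ccontr)
      let ?D = "B \<inter> X k - (\<Union>n. C n)"
      assume "emeasure \<mu> ?D \<noteq> 0"
      moreover have "emeasure \<mu> ?D \<le> emeasure \<mu> (B \<inter> X k)"
        using B Xb s by (intro emeasure_mono) auto
      ultimately obtain r where r: "emeasure \<mu> ?D = ennreal r" "0 < r"
        using fin[of k] by (cases "emeasure \<mu> ?D") (auto simp: less_le top_unique)
      obtain j where "1 / real (Suc j) < r" using nat_approx_posE[OF r(2)] by auto
      then have j: "ennreal (1 / Suc j) < emeasure \<mu> ?D"
        unfolding r(1) using r(2) by (intro ennreal_lessI) auto
      have "K k j \<subseteq> C (max k j)" unfolding C_def by force
      then have KD: "K k j \<subseteq> B \<inter> X k - ?D" using K(2)[of k j] by blast
      have "emeasure \<mu> (K k j) + emeasure \<mu> ?D = emeasure \<mu> (K k j \<union> ?D)"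
        using KD Kb B Xb Cb s by (intro plus_emeasure) auto
      also have "\<dots> \<le> emeasure \<mu> (B \<inter> X k)"
        using KD B Xb s by (intro emeasure_mono) auto
      also have "\<dots> < emeasure \<mu> (K k j) + ennreal (1 / Suc j)" by (rule K(3))
      also have "\<dots> \<le> emeasure \<mu> (K k j) + emeasure \<mu> ?D" using j by (intro add_mono) auto
      finally show False by simp
    qed
    have "emeasure \<mu> (\<Union>k. B \<inter> X k - (\<Union>n. C n)) = 0"
      using null B Xb Cb s by (intro emeasure_UN_eq_0) auto
    moreover have "(\<Union>k. B \<inter> X k - (\<Union>n. C n)) = B - (\<Union>n. C n)" using X(3) by blast
    ultimately show "AE x in \<mu>. x \<in> B \<longrightarrow> x \<in> (\<Union>n. C n)"
      using B Cb s by (intro AE_I[of _ _ "B - (\<Union>n. C n)"]) auto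
  qed
qed

lemma AE_in_borel_subset:
  assumes "sets \<mu> = sets borel" "AE x in \<mu>. x \<in> A"
  obtains B where "B \<in> sets borel" "B \<subseteq> A" "AE x in \<mu>. x \<in> B"
proof -
  obtain N where N: "{x \<in> space \<mu>. x \<notin> A} \<subseteq> N" "emeasure \<mu> N = 0" "N \<in> sets \<mu>"
    using assms(2) by (rule AE_E)
  have sp: "space \<mu> = UNIV" using sets_eq_imp_space_eq[OF assms(1)] by simp
  show thesis
  proof
    show "- N \<in> sets borel" using N(3) assms(1) borel_comp by auto
    show "- N \<subseteq> A" using N(1) sp by auto
    show "AE x in \<mu>. x \<in> - N" using N by (intro AE_I[of _ _ N]) auto
  qed
qed

lemma integral_compact_exhaustion:
  fixes \<mu> :: "'a::{t2_space, second_countable_topology} measure"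
  assumes lc: "locally_compact_space (euclidean :: 'a topology)"
    and \<mu>: "radon \<mu>" and A: "AE x in \<mu>. x \<in> A" and f: "f \<in> borel_measurable borel"
  obtains C :: "nat \<Rightarrow> 'a set"
  where "\<And>n. compact (C n)" "\<And>n. C n \<subseteq> A" "incseq C"
    "(\<integral>\<^sup>+x. f x \<partial>\<mu>) = (SUP n. \<integral>\<^sup>+x. indicator (C n) x * f x \<partial>\<mu>)"
proof -
  obtain B where B: "B \<in> sets borel" "B \<subseteq> A" "AE x in \<mu>. x \<in> B"
    by (rule AE_in_borel_subset[OF sets_radon[OF \<mu>] A])
  obtain C :: "nat \<Rightarrow> 'a set" where C: "\<And>n. compact (C n)" "\<And>n. C n \<subseteq> B" "incseq C"
      "AE x in \<mu>. x \<in> B \<longrightarrow> x \<in> (\<Union>n. C n)"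
    by (rule radon_inner_sigma_compact[OF lc \<mu> B(1)]) (rule that)
  have fm [measurable]: "f \<in> borel_measurable \<mu>" using f sets_radon[OF \<mu>] by (simp cong: measurable_cong_sets)
  have Cm [measurable]: "C n \<in> sets \<mu>" for n using C(1) borel_compact sets_radon[OF \<mu>] by auto
  have pt: "(SUP n. indicator (C n) x * f x) = f x" if "x \<in> (\<Union>n. C n)" for x
  proof (rule antisym)
    show "(SUP n. indicator (C n) x * f x) \<le> f x" by (intro SUP_least) (auto simp: indicator_def)
    obtain n where "x \<in> C n" using \<open>x \<in> (\<Union>n. C n)\<close> by blast
    then show "f x \<le> (SUP n. indicator (C n) x * f x)" by (intro SUP_upper2[of n]) auto
  qed
  have "(\<integral>\<^sup>+x. f x \<partial>\<mu>) = (\<integral>\<^sup>+x. (SUP n. indicator (C n) x * f x) \<partial>\<mu>)"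
  proof (rule nn_integral_cong_AE)
    show "AE x in \<mu>. f x = (SUP n. indicator (C n) x * f x)"
      using B(3) C(4) by eventually_elim (simp add: pt)
  qed
  also have "\<dots> = (SUP n. \<integral>\<^sup>+x. indicator (C n) x * f x \<partial>\<mu>)"
    using C(3) by (intro nn_integral_monotone_convergence_SUP)
      (auto simp: incseq_def le_fun_def indicator_def)
  finally show thesis using that C B(2) by blast
qed

text \<open>An exhaustion by compact subsets of \<open>A\<close> is stopped once it has nearly used up the integral.\<close>

lemma integral_compact_tail:
  fixes \<mu> :: "'a::{t2_space, second_countable_topology} measure"
  assumes lc: "locally_compact_space (euclidean :: 'a topology)"
    and \<mu>: "radon \<mu>" and A: "AE x in \<mu>. x \<in> A" and f: "f \<in> borel_measurable borel"
    and fin: "(\<integral>\<^sup>+x. f x \<partial>\<mu>) < \<infinity>" and e: "0 < e"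
  obtains K where "compact K" "K \<subseteq> A" "(\<integral>\<^sup>+x. indicator (- K) x * f x \<partial>\<mu>) \<le> ennreal e"
proof -
  obtain C :: "nat \<Rightarrow> 'a set" where C: "\<And>n. compact (C n)" "\<And>n. C n \<subseteq> A" "incseq C"
    "(\<integral>\<^sup>+x. f x \<partial>\<mu>) = (SUP n. \<integral>\<^sup>+x. indicator (C n) x * f x \<partial>\<mu>)"
    by (rule integral_compact_exhaustion[OF lc \<mu> A f]) (rule that)
  have "\<exists>n\<in>UNIV. (\<integral>\<^sup>+x. f x \<partial>\<mu>) < (\<integral>\<^sup>+x. indicator (C n) x * f x \<partial>\<mu>) + ennreal e"
    by (rule SUP_approx_ennreal[OF e _ C(4)]) (use fin in auto)
  then obtain n where n: "(\<integral>\<^sup>+x. f x \<partial>\<mu>) < (\<integral>\<^sup>+x. indicator (C n) x * f x \<partial>\<mu>) + ennreal e" by blast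
  have fm [measurable]: "f \<in> borel_measurable \<mu>" using f sets_radon[OF \<mu>] by (simp cong: measurable_cong_sets)
  have Cm [measurable]: "C n \<in> sets \<mu>" "- C n \<in> sets \<mu>"
    using C(1) borel_compact borel_comp sets_radon[OF \<mu>] by auto
  have split: "(\<integral>\<^sup>+x. f x \<partial>\<mu>) = (\<integral>\<^sup>+x. indicator (C n) x * f x \<partial>\<mu>) + (\<integral>\<^sup>+x. indicator (- C n) x * f x \<partial>\<mu>)"
    by (subst nn_integral_add[symmetric]) (auto intro!: nn_integral_cong simp: indicator_def)
  have "(\<integral>\<^sup>+x. indicator (C n) x * f x \<partial>\<mu>) \<noteq> \<infinity>" using fin split by auto
  then have "(\<integral>\<^sup>+x. indicator (- C n) x * f x \<partial>\<mu>) \<le> ennreal e"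
    using n unfolding split by (simp add: ennreal_add_left_cancel_less less_imp_le)
  then show thesis using that C by blast
qed

lemma nn_integral_layer_cake:
  assumes "sigma_finite_measure \<mu>" and g[measurable]: "g \<in> borel_measurable \<mu>"
  shows "(\<integral>\<^sup>+x. g x \<partial>\<mu>) = (\<integral>\<^sup>+t. indicator {0..} t * emeasure \<mu> {x \<in> space \<mu>. ennreal t < g x} \<partial>lborel)"
    and "(\<lambda>t. indicator {0::real..} t * emeasure \<mu> {x \<in> space \<mu>. ennreal t < g x}) \<in> borel_measurable lborel"
proof -
  interpret sigma_finite_measure \<mu> by fact
  interpret P: pair_sigma_finite lborel \<mu> ..
  have inf: "emeasure lborel {0::real..} = \<infinity>"
  proof (rule ccontr)
    assume "emeasure lborel {0::real..} \<noteq> \<infinity>"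
    then obtain r where r: "0 \<le> r" "emeasure lborel {0::real..} = ennreal r"
      by (cases "emeasure lborel {0::real..}") auto
    have "emeasure lborel {0..r + 1} \<le> emeasure lborel {0::real..}" by (intro emeasure_mono) auto
    then show False using r by simp
  qed
  have gx: "(\<integral>\<^sup>+t. indicator {0::real..} t * indicator {t. ennreal t < g x} t \<partial>lborel) = g x" for x
  proof (cases "g x")
    case (real r)
    have "(\<integral>\<^sup>+t. indicator {0::real..} t * indicator {t. ennreal t < g x} t \<partial>lborel)
        = (\<integral>\<^sup>+t. indicator {0..<r} t \<partial>lborel)"
      using real by (intro nn_integral_cong) (auto simp: indicator_def ennreal_less_iff)
    then show ?thesis using real by simp
  next
    case top
    have "(\<integral>\<^sup>+t. indicator {0::real..} t * indicator {t. ennreal t < g x} t \<partial>lborel)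
        = (\<integral>\<^sup>+t. indicator {0::real..} t \<partial>lborel)"
      using top by (intro nn_integral_cong) (auto simp: indicator_def)
    then show ?thesis using top inf by simp
  qed
  have m: "(\<lambda>(t, x). indicator {0::real..} t * (indicator {t. ennreal t < g x} t :: ennreal))
      \<in> borel_measurable (lborel \<Otimes>\<^sub>M \<mu>)"
  proof -
    have "(\<lambda>(t, x). indicator {0::real..} t * (indicator {t. ennreal t < g x} t :: ennreal))
        = (\<lambda>p. indicator {0::real..} (fst p) * indicator {p. ennreal (fst p) < g (snd p)} p)"
      by (auto simp: indicator_def)
    moreover have "(\<lambda>p. indicator {0::real..} (fst p) * (if ennreal (fst p) < g (snd p) then 1 else 0 :: ennreal))
        \<in> borel_measurable (lborel \<Otimes>\<^sub>M \<mu>)"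
      by measurable
    ultimately show ?thesis by (simp add: indicator_def[abs_def])
  qed
  have inner: "(\<integral>\<^sup>+x. indicator {0::real..} t * indicator {t. ennreal t < g x} t \<partial>\<mu>)
      = indicator {0::real..} t * emeasure \<mu> {x \<in> space \<mu>. ennreal t < g x}" for t
  proof -
    have "(\<integral>\<^sup>+x. indicator {0::real..} t * indicator {t. ennreal t < g x} t \<partial>\<mu>)
        = (\<integral>\<^sup>+x. indicator {0::real..} t * indicator {x \<in> space \<mu>. ennreal t < g x} x \<partial>\<mu>)"
      by (intro nn_integral_cong) (auto simp: indicator_def)
    also have "\<dots> = indicator {0::real..} t * emeasure \<mu> {x \<in> space \<mu>. ennreal t < g x}"
      by (simp add: nn_integral_cmult)
    finally show ?thesis .
  qed
  show "(\<integral>\<^sup>+x. g x \<partial>\<mu>) = (\<integral>\<^sup>+t. indicator {0..} t * emeasure \<mu> {x \<in> space \<mu>. ennreal t < g x} \<partial>lborel)"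
    using P.Fubini'[OF m] by (simp add: gx inner)
  show "(\<lambda>t. indicator {0::real..} t * emeasure \<mu> {x \<in> space \<mu>. ennreal t < g x}) \<in> borel_measurable lborel"
    using borel_measurable_nn_integral[OF m] by (simp add: inner)
qed

context perfect_kernel
begin

interpretation S: Metric_space "finite_energy \<kappa>" "strong_dist \<kappa>"
  by (rule Metric_space_strong)

lemma of_pos_finite_energy: "\<mu> \<in> \<E> \<Longrightarrow> of_pos \<mu> \<in> finite_energy \<kappa>"
  by (simp add: finite_energy_pos_def)

lemma of_pos_inject: "of_pos \<mu> = of_pos \<nu> \<longleftrightarrow> \<mu> = \<nu>"
  by (simp add: of_pos_def)

lemma strong_dist_of_pos:
  assumes "\<mu> \<in> \<E>" "\<nu> \<in> \<E>"
  shows "strong_dist \<kappa> (of_pos \<mu>) (of_pos \<nu>) = sqrt (sqdist \<mu> \<nu>)"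
  using strong_dist_eq[OF of_pos_finite_energy of_pos_finite_energy, OF assms] assms
  by (simp add: of_pos_def msum_null_left msum_null_right sets_radon radon_finite_energy_pos)

text \<open>
  On positive measures the strong topology only enters through convergent sequences, and for these
  the signed differences in \<open>strong_dist\<close> can be avoided.
\<close>

definition strongly_converges :: "(nat \<Rightarrow> 'a measure) \<Rightarrow> 'a measure \<Rightarrow> bool" where
  "strongly_converges \<nu>s \<nu> \<longleftrightarrow> range \<nu>s \<subseteq> \<E> \<and> \<nu> \<in> \<E> \<and>
     (\<lambda>n. sqdist (\<nu>s n) \<nu>) \<longlonglongrightarrow> 0"

lemma strongly_convergesD:
  assumes "strongly_converges \<nu>s \<nu>"
  shows "\<nu>s n \<in> \<E>" "\<nu> \<in> \<E>" "(\<lambda>n. sqdist (\<nu>s n) \<nu>) \<longlonglongrightarrow> 0"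
  using assms unfolding strongly_converges_def by auto

lemma strongly_converges_subseq:
  "strongly_converges \<nu>s \<nu> \<Longrightarrow> strict_mono r \<Longrightarrow> strongly_converges (\<nu>s \<circ> r) \<nu>"
  unfolding strongly_converges_def using LIMSEQ_subseq_LIMSEQ[of "\<lambda>n. sqdist (\<nu>s n) \<nu>" 0 r]
  by (auto simp: comp_def)

lemma limitin_strong_topology:
  assumes "strongly_converges \<nu>s \<nu>"
  shows "limitin (strong_topology \<kappa>) (\<lambda>n. of_pos (\<nu>s n)) (of_pos \<nu>) sequentially"
proof -
  note D = strongly_convergesD[OF assms]
  have "(\<lambda>n. sqrt (sqdist (\<nu>s n) \<nu>)) \<longlonglongrightarrow> sqrt 0" using D(3) by (rule tendsto_real_sqrt)
  then show ?thesis
    unfolding strong_topology_def S.limitin_metric_dist_null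
    using D by (simp add: strong_dist_of_pos of_pos_finite_energy)
qed

lemma strongly_complete:
  assumes E: "\<And>n. \<nu>s n \<in> \<E>"
    and C: "\<And>e. 0 < e \<Longrightarrow> \<exists>N. \<forall>n\<ge>N. \<forall>m\<ge>N. sqdist (\<nu>s n) (\<nu>s m) < e"
  obtains \<nu> where "strongly_converges \<nu>s \<nu>"
proof -
  let ?M = "of_pos ` \<E>"
  have sub: "?M \<subseteq> finite_energy \<kappa>" using of_pos_finite_energy by auto
  interpret P: Metric_space ?M "strong_dist \<kappa>" by (rule S.subspace[OF sub])
  have "P.MCauchy (\<lambda>n. of_pos (\<nu>s n))"
    unfolding P.MCauchy_def
  proof (intro conjI allI impI)
    fix e :: real assume "0 < e"
    then obtain N where N: "\<And>n m. n \<ge> N \<Longrightarrow> m \<ge> N \<Longrightarrow> sqdist (\<nu>s n) (\<nu>s m) < e\<^sup>2"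
      using C[of "e\<^sup>2"] by auto
    have "strong_dist \<kappa> (of_pos (\<nu>s n)) (of_pos (\<nu>s m)) < e" if "n \<ge> N" "m \<ge> N" for n m
      using real_sqrt_less_mono[OF N[OF that]] \<open>0 < e\<close> by (simp add: strong_dist_of_pos E)
    then show "\<exists>N. \<forall>n n'. N \<le> n \<longrightarrow> N \<le> n' \<longrightarrow> strong_dist \<kappa> (of_pos (\<nu>s n)) (of_pos (\<nu>s n')) < e"
      by blast
  qed (use E in auto)
  moreover have "P.mcomplete" using perf unfolding perfect_def consistent_def by blast
  ultimately obtain x where "limitin P.mtopology (\<lambda>n. of_pos (\<nu>s n)) x sequentially"
    unfolding P.mcomplete_def by blast
  then have x: "x \<in> ?M" "(\<lambda>n. strong_dist \<kappa> (of_pos (\<nu>s n)) x) \<longlonglongrightarrow> 0"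
    unfolding P.limitin_metric_dist_null by auto
  then obtain \<nu> where \<nu>: "\<nu> \<in> \<E>" "x = of_pos \<nu>" by blast
  have "(\<lambda>n. (sqrt (sqdist (\<nu>s n) \<nu>))\<^sup>2) \<longlonglongrightarrow> 0\<^sup>2"
    using x(2) unfolding \<nu>(2) by (intro tendsto_power) (simp add: strong_dist_of_pos E \<nu>(1))
  then have "strongly_converges \<nu>s \<nu>"
    unfolding strongly_converges_def using E \<nu>(1) energy_radon_diff(3)[OF E \<nu>(1)] by auto
  then show thesis by (rule that)
qed

lemma strongly_closed:
  assumes cl: "closedin (strong_topology \<kappa>) (of_pos ` \<E>_on A)"
    and conv: "strongly_converges \<nu>s \<nu>" and A: "\<And>n. \<nu>s n \<in> \<E>_on A"
  shows "\<nu> \<in> \<E>_on A"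
proof -
  have "of_pos \<nu> \<in> of_pos ` \<E>_on A"
    by (rule limitin_closedin[OF limitin_strong_topology[OF conv] cl]) (use A in auto)
  then show ?thesis by (auto simp: of_pos_inject)
qed

lemma mutual_strong_limit:
  assumes conv: "strongly_converges \<nu>s \<nu>" and \<mu>: "\<mu> \<in> \<E>"
  shows "(\<lambda>n. mutual (\<nu>s n) \<mu>) \<longlonglongrightarrow> mutual \<nu> \<mu>"
proof -
  note D = strongly_convergesD[OF conv]
  have "(\<lambda>n. sqrt (sqdist (\<nu>s n) \<nu>) * sqrt (mutual \<mu> \<mu>)) \<longlonglongrightarrow> sqrt 0 * sqrt (mutual \<mu> \<mu>)"
    by (intro tendsto_intros D)
  then have "(\<lambda>n. sqrt (sqdist (\<nu>s n) \<nu>) * sqrt (mutual \<mu> \<mu>)) \<longlonglongrightarrow> 0" by simp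
  then have "(\<lambda>n. mutual (\<nu>s n) \<mu> - mutual \<nu> \<mu>) \<longlonglongrightarrow> 0"
    by (rule Lim_null_comparison[rotated]) (use mutual_diff_bound[OF D(1,2) \<mu>] in simp)
  then show ?thesis by (rule LIM_zero_cancel)
qed

lemma energy_strong_limit:
  assumes conv: "strongly_converges \<nu>s \<nu>"
  shows "(\<lambda>n. mutual (\<nu>s n) (\<nu>s n)) \<longlonglongrightarrow> mutual \<nu> \<nu>"
proof -
  note D = strongly_convergesD[OF conv]
  have "(\<lambda>n. sqdist (\<nu>s n) \<nu> - mutual \<nu> \<nu> + 2 * mutual (\<nu>s n) \<nu>) \<longlonglongrightarrow> 0 - mutual \<nu> \<nu> + 2 * mutual \<nu> \<nu>"
    by (intro tendsto_intros D mutual_strong_limit[OF conv])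
  then show ?thesis by (simp add: sqdist_def)
qed

text \<open>
  The measures that nearly agree with \<open>\<nu>\<close> on \<open>\<phi>\<close> form a vaguely open set, which consistency of the
  kernel makes a strong neighbourhood of \<open>\<nu>\<close>.
\<close>

lemma vague_convergence:
  assumes conv: "strongly_converges \<nu>s \<nu>" and \<phi>: "\<phi> \<in> compactly_supported"
  shows "(\<lambda>n. \<integral>x. \<phi> x \<partial>\<nu>s n) \<longlonglongrightarrow> (\<integral>x. \<phi> x \<partial>\<nu>)"
proof (rule tendstoI)
  fix e :: real assume e: "0 < e"
  note D = strongly_convergesD[OF conv]
  let ?E = "of_pos ` \<E>"
  let ?I = "\<lambda>\<sigma>. \<lambda>\<phi>\<in>compactly_supported. (\<integral>x. \<phi> x \<partial>pos_part \<sigma>) - (\<integral>x. \<phi> x \<partial>neg_part \<sigma>)"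
  let ?c = "\<integral>x. \<phi> x \<partial>\<nu>"
  let ?P = "product_topology (\<lambda>_. euclideanreal) (compactly_supported :: ('a \<Rightarrow> real) set)"
  define V where "V = {h \<in> topspace ?P. h \<phi> \<in> ball ?c e}"
  have "openin ?P V"
    unfolding V_def
    by (rule openin_continuous_map_preimage[OF continuous_map_product_projection[OF \<phi>]]) simp
  then have "openin vague_topology (?I -` V \<inter> signed_radon)"
    unfolding vague_topology_def openin_pullback_topology by blast
  then have "openin (subtopology vague_topology ?E) (?I -` V \<inter> signed_radon \<inter> ?E)"
    unfolding openin_subtopology by blast
  then have "openin (subtopology (strong_topology \<kappa>) ?E) (?I -` V \<inter> signed_radon \<inter> ?E)"
    using perf unfolding perfect_def consistent_def by blast
  then obtain T where T: "openin (strong_topology \<kappa>) T" "?I -` V \<inter> signed_radon \<inter> ?E = T \<inter> ?E"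
    unfolding openin_subtopology by blast
  have mem: "of_pos \<mu> \<in> T \<longleftrightarrow> dist (\<integral>x. \<phi> x \<partial>\<mu>) ?c < e" if "\<mu> \<in> \<E>" for \<mu>
  proof -
    have "of_pos \<mu> \<in> T \<longleftrightarrow> of_pos \<mu> \<in> T \<inter> ?E" using that by blast
    also have "\<dots> \<longleftrightarrow> ?I (of_pos \<mu>) \<in> V"
      using that of_pos_signed_radon[OF radon_finite_energy_pos[OF that]] unfolding T(2)[symmetric] by blast
    also have "\<dots> \<longleftrightarrow> dist (\<integral>x. \<phi> x \<partial>\<mu>) ?c < e"
      using \<phi> by (auto simp: V_def of_pos_def dist_commute)
    finally show ?thesis .
  qed
  have "of_pos \<nu> \<in> T" using mem[OF D(2)] e by simp
  then have "\<forall>\<^sub>F n in sequentially. of_pos (\<nu>s n) \<in> T"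
    using limitin_strong_topology[OF conv] T(1) unfolding limitin_def by blast
  then show "\<forall>\<^sub>F n in sequentially. dist (\<integral>x. \<phi> x \<partial>\<nu>s n) ?c < e"
    using mem[OF D(1)] by simp
qed

lemma compactly_supported_measurable:
  assumes "\<phi> \<in> compactly_supported" shows "\<phi> \<in> borel_measurable borel"
  using assms unfolding compactly_supported_def by (auto intro: borel_measurable_continuous_onI)

lemma nn_integral_compactly_supported:
  assumes \<mu>: "radon \<mu>" and \<phi>: "\<phi> \<in> compactly_supported" "\<And>x. 0 \<le> \<phi> x" "\<And>x. \<phi> x \<le> 1"
  shows "(\<integral>\<^sup>+x. ennreal (\<phi> x) \<partial>\<mu>) = ennreal (\<integral>x. \<phi> x \<partial>\<mu>)"
proof (rule nn_integral_eq_integral)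
  let ?K = "closure {x. \<phi> x \<noteq> 0}"
  have K: "compact ?K" using \<phi>(1) unfolding compactly_supported_def by simp
  have m: "\<phi> \<in> borel_measurable \<mu>"
    using compactly_supported_measurable[OF \<phi>(1)] sets_radon[OF \<mu>] by (simp cong: measurable_cong_sets)
  have "(\<integral>\<^sup>+x. ennreal (norm (\<phi> x)) \<partial>\<mu>) \<le> (\<integral>\<^sup>+x. indicator ?K x \<partial>\<mu>)"
    using \<phi>(2,3) closure_subset[of "{x. \<phi> x \<noteq> 0}"] by (intro nn_integral_mono) (auto simp: indicator_def)
  also have "\<dots> = emeasure \<mu> ?K" using sets_radon[OF \<mu>] K borel_compact by simp
  also have "\<dots> < \<infinity>" by (rule compact_finite_radon[OF \<mu> K])
  finally show "integrable \<mu> \<phi>" using m by (intro integrableI_bounded) auto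
qed (use \<phi> in auto)

text \<open>
  Half of the portmanteau theorem: testing with bump functions bounds \<open>\<nu>\<close> on open sets, and the
  layer-cake formula with Fatou's lemma passes to all nonnegative lower semicontinuous functions.
\<close>

lemma liminf_emeasure_open:
  assumes conv: "strongly_converges \<nu>s \<nu>" and G: "open G"
  shows "emeasure \<nu> G \<le> liminf (\<lambda>n. emeasure (\<nu>s n) G)"
proof -
  note D = strongly_convergesD[OF conv]
  have r: "radon \<nu>" "\<And>n. radon (\<nu>s n)" using D radon_finite_energy_pos by auto
  have "emeasure \<nu> G = (SUP K\<in>{K. compact K \<and> K \<subseteq> G}. emeasure \<nu> K)"
    using r(1) borel_open[OF G] unfolding radon_def by blast
  also have "\<dots> \<le> liminf (\<lambda>n. emeasure (\<nu>s n) G)"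
  proof (rule SUP_least, clarify)
    fix K assume K: "compact K" "K \<subseteq> G"
    obtain \<phi> where \<phi>: "\<phi> \<in> compactly_supported" "\<And>x. 0 \<le> \<phi> x" "\<And>x. \<phi> x \<le> 1"
      "\<And>x. x \<in> K \<Longrightarrow> \<phi> x = 1" "\<And>x. x \<notin> G \<Longrightarrow> \<phi> x = 0"
      by (rule bump_function[OF lc K(1) G K(2)]) (rule that)
    note int = nn_integral_compactly_supported[OF _ \<phi>(1,2,3)]
    have "K \<in> sets \<nu>" using sets_radon[OF r(1)] borel_compact[OF K(1)] by simp
    then have "emeasure \<nu> K = (\<integral>\<^sup>+x. indicator K x \<partial>\<nu>)" by simp
    also have "\<dots> \<le> (\<integral>\<^sup>+x. ennreal (\<phi> x) \<partial>\<nu>)" using \<phi>(4) by (intro nn_integral_mono) (auto simp: indicator_def)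
    also have "\<dots> = liminf (\<lambda>n. ennreal (\<integral>x. \<phi> x \<partial>\<nu>s n))"
      unfolding int[OF r(1)]
      by (rule lim_imp_Liminf[symmetric]) (auto intro!: tendsto_ennrealI vague_convergence[OF conv \<phi>(1)])
    also have "\<dots> \<le> liminf (\<lambda>n. emeasure (\<nu>s n) G)"
    proof (intro Liminf_mono always_eventually allI)
      fix n
      have "ennreal (\<integral>x. \<phi> x \<partial>\<nu>s n) \<le> (\<integral>\<^sup>+x. indicator G x \<partial>\<nu>s n)"
        unfolding int[OF r(2), symmetric] using \<phi>(3,5) by (intro nn_integral_mono) (auto simp: indicator_def)
      then show "ennreal (\<integral>x. \<phi> x \<partial>\<nu>s n) \<le> emeasure (\<nu>s n) G"
        using sets_radon[OF r(2)] G by simp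
    qed
    finally show "emeasure \<nu> K \<le> liminf (\<lambda>n. emeasure (\<nu>s n) G)" .
  qed
  finally show ?thesis .
qed

lemma liminf_integral_lsc:
  assumes conv: "strongly_converges \<nu>s \<nu>" and g: "\<And>t. open {x. t < g x}"
  shows "(\<integral>\<^sup>+x. g x \<partial>\<nu>) \<le> liminf (\<lambda>n. \<integral>\<^sup>+x. g x \<partial>\<nu>s n)"
proof -
  note D = strongly_convergesD[OF conv]
  have gm: "g \<in> borel_measurable borel"
    by (rule borel_measurableI_greater) (simp add: borel_open g)
  have lay: "(\<integral>\<^sup>+x. g x \<partial>\<mu>) = (\<integral>\<^sup>+t. indicator {0..} t * emeasure \<mu> {x. ennreal t < g x} \<partial>lborel)"
      "(\<lambda>t. indicator {0::real..} t * emeasure \<mu> {x. ennreal t < g x}) \<in> borel_measurable lborel"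
    if "\<mu> \<in> \<E>" for \<mu>
    using nn_integral_layer_cake[OF sigma_finite_radon[OF lc radon_finite_energy_pos[OF that]], of g] gm
      space_radon[OF radon_finite_energy_pos[OF that]] sets_radon[OF radon_finite_energy_pos[OF that]]
    by (simp_all cong: measurable_cong_sets)
  have "(\<integral>\<^sup>+x. g x \<partial>\<nu>)
      \<le> (\<integral>\<^sup>+t. liminf (\<lambda>n. indicator {0..} t * emeasure (\<nu>s n) {x. ennreal t < g x}) \<partial>lborel)"
    unfolding lay(1)[OF D(2)]
    using liminf_emeasure_open[OF conv g] by (intro nn_integral_mono) (auto simp: indicator_def)
  also have "\<dots> \<le> liminf (\<lambda>n. \<integral>\<^sup>+t. indicator {0..} t * emeasure (\<nu>s n) {x. ennreal t < g x} \<partial>lborel)"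
    by (rule nn_integral_liminf) (use lay(2) D in auto)
  also have "\<dots> = liminf (\<lambda>n. \<integral>\<^sup>+x. g x \<partial>\<nu>s n)"
    using lay(1)[OF D(1)] by simp
  finally show ?thesis .
qed

lemma eventually_integral_lsc:
  assumes conv: "strongly_converges \<nu>s \<nu>" and g: "\<And>t. open {x. t < g x}"
    and fin: "(\<integral>\<^sup>+x. g x \<partial>\<nu>) < \<infinity>" and e: "0 < e"
  shows "\<forall>\<^sub>F n in sequentially. (\<integral>\<^sup>+x. g x \<partial>\<nu>) \<le> (\<integral>\<^sup>+x. g x \<partial>\<nu>s n) + ennreal e"
proof (cases "(\<integral>\<^sup>+x. g x \<partial>\<nu>) = 0")
  case False
  then have "(\<integral>\<^sup>+x. g x \<partial>\<nu>) - ennreal e < (\<integral>\<^sup>+x. g x \<partial>\<nu>)"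
    using fin e by (intro ennreal_between) (auto simp: zero_less_iff_neq_zero)
  then have "\<forall>\<^sub>F n in sequentially. (\<integral>\<^sup>+x. g x \<partial>\<nu>) - ennreal e < (\<integral>\<^sup>+x. g x \<partial>\<nu>s n)"
    using liminf_integral_lsc[OF conv g] unfolding le_Liminf_iff by blast
  then show ?thesis
    by eventually_elim (auto simp: ennreal_minus_le_iff add.commute dest!: less_imp_le)
qed simp

end

context perfect_kernel
begin

lemma ennreal_less_minus_swap:
  fixes t u m :: ennreal assumes "m < \<infinity>"
  shows "t < m - u \<longleftrightarrow> u < m - t"
  using assms by (simp add: less_diff_eq_ennreal add.commute)

text \<open>
  If \<open>\<phi>\<close> is a bump function equal to \<open>1\<close> on \<open>K\<close>, then \<open>M \<cdot> \<phi> - 1\<^sub>K \<cdot> u\<close> is nonnegative and lower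
  semicontinuous, while the integrals of \<open>\<phi>\<close> converge.
\<close>

lemma eventually_integral_usc_on_compact:
  assumes conv: "strongly_converges \<nu>s \<nu>" and K: "compact K"
    and u: "u \<in> borel_measurable borel" "usc_on K u" and M: "0 \<le> M" "\<And>x. x \<in> K \<Longrightarrow> u x \<le> ennreal M"
    and e: "0 < e"
  shows "\<forall>\<^sub>F n in sequentially.
    (\<integral>\<^sup>+x. indicator K x * u x \<partial>\<nu>s n) \<le> (\<integral>\<^sup>+x. indicator K x * u x \<partial>\<nu>) + ennreal e"
proof -
  note D = strongly_convergesD[OF conv]
  obtain \<phi> where \<phi>: "\<phi> \<in> compactly_supported" "\<And>x. 0 \<le> \<phi> x" "\<And>x. \<phi> x \<le> 1"
      "\<And>x. x \<in> K \<Longrightarrow> \<phi> x = 1" "\<And>x. x \<notin> UNIV \<Longrightarrow> \<phi> x = 0"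
    by (rule bump_function[OF lc K open_UNIV subset_UNIV]) (rule that)
  define g where "g x = ennreal (M * \<phi> x) - indicator K x * u x" for x
  have le: "indicator K x * u x \<le> ennreal (M * \<phi> x)" for x
    using M \<phi>(4) by (auto simp: indicator_def)
  have Kb: "K \<in> sets borel" using K by (rule borel_compact)
  have cont: "continuous_on UNIV (\<lambda>x. ennreal (M * \<phi> x))"
    using \<phi>(1) unfolding compactly_supported_def by (intro continuous_on_ennreal continuous_intros) auto
  have open_g: "open {x. t < g x}" for t
  proof -
    obtain W where W: "open W" "{x\<in>K. u x < ennreal M - t} = K \<inter> W"
      using u(2) unfolding usc_on_def openin_open by blast
    have "t < g x \<longleftrightarrow> t < ennreal (M * \<phi> x) \<and> (x \<in> K \<longrightarrow> x \<in> W)" for x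
    proof (cases "x \<in> K")
      case True
      have "x \<in> W \<longleftrightarrow> t < ennreal M - u x"
        using W(2) True ennreal_less_minus_swap[of "ennreal M" t "u x"] by auto
      moreover have "t < ennreal M - u x \<Longrightarrow> t < ennreal M"
        by (meson diff_le_self_ennreal less_le_trans)
      ultimately show ?thesis using True \<phi>(4)[OF True] unfolding g_def by auto
    qed (simp add: g_def)
    then have "{x. t < g x} = {x. t < ennreal (M * \<phi> x)} \<inter> (- K \<union> W)" by auto
    moreover have "open {x. t < ennreal (M * \<phi> x)}"
      using open_Collect_less[OF continuous_on_const cont] .
    ultimately show ?thesis using W(1) compact_imp_closed[OF K] by (simp add: open_Int open_Un open_Compl)
  qed
  have pt: "indicator K x * u x + g x = ennreal (M * \<phi> x)" for x
    unfolding g_def using diff_add_cancel_ennreal[OF le] by (simp add: add.commute)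
  have gm: "g \<in> borel_measurable borel"
    by (rule borel_measurableI_greater) (simp add: borel_open open_g)
  have split: "(\<integral>\<^sup>+x. indicator K x * u x \<partial>\<mu>) + (\<integral>\<^sup>+x. g x \<partial>\<mu>) = ennreal (M * (\<integral>x. \<phi> x \<partial>\<mu>))"
    if \<mu>: "\<mu> \<in> \<E>" for \<mu>
  proof -
    have r: "radon \<mu>" using \<mu> by (rule radon_finite_energy_pos)
    have [measurable]: "g \<in> borel_measurable \<mu>" "u \<in> borel_measurable \<mu>" "K \<in> sets \<mu>" "\<phi> \<in> borel_measurable \<mu>"
      using gm u(1) Kb compactly_supported_measurable[OF \<phi>(1)] sets_radon[OF r] by (simp_all cong: measurable_cong_sets)
    have "(\<integral>\<^sup>+x. indicator K x * u x \<partial>\<mu>) + (\<integral>\<^sup>+x. g x \<partial>\<mu>) = (\<integral>\<^sup>+x. ennreal (M * \<phi> x) \<partial>\<mu>)"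
      by (subst nn_integral_add[symmetric]) (auto intro!: nn_integral_cong simp: pt)
    also have "\<dots> = ennreal M * (\<integral>\<^sup>+x. ennreal (\<phi> x) \<partial>\<mu>)"
      using M(1) \<phi>(2) by (simp add: ennreal_mult nn_integral_cmult)
    also have "\<dots> = ennreal (M * (\<integral>x. \<phi> x \<partial>\<mu>))"
      unfolding nn_integral_compactly_supported[OF r \<phi>(1,2,3)] using M(1) \<phi>(2) by (simp add: ennreal_mult)
    finally show ?thesis .
  qed
  have gfin: "(\<integral>\<^sup>+x. g x \<partial>\<nu>) < \<infinity>"
    using split[OF D(2)] by (metis ennreal_add_eq_top ennreal_less_top infinity_ennreal_def less_top)
  have "(\<lambda>n. M * (\<integral>x. \<phi> x \<partial>\<nu>s n)) \<longlonglongrightarrow> M * (\<integral>x. \<phi> x \<partial>\<nu>)"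
    by (intro tendsto_intros vague_convergence[OF conv \<phi>(1)])
  then have "\<forall>\<^sub>F n in sequentially. M * (\<integral>x. \<phi> x \<partial>\<nu>s n) < M * (\<integral>x. \<phi> x \<partial>\<nu>) + e / 2"
    by (rule order_tendstoD(2)) (use e in simp)
  moreover have "\<forall>\<^sub>F n in sequentially. (\<integral>\<^sup>+x. g x \<partial>\<nu>) \<le> (\<integral>\<^sup>+x. g x \<partial>\<nu>s n) + ennreal (e / 2)"
    by (rule eventually_integral_lsc[OF conv open_g gfin]) (use e in simp)
  ultimately show ?thesis
  proof eventually_elim
    case (elim n)
    have pos: "0 \<le> M * (\<integral>x. \<phi> x \<partial>\<nu>)" using M(1) \<phi>(2) by simp
    have "(\<integral>\<^sup>+x. g x \<partial>\<nu>) + (\<integral>\<^sup>+x. indicator K x * u x \<partial>\<nu>s n)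
        \<le> ((\<integral>\<^sup>+x. indicator K x * u x \<partial>\<nu>s n) + (\<integral>\<^sup>+x. g x \<partial>\<nu>s n)) + ennreal (e / 2)"
      using elim(2) by (simp add: add.commute add.left_commute add_left_mono)
    also have "\<dots> = ennreal (M * (\<integral>x. \<phi> x \<partial>\<nu>s n)) + ennreal (e / 2)"
      by (simp add: split[OF D(1)])
    also have "\<dots> \<le> ennreal (M * (\<integral>x. \<phi> x \<partial>\<nu>) + e / 2) + ennreal (e / 2)"
      using elim(1) by (intro add_right_mono ennreal_leI) simp
    also have "\<dots> = ennreal (M * (\<integral>x. \<phi> x \<partial>\<nu>)) + ennreal e"
      using pos e by (simp add: ennreal_plus[symmetric] del: ennreal_plus)
    also have "\<dots> = (\<integral>\<^sup>+x. g x \<partial>\<nu>) + ((\<integral>\<^sup>+x. indicator K x * u x \<partial>\<nu>) + ennreal e)"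
      by (simp add: split[OF D(2), symmetric] ac_simps)
    finally show ?case using gfin by (auto simp: ennreal_add_left_cancel_le)
  qed
qed

section \<open>Tightness of strongly convergent sequences\<close>

lemma pos_energy_restrict:
  assumes "radon \<mu>" "radon \<nu>" "B \<in> sets borel"
  shows "\<I> (restrict_to \<mu> B) \<nu> = (\<integral>\<^sup>+x. indicator B x * \<U> \<nu> x \<partial>\<mu>)"
proof -
  have "radon (restrict_to \<mu> B)"
    using assms by (intro radon_density_le[OF lc]) (auto simp: indicator_def)
  then show ?thesis
    using assms by (simp add: pos_energy_eq nn_integral_restrict_to sets_radon pos_potential_measurable)
qed

lemma mutual_split:
  assumes \<mu>: "\<mu> \<in> \<E>" and \<nu>: "\<nu> \<in> \<E>" and B: "B \<in> sets borel"
  shows "mutual \<mu> \<nu> = mutual (restrict_to \<mu> B) \<nu> + mutual (restrict_to \<mu> (- B)) \<nu>"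
  using mutual_msum(1)[OF finite_energy_pos_restrict[OF \<mu> B] finite_energy_pos_restrict[OF \<mu> borel_comp[OF B]] \<nu>]
    msum_restrict_to[OF sets_radon[OF radon_finite_energy_pos[OF \<mu>]] B] by simp

lemma mutual_restrict_le:
  assumes \<mu>: "\<mu> \<in> \<E>" and \<nu>: "\<nu> \<in> \<E>" and B: "B \<in> sets borel"
  shows "mutual (restrict_to \<mu> B) \<nu> \<le> mutual \<mu> \<nu>"
  using mutual_split[OF assms] mutual_nonneg by simp

text \<open>
  Replacing one of the two copies of \<open>\<nu>s n\<close> by \<open>\<nu>\<close> costs little by the Cauchy--Schwarz inequality.
  What remains is \<open>I(\<nu>s n, \<nu>)\<close>, which converges to \<open>I(\<nu>, \<nu>)\<close>, minus the integral of the lower semicontinuous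
  function \<open>1\<^sub>G \<cdot> U\<^sup>\<nu>\<close>.
\<close>

lemma eventually_energy_outside_open:
  assumes conv: "strongly_converges \<nu>s \<nu>" and G: "open G" and d: "0 < d"
  shows "\<forall>\<^sub>F n in sequentially.
    mutual (restrict_to (\<nu>s n) (- G)) (\<nu>s n) \<le> mutual (restrict_to \<nu> (- G)) \<nu> + d"
proof -
  note D = strongly_convergesD[OF conv]
  have Gb: "G \<in> sets borel" using G by simp
  have r: "radon \<nu>" "\<And>n. radon (\<nu>s n)" using D radon_finite_energy_pos by auto
  have lsc: "open {x. t < indicator G x * \<U> \<nu> x}" for t
  proof -
    have "{x. t < indicator G x * \<U> \<nu> x} = G \<inter> {x. t < \<U> \<nu> x}"
      by (auto simp: indicator_def)
    then show ?thesis using G pos_potential_lsc[OF r(1)] by (simp add: open_Int)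
  qed
  have I: "(\<integral>\<^sup>+x. indicator G x * \<U> \<nu> x \<partial>\<mu>) = ennreal (mutual (restrict_to \<mu> G) \<nu>)"
    if "\<mu> \<in> \<E>" for \<mu>
    using pos_energy_restrict[OF radon_finite_energy_pos[OF that] r(1) Gb]
      pos_energy_mutual[OF finite_energy_pos_restrict[OF that Gb] D(2)] by simp
  have "\<forall>\<^sub>F n in sequentially. (\<integral>\<^sup>+x. indicator G x * \<U> \<nu> x \<partial>\<nu>)
      \<le> (\<integral>\<^sup>+x. indicator G x * \<U> \<nu> x \<partial>\<nu>s n) + ennreal (d / 3)"
    by (rule eventually_integral_lsc[OF conv lsc]) (use d I[OF D(2)] in auto)
  then have 1: "\<forall>\<^sub>F n in sequentially. mutual (restrict_to \<nu> G) \<nu> \<le> mutual (restrict_to (\<nu>s n) G) \<nu> + d / 3"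
    by eventually_elim
       (use d in \<open>simp add: I D ennreal_plus[symmetric] mutual_nonneg del: ennreal_plus\<close>)
  have 2: "\<forall>\<^sub>F n in sequentially. mutual (\<nu>s n) \<nu> < mutual \<nu> \<nu> + d / 3"
    using mutual_strong_limit[OF conv D(2)] by (rule order_tendstoD(2)) (use d in simp)
  have "(\<lambda>n. sqrt (sqdist (\<nu>s n) \<nu>) * sqrt (mutual (\<nu>s n) (\<nu>s n))) \<longlonglongrightarrow> sqrt 0 * sqrt (mutual \<nu> \<nu>)"
    by (intro tendsto_intros D energy_strong_limit[OF conv])
  then have 3: "\<forall>\<^sub>F n in sequentially. sqrt (sqdist (\<nu>s n) \<nu>) * sqrt (mutual (\<nu>s n) (\<nu>s n)) < d / 3"
    by (rule order_tendstoD(2)) (use d in simp)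
  show ?thesis
    using 1 2 3
  proof eventually_elim
    case (elim n)
    let ?a = "restrict_to (\<nu>s n) (- G)"
    have a: "?a \<in> \<E>" using finite_energy_pos_restrict[OF D(1)] Gb by (simp add: borel_comp)
    have aa: "mutual ?a ?a \<le> mutual (\<nu>s n) (\<nu>s n)"
      using mutual_restrict_le[OF D(1) a borel_comp[OF Gb]] mutual_restrict_le[OF D(1) D(1) borel_comp[OF Gb]]
        mutual_commute[OF a D(1)] by (metis order_trans)
    have "mutual ?a (\<nu>s n) - mutual ?a \<nu> \<le> sqrt (sqdist (\<nu>s n) \<nu>) * sqrt (mutual ?a ?a)"
      using mutual_diff_bound[OF D(1)[of n] D(2) a] mutual_commute[OF a D(1)[of n]] mutual_commute[OF a D(2)]
      by (auto simp: abs_le_iff)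
    also have "\<dots> \<le> sqrt (sqdist (\<nu>s n) \<nu>) * sqrt (mutual (\<nu>s n) (\<nu>s n))"
      using aa energy_radon_diff(3)[OF D(1,2)] by (intro mult_left_mono real_sqrt_le_mono) auto
    finally have "mutual ?a (\<nu>s n) \<le> mutual ?a \<nu> + d / 3" using elim(3) by simp
    moreover have "mutual ?a \<nu> \<le> mutual (restrict_to \<nu> (- G)) \<nu> + 2 * d / 3"
      using elim(1,2) mutual_split[OF D(1,2) Gb] mutual_split[OF D(2,2) Gb] by simp
    ultimately show ?case by simp
  qed
qed

text \<open>
  This makes an external field tractable that is semicontinuous only along compact subsets of an
  arbitrary set \<open>A\<close>. Most of the energy of the limit lives on
  one compact \<open>K0 \<subseteq> A\<close>; strong convergence forces the members of the sequence to have little energy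
  outside any given neighbourhood of \<open>K0\<close>. Within ever smaller neighbourhoods, inner regularity
  replaces the members by compact parts \<open>H i \<subseteq> A\<close> shrinking to \<open>K0\<close>, so that \<open>K0 \<union> (\<Union>i. H i)\<close> is
  compact.
\<close>

lemma strong_tightness:
  assumes conv: "strongly_converges \<nu>s \<nu>"
    and A: "\<And>n. AE x in \<nu>s n. x \<in> A" "AE x in \<nu>. x \<in> A" and e: "0 < e"
  obtains K r where "compact K" "K \<subseteq> A" "strict_mono r"
    "\<And>i::nat. mutual (restrict_to (\<nu>s (r i)) (- K)) (\<nu>s (r i)) \<le> e"
proof -
  note D = strongly_convergesD[OF conv]
  have r: "radon \<nu>" "\<And>n. radon (\<nu>s n)" using D radon_finite_energy_pos by auto
  have I: "(\<integral>\<^sup>+x. indicator B x * \<U> \<mu> x \<partial>\<mu>) = ennreal (mutual (restrict_to \<mu> B) \<mu>)"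
    if "\<mu> \<in> \<E>" "B \<in> sets borel" for \<mu> B
    using pos_energy_restrict[OF radon_finite_energy_pos radon_finite_energy_pos, OF that(1,1,2)]
      pos_energy_mutual[OF finite_energy_pos_restrict[OF that] that(1)] by simp
  have fin: "(\<integral>\<^sup>+x. \<U> \<mu> x \<partial>\<mu>) < \<infinity>" if "\<mu> \<in> \<E>" for \<mu>
    using that pos_energy_eq[of \<mu> \<mu>] by (simp add: finite_energy_pos_iff)
  obtain K0 where K0: "compact K0" "K0 \<subseteq> A" "(\<integral>\<^sup>+x. indicator (- K0) x * \<U> \<nu> x \<partial>\<nu>) \<le> ennreal (e / 3)"
    by (rule integral_compact_tail[OF lc r(1) A(2) pos_potential_measurable[OF r(1)] fin[OF D(2)], of "e / 3"])
       (use e in simp, rule that)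
  have K0b: "K0 \<in> sets borel" using K0(1) by (rule borel_compact)
  obtain G :: "nat \<Rightarrow> 'a set" where G: "\<And>i. open (G i)" "\<And>i. K0 \<subseteq> G i"
    "\<And>V. open V \<Longrightarrow> K0 \<subseteq> V \<Longrightarrow> \<exists>i. \<forall>j\<ge>i. G j \<subseteq> V"
    by (rule compact_nhds_base[OF K0(1)]) (rule that)
  have Gb: "G i \<in> sets borel" for i using G(1) by simp
  have outG: "mutual (restrict_to \<nu> (- G i)) \<nu> \<le> e / 3" for i
  proof -
    have "ennreal (mutual (restrict_to \<nu> (- G i)) \<nu>) \<le> (\<integral>\<^sup>+x. indicator (- K0) x * \<U> \<nu> x \<partial>\<nu>)"
      unfolding I[OF D(2) borel_comp[OF Gb], symmetric]
      using G(2) by (intro nn_integral_mono) (auto simp: indicator_def)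
    also note K0(3)
    finally show ?thesis using e by simp
  qed
  have "\<forall>i. \<exists>N. \<forall>n\<ge>N. mutual (restrict_to (\<nu>s n) (- G i)) (\<nu>s n) \<le> 2 * e / 3"
  proof
    fix i
    have "\<forall>\<^sub>F n in sequentially. mutual (restrict_to (\<nu>s n) (- G i)) (\<nu>s n) \<le> mutual (restrict_to \<nu> (- G i)) \<nu> + e / 3"
      by (rule eventually_energy_outside_open[OF conv G(1)]) (use e in simp)
    then have "\<forall>\<^sub>F n in sequentially. mutual (restrict_to (\<nu>s n) (- G i)) (\<nu>s n) \<le> 2 * e / 3"
      by eventually_elim (use outG[of i] in linarith)
    then show "\<exists>N. \<forall>n\<ge>N. mutual (restrict_to (\<nu>s n) (- G i)) (\<nu>s n) \<le> 2 * e / 3"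
      unfolding eventually_sequentially .
  qed
  then obtain N where N: "\<And>i n. n \<ge> N i \<Longrightarrow> mutual (restrict_to (\<nu>s n) (- G i)) (\<nu>s n) \<le> 2 * e / 3" by metis
  \<comment> \<open>A strictly increasing sequence above \<open>N\<close>.\<close>
  define r where "r i = i + (\<Sum>j\<le>i. N j)" for i
  have rmono: "strict_mono r" unfolding r_def by (rule strict_monoI_Suc) simp
  have rN: "N i \<le> r i" for i
    unfolding r_def using member_le_sum[of i "{..i}" N] by simp
  have "\<exists>H. compact H \<and> H \<subseteq> A \<inter> G i
      \<and> (\<integral>\<^sup>+x. indicator (- H) x * \<U> (\<nu>s (r i)) x \<partial>restrict_to (\<nu>s (r i)) (G i)) \<le> ennreal (e / 3)" for i
  proof -
    let ?\<mu> = "\<nu>s (r i)"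
    have rad: "radon (restrict_to ?\<mu> (G i))"
      using finite_energy_pos_restrict[OF D(1) Gb] by (rule radon_finite_energy_pos)
    have "AE x in restrict_to ?\<mu> (G i). x \<in> A \<inter> G i"
      using A(1)[of "r i"] Gb sets_radon[OF \<open>\<And>n. radon (\<nu>s n)\<close>]
      by (subst AE_density) (auto intro!: borel_measurable_indicator elim: eventually_mono split: split_indicator_asm)
    moreover have "(\<integral>\<^sup>+x. \<U> ?\<mu> x \<partial>restrict_to ?\<mu> (G i)) < \<infinity>"
      using energy_radon_diff(1)[OF finite_energy_pos_restrict[OF D(1)[of "r i"] Gb[of i]] D(1)[of "r i"]]
      unfolding pos_energy_eq[OF rad \<open>\<And>n. radon (\<nu>s n)\<close>] .
    ultimately obtain H where "compact H" "H \<subseteq> A \<inter> G i"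
      "(\<integral>\<^sup>+x. indicator (- H) x * \<U> ?\<mu> x \<partial>restrict_to ?\<mu> (G i)) \<le> ennreal (e / 3)"
      using e
      by - (rule integral_compact_tail[OF lc rad _ pos_potential_measurable[OF \<open>\<And>n. radon (\<nu>s n)\<close>], of "A \<inter> G i" "r i" "e / 3"],
          assumption, assumption, simp, rule that)
    then show ?thesis by blast
  qed
  then obtain H where H: "\<And>i. compact (H i)" "\<And>i. H i \<subseteq> A \<inter> G i"
    "\<And>i. (\<integral>\<^sup>+x. indicator (- H i) x * \<U> (\<nu>s (r i)) x \<partial>restrict_to (\<nu>s (r i)) (G i)) \<le> ennreal (e / 3)"
    by metis
  define K where "K = K0 \<union> (\<Union>i. H i)"
  have Kc: "compact K"
    unfolding K_def by (rule compact_Un_shrinking[OF K0(1) H(1) _ G(3)]) (use H(2) in blast)+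
  have Kb: "K \<in> sets borel" using Kc by (rule borel_compact)
  have bound: "mutual (restrict_to (\<nu>s (r i)) (- K)) (\<nu>s (r i)) \<le> e" for i
  proof -
    let ?\<mu> = "\<nu>s (r i)" and ?U = "\<U> (\<nu>s (r i))"
    have Hb: "H i \<in> sets borel" using H(1) by (rule borel_compact)
    note s = sets_radon[OF \<open>\<And>n. radon (\<nu>s n)\<close>, of "r i"]
    have Um: "?U \<in> borel_measurable borel" by (rule pos_potential_measurable[OF \<open>\<And>n. radon (\<nu>s n)\<close>])
    have [measurable]: "?U \<in> borel_measurable ?\<mu>" "G i \<in> sets ?\<mu>" "H i \<in> sets ?\<mu>" "- G i \<in> sets ?\<mu>" "- H i \<in> sets ?\<mu>"
      using Um Gb Hb s by (simp_all add: borel_comp cong: measurable_cong_sets)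
    have "ennreal (mutual (restrict_to ?\<mu> (- K)) ?\<mu>) = (\<integral>\<^sup>+x. indicator (- K) x * ?U x \<partial>?\<mu>)"
      by (rule I[OF D(1) borel_comp[OF Kb], symmetric])
    also have "\<dots> \<le> (\<integral>\<^sup>+x. indicator (- G i) x * ?U x + indicator (G i) x * (indicator (- H i) x * ?U x) \<partial>?\<mu>)"
      unfolding K_def by (intro nn_integral_mono) (auto simp: indicator_def)
    also have "\<dots> = (\<integral>\<^sup>+x. indicator (- G i) x * ?U x \<partial>?\<mu>) + (\<integral>\<^sup>+x. indicator (G i) x * (indicator (- H i) x * ?U x) \<partial>?\<mu>)"
      by (rule nn_integral_add) measurable
    also have "(\<integral>\<^sup>+x. indicator (G i) x * (indicator (- H i) x * ?U x) \<partial>?\<mu>)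
        = (\<integral>\<^sup>+x. indicator (- H i) x * ?U x \<partial>restrict_to ?\<mu> (G i))"
      using Hb Gb Um s by (subst nn_integral_restrict_to) (auto intro!: borel_measurable_times_ennreal)
    also have "(\<integral>\<^sup>+x. indicator (- G i) x * ?U x \<partial>?\<mu>) = ennreal (mutual (restrict_to ?\<mu> (- G i)) ?\<mu>)"
      by (rule I[OF D(1) borel_comp[OF Gb]])
    also have "ennreal (mutual (restrict_to ?\<mu> (- G i)) ?\<mu>) + (\<integral>\<^sup>+x. indicator (- H i) x * ?U x \<partial>restrict_to ?\<mu> (G i))
        \<le> ennreal (2 * e / 3) + ennreal (e / 3)"
      using N[OF rN[of i]] by (intro add_mono H(3) ennreal_leI)
    also have "\<dots> = ennreal e" using e by (simp add: ennreal_plus[symmetric] del: ennreal_plus)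
    finally show ?thesis using e by simp
  qed
  show thesis
    by (rule that[OF Kc _ rmono bound]) (use K0(2) H(2) in \<open>auto simp: K_def\<close>)
qed

section \<open>Sets of inner capacity zero\<close>

lemma finite_energy_on_iff:
  "\<mu> \<in> \<E>_on A \<longleftrightarrow> \<mu> \<in> \<E> \<and> (AE x in \<mu>. x \<in> A)"
  unfolding finite_energy_on_def by simp

lemma compact_capacity_pos:
  assumes \<mu>: "\<mu> \<in> \<E>_on K" "emeasure \<mu> K = 1"
  shows "0 < compact_capacity \<kappa> K"
proof -
  have "(INF \<mu>\<in>{\<mu>\<in>\<E>_on K. emeasure \<mu> K = 1}. \<I> \<mu> \<mu>) \<le> \<I> \<mu> \<mu>"
    using \<mu> by (intro INF_lower) auto
  also have "\<dots> < \<infinity>" using \<mu>(1) by (simp add: finite_energy_on_iff finite_energy_pos_iff)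
  finally show ?thesis unfolding compact_capacity_def by (simp add: ennreal_zero_less_divide)
qed

text \<open>
  A compact set charged by \<open>\<mu>\<close> has positive capacity, as the normalized restriction of \<open>\<mu>\<close> shows.
  The exceptional set need not be Borel, since \<open>A\<close> is arbitrary; its intersection with a Borel subset
  of \<open>A\<close> carrying \<open>\<mu>\<close> is.
\<close>

lemma AE_of_nearly_everywhere:
  assumes \<mu>: "\<mu> \<in> \<E>_on A" and P: "{x. \<not> P x} \<in> sets borel"
    and ne: "nearly_everywhere \<kappa> A P"
  shows "AE x in \<mu>. P x"
proof -
  have E: "\<mu> \<in> \<E>" and A: "AE x in \<mu>. x \<in> A" using \<mu> by (auto simp: finite_energy_on_iff)
  have r: "radon \<mu>" using E by (rule radon_finite_energy_pos)
  note s = sets_radon[OF r]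
  obtain B where B: "B \<in> sets borel" "B \<subseteq> A" "AE x in \<mu>. x \<in> B"
    by (rule AE_in_borel_subset[OF s A])
  let ?N = "B \<inter> {x. \<not> P x}"
  have Nb: "?N \<in> sets borel" using B(1) P by auto
  have "emeasure \<mu> ?N = (SUP K\<in>{K. compact K \<and> K \<subseteq> ?N}. emeasure \<mu> K)"
    using r Nb unfolding radon_def by blast
  also have "\<dots> = 0"
  proof (rule antisym[OF SUP_least], clarify)
    fix K assume K: "compact K" "K \<subseteq> ?N"
    have Kb: "K \<in> sets borel" using K(1) by (rule borel_compact)
    show "emeasure \<mu> K \<le> 0"
    proof (rule ccontr)
      assume "\<not> emeasure \<mu> K \<le> 0"
      then obtain m where m: "emeasure \<mu> K = ennreal m" "0 < m"
        using compact_finite_radon[OF r K(1)] by (cases "emeasure \<mu> K") (auto simp: ennreal_eq_0_iff not_le)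
      define \<tau> where "\<tau> = scale_measure (ennreal (1 / m)) (restrict_to \<mu> K)"
      have "\<tau> \<in> \<E>"
        unfolding \<tau>_def by (intro finite_energy_pos_scale finite_energy_pos_restrict E Kb)
      moreover have s\<tau>: "sets \<tau> = sets borel" unfolding \<tau>_def using s by simp
      moreover have "emeasure \<tau> (- K) = 0"
        unfolding \<tau>_def using Kb s by (simp add: emeasure_restrict_to borel_comp)
      then have "AE x in \<tau>. x \<in> K"
        using s\<tau> Kb by (intro AE_I[of _ _ "- K"]) (auto simp: borel_comp)
      ultimately have on: "\<tau> \<in> \<E>_on K" by (simp add: finite_energy_on_iff)
      have "emeasure \<tau> K = 1"
        unfolding \<tau>_def using Kb s m by (simp add: emeasure_restrict_to ennreal_mult[symmetric])
      then have "0 < compact_capacity \<kappa> K" by (rule compact_capacity_pos[OF on])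
      also have "\<dots> \<le> inner_capacity \<kappa> {x\<in>A. \<not> P x}"
        unfolding inner_capacity_def using K B(2) by (intro SUP_upper) auto
      finally show False using ne unfolding nearly_everywhere_def by simp
    qed
  qed simp
  finally have "AE x in \<mu>. x \<notin> ?N"
    using Nb s by (intro AE_I[of _ _ ?N]) auto
  then show ?thesis using B(3) by eventually_elim auto
qed

lemma nearly_everywhereI:
  assumes "\<And>K \<mu>. compact K \<Longrightarrow> K \<subseteq> {x\<in>A. \<not> P x} \<Longrightarrow> \<mu> \<in> \<E>_on K \<Longrightarrow> emeasure \<mu> K = 1 \<Longrightarrow> False"
  shows "nearly_everywhere \<kappa> A P"
proof -
  have "compact_capacity \<kappa> K = 0" if "compact K" "K \<subseteq> {x\<in>A. \<not> P x}" for K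
  proof -
    have "{\<mu>\<in>\<E>_on K. emeasure \<mu> K = 1} = {}" using assms[OF that] by blast
    then show ?thesis unfolding compact_capacity_def by (simp only: image_empty) simp
  qed
  then show ?thesis
    unfolding nearly_everywhere_def inner_capacity_def by (auto intro!: antisym SUP_least)
qed

end

section \<open>The Gauss variational problem with an external field\<close>

lemma AE_msum:
  assumes s: "sets \<mu> = sets borel" "sets \<nu> = sets borel"
    and P: "AE x in \<mu>. P x" "AE x in \<nu>. P x"
  shows "AE x in msum \<mu> \<nu>. P x"
proof -
  have sp: "space \<mu> = UNIV" "space \<nu> = UNIV" using s[THEN sets_eq_imp_space_eq] by simp_all
  obtain M where M: "{x \<in> space \<mu>. \<not> P x} \<subseteq> M" "emeasure \<mu> M = 0" "M \<in> sets \<mu>"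
    using P(1) by (rule AE_E)
  obtain N where N: "{x \<in> space \<nu>. \<not> P x} \<subseteq> N" "emeasure \<nu> N = 0" "N \<in> sets \<nu>"
    using P(2) by (rule AE_E)
  have MN: "M \<in> sets borel" "N \<in> sets borel" using M(3) N(3) s by simp_all
  have "emeasure \<mu> (M \<inter> N) = 0" "emeasure \<nu> (M \<inter> N) = 0"
    using emeasure_mono[of "M \<inter> N" M \<mu>] emeasure_mono[of "M \<inter> N" N \<nu>] M N by auto
  then have "emeasure (msum \<mu> \<nu>) (M \<inter> N) = 0" using MN by (simp add: emeasure_msum[OF s])
  then show ?thesis using M(1) N(1) MN sp by (intro AE_I[of _ _ "M \<inter> N"]) auto
qed

lemma AE_scale_measure:
  assumes "AE x in \<mu>. P x" shows "AE x in scale_measure t \<mu>. P x"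
proof -
  obtain N where "{x \<in> space \<mu>. \<not> P x} \<subseteq> N" "emeasure \<mu> N = 0" "N \<in> sets \<mu>"
    using assms by (rule AE_E)
  then show ?thesis by (intro AE_I[of _ _ N]) (auto simp: space_scale_measure)
qed

lemma AE_restrict_to:
  assumes "sets \<mu> = sets borel" "B \<in> sets borel" "AE x in \<mu>. P x"
  shows "AE x in restrict_to \<mu> B. P x"
  using assms by (subst AE_density) (auto intro!: borel_measurable_indicator elim: eventually_mono)

lemma AE_eq_of_nn_integral_eq:
  assumes f: "f \<in> borel_measurable \<mu>" and g: "g \<in> borel_measurable \<mu>"
    and fin: "(\<integral>\<^sup>+x. f x \<partial>\<mu>) \<noteq> \<infinity>" and le: "AE x in \<mu>. f x \<le> g x"
    and int: "(\<integral>\<^sup>+x. g x \<partial>\<mu>) \<le> (\<integral>\<^sup>+x. f x \<partial>\<mu>)"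
  shows "AE x in \<mu>. f x = g x"
proof -
  have "AE x in \<mu>. g x \<le> f x"
    using nn_integral_less[OF f g fin le] int by (auto simp: not_less[symmetric])
  with le show ?thesis by eventually_elim simp
qed

lemma nonneg_of_small_quadratic:
  fixes x y :: real
  assumes "\<And>t. 0 < t \<Longrightarrow> t \<le> 1 \<Longrightarrow> 0 \<le> t\<^sup>2 * x + 2 * t * y" and x: "0 \<le> x"
  shows "0 \<le> y"
proof (rule ccontr)
  assume "\<not> 0 \<le> y"
  define t where "t = min 1 (- y / (x + 1))"
  have t: "0 < t" "t \<le> 1" unfolding t_def using \<open>\<not> 0 \<le> y\<close> x by (auto intro: divide_neg_pos)
  have "t * (x + 1) \<le> - y / (x + 1) * (x + 1)" unfolding t_def using x by (intro mult_right_mono) auto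
  also have "- y / (x + 1) * (x + 1) = - y" using x by simp
  finally have "t * x + y \<le> 0" using t by (simp add: distrib_left)
  then have "t * (t * x + 2 * y) < 0" using \<open>\<not> 0 \<le> y\<close> t by (intro mult_pos_neg) auto
  then show False using assms(1)[OF t] by (simp add: power2_eq_square algebra_simps)
qed

text \<open>
  The external field is \<open>f = q - p\<close> with \<open>p\<close>, \<open>q\<close> nonnegative. The attractive part \<open>p\<close> is the dangerous
  one: its integrals have to be dominated by the norm, and must not drop in strong limits. For the
  repulsive part lower semicontinuity suffices.
\<close>

locale gauss_problem = perfect_kernel \<kappa>
  for \<kappa> :: "'a::{t2_space, second_countable_topology} \<Rightarrow> 'a \<Rightarrow> ennreal" +
  fixes A :: "'a set" and p q :: "'a \<Rightarrow> ennreal" and C :: real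
  assumes p_measurable: "p \<in> borel_measurable borel"
    and q_lsc: "\<And>t. open {x. t < q x}"
    and closed: "\<And>\<nu>s \<nu>. strongly_converges \<nu>s \<nu> \<Longrightarrow> (\<And>n. \<nu>s n \<in> finite_energy_on \<kappa> A)
      \<Longrightarrow> \<nu> \<in> finite_energy_on \<kappa> A"
    and C_nonneg: "0 \<le> C"
    and p_bound: "\<And>\<mu>. \<mu> \<in> finite_energy_on \<kappa> A \<Longrightarrow> (\<integral>\<^sup>+x. p x \<partial>\<mu>) \<le> ennreal (C * sqrt (mutual \<mu> \<mu>))"
    and p_usc: "\<And>\<nu>s \<nu> e. strongly_converges \<nu>s \<nu> \<Longrightarrow> (\<And>n. \<nu>s n \<in> finite_energy_on \<kappa> A)
      \<Longrightarrow> \<nu> \<in> finite_energy_on \<kappa> A \<Longrightarrow> 0 < e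
      \<Longrightarrow> \<forall>\<^sub>F n in sequentially. (\<integral>\<^sup>+x. p x \<partial>\<nu>s n) \<le> (\<integral>\<^sup>+x. p x \<partial>\<nu>) + ennreal e"
begin

definition admissible :: "'a measure set" where
  "admissible = {\<mu>\<in>\<E>_on A. (\<integral>\<^sup>+x. q x \<partial>\<mu>) < \<infinity>}"

definition P :: "'a measure \<Rightarrow> real" where "P \<mu> = enn2real (\<integral>\<^sup>+x. p x \<partial>\<mu>)"
definition Q :: "'a measure \<Rightarrow> real" where "Q \<mu> = enn2real (\<integral>\<^sup>+x. q x \<partial>\<mu>)"

definition J :: "'a measure \<Rightarrow> real" where "J \<mu> = mutual \<mu> \<mu> - 2 * P \<mu> + 2 * Q \<mu>"

text \<open>Half the derivative of the functional at \<open>\<nu>\<close> in the direction \<open>\<mu>\<close>.\<close>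

definition slope :: "'a measure \<Rightarrow> 'a measure \<Rightarrow> real" where
  "slope \<nu> \<mu> = mutual \<nu> \<mu> - P \<mu> + Q \<mu>"

definition variational :: "'a measure \<Rightarrow> bool" where
  "variational \<nu> \<longleftrightarrow> (\<forall>\<mu>\<in>admissible. 0 \<le> slope \<nu> \<mu>) \<and> slope \<nu> \<nu> = 0"

lemma q_measurable: "q \<in> borel_measurable borel"
  by (rule borel_measurableI_greater) (simp add: borel_open q_lsc)

lemma p_finite:
  assumes "\<mu> \<in> \<E>_on A"
  shows "(\<integral>\<^sup>+x. p x \<partial>\<mu>) = ennreal (P \<mu>)" "P \<mu> \<le> C * sqrt (mutual \<mu> \<mu>)"
proof -
  have "(\<integral>\<^sup>+x. p x \<partial>\<mu>) < \<infinity>" using p_bound[OF assms] by (auto intro: le_less_trans)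
  then show 1: "(\<integral>\<^sup>+x. p x \<partial>\<mu>) = ennreal (P \<mu>)" unfolding P_def by simp
  show "P \<mu> \<le> C * sqrt (mutual \<mu> \<mu>)"
    using p_bound[OF assms] C_nonneg mutual_nonneg unfolding 1 by (simp add: ennreal_le_iff)
qed

lemma P_nonneg: "0 \<le> P \<mu>" and Q_nonneg: "0 \<le> Q \<mu>"
  by (simp_all add: P_def Q_def)

lemma admissibleD:
  assumes "\<mu> \<in> admissible"
  shows "\<mu> \<in> \<E>_on A" "\<mu> \<in> \<E>" "radon \<mu>" "sets \<mu> = sets borel"
    "AE x in \<mu>. x \<in> A" "(\<integral>\<^sup>+x. q x \<partial>\<mu>) = ennreal (Q \<mu>)" "(\<integral>\<^sup>+x. p x \<partial>\<mu>) = ennreal (P \<mu>)"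
  using assms p_finite(1) radon_finite_energy_pos sets_radon
  unfolding admissible_def Q_def by (auto simp: finite_energy_on_iff)

lemma admissibleI:
  "\<mu> \<in> \<E> \<Longrightarrow> AE x in \<mu>. x \<in> A \<Longrightarrow> (\<integral>\<^sup>+x. q x \<partial>\<mu>) < \<infinity> \<Longrightarrow> \<mu> \<in> admissible"
  unfolding admissible_def by (simp add: finite_energy_on_iff)

lemma admissible_null: "null_measure borel \<in> admissible"
  by (intro admissibleI finite_energy_pos_null) (auto intro!: AE_I[of _ _ UNIV])

lemma admissible_msum:
  assumes "\<mu> \<in> admissible" "\<nu> \<in> admissible"
  shows "msum \<mu> \<nu> \<in> admissible" "P (msum \<mu> \<nu>) = P \<mu> + P \<nu>" "Q (msum \<mu> \<nu>) = Q \<mu> + Q \<nu>"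
proof -
  note D = admissibleD[OF assms(1)] admissibleD[OF assms(2)]
  have I: "(\<integral>\<^sup>+x. q x \<partial>msum \<mu> \<nu>) = ennreal (Q \<mu>) + ennreal (Q \<nu>)"
    "(\<integral>\<^sup>+x. p x \<partial>msum \<mu> \<nu>) = ennreal (P \<mu>) + ennreal (P \<nu>)"
    using D p_measurable q_measurable by (simp_all add: nn_integral_msum)
  show "msum \<mu> \<nu> \<in> admissible"
    using D I by (intro admissibleI finite_energy_pos_msum AE_msum) simp_all
  show "P (msum \<mu> \<nu>) = P \<mu> + P \<nu>" "Q (msum \<mu> \<nu>) = Q \<mu> + Q \<nu>"
    unfolding P_def[of "msum \<mu> \<nu>"] Q_def[of "msum \<mu> \<nu>"] I
    by (simp_all add: enn2real_plus P_nonneg Q_nonneg)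
qed

lemma admissible_scale:
  assumes "\<mu> \<in> admissible" "0 \<le> t"
  shows "scale_measure (ennreal t) \<mu> \<in> admissible"
    "P (scale_measure (ennreal t) \<mu>) = t * P \<mu>" "Q (scale_measure (ennreal t) \<mu>) = t * Q \<mu>"
proof -
  note D = admissibleD[OF assms(1)]
  have I: "(\<integral>\<^sup>+x. q x \<partial>scale_measure (ennreal t) \<mu>) = ennreal t * ennreal (Q \<mu>)"
    "(\<integral>\<^sup>+x. p x \<partial>scale_measure (ennreal t) \<mu>) = ennreal t * ennreal (P \<mu>)"
    using D p_measurable q_measurable by (simp_all add: nn_integral_scale_measure cong: measurable_cong_sets)
  show "scale_measure (ennreal t) \<mu> \<in> admissible"
    using D I by (intro admissibleI finite_energy_pos_scale AE_scale_measure) (simp_all add: ennreal_mult_less_top)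
  show "P (scale_measure (ennreal t) \<mu>) = t * P \<mu>" "Q (scale_measure (ennreal t) \<mu>) = t * Q \<mu>"
    unfolding P_def[of "scale_measure _ _"] Q_def[of "scale_measure _ _"] I
    using assms(2) by (simp_all add: enn2real_mult P_nonneg Q_nonneg)
qed

lemma admissible_restrict:
  assumes \<mu>: "\<mu> \<in> admissible" and B: "B \<in> sets borel"
  shows "restrict_to \<mu> B \<in> admissible"
proof (rule admissibleI)
  note D = admissibleD[OF \<mu>]
  show "restrict_to \<mu> B \<in> \<E>" using D B by (intro finite_energy_pos_restrict)
  show "AE x in restrict_to \<mu> B. x \<in> A" using D B by (intro AE_restrict_to)
  have "(\<integral>\<^sup>+x. q x \<partial>restrict_to \<mu> B) \<le> (\<integral>\<^sup>+x. q x \<partial>\<mu>)"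
    unfolding nn_integral_restrict_to[OF D(4) B q_measurable] by (intro nn_integral_mono) (auto simp: indicator_def)
  then show "(\<integral>\<^sup>+x. q x \<partial>restrict_to \<mu> B) < \<infinity>" unfolding D(6) by (auto intro: le_less_trans)
qed

lemma J_lower_bound:
  assumes "\<mu> \<in> admissible" shows "- C\<^sup>2 \<le> J \<mu>"
proof -
  let ?m = "sqrt (mutual \<mu> \<mu>)"
  have "?m\<^sup>2 - 2 * ?m * C \<le> J \<mu>"
    using p_finite(2)[OF admissibleD(1)[OF assms]] Q_nonneg[of \<mu>] mutual_nonneg[of \<mu> \<mu>] unfolding J_def by (simp add: mult.commute)
  moreover have "0 \<le> (?m - C)\<^sup>2" by simp
  ultimately show ?thesis by (simp add: power2_diff)
qed

lemma J_parallelogram: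
  assumes \<mu>: "\<mu> \<in> admissible" and \<nu>: "\<nu> \<in> admissible"
  shows "sqdist \<mu> \<nu> = 2 * J \<mu> + 2 * J \<nu> - 4 * J (scale_measure (ennreal (1/2)) (msum \<mu> \<nu>))"
proof -
  define t :: real where "t = 1/2"
  then have t: "0 \<le> t" by simp
  note E = admissibleD(2)[OF \<mu>] admissibleD(2)[OF \<nu>]
  have "J (scale_measure (ennreal t) (msum \<mu> \<nu>))
      = t\<^sup>2 * (mutual \<mu> \<mu> + 2 * mutual \<mu> \<nu> + mutual \<nu> \<nu>) - 2 * t * (P \<mu> + P \<nu>) + 2 * t * (Q \<mu> + Q \<nu>)"
    using admissible_scale[OF admissible_msum(1)[OF \<mu> \<nu>] t] admissible_msum[OF \<mu> \<nu>] E t mutual_commute[OF E(2,1)]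
    unfolding J_def
    by (simp add: mutual_scale mutual_msum finite_energy_pos_msum finite_energy_pos_scale power2_eq_square algebra_simps)
  then show ?thesis unfolding t_def J_def sqdist_def by (simp add: power2_eq_square field_simps)
qed

text \<open>
  A minimizing sequence is strongly Cauchy by the parallelogram identity. Its strong limit is
  admissible and a minimizer since, along the sequence, the energy converges, \<open>p\<close> loses nothing and
  \<open>q\<close> is lower semicontinuous.
\<close>

lemma minimizer_exists:
  obtains \<nu> where "\<nu> \<in> admissible" "\<And>\<mu>. \<mu> \<in> admissible \<Longrightarrow> J \<nu> \<le> J \<mu>"
proof -
  define w where "w = (INF \<mu>\<in>admissible. J \<mu>)"
  have bdd: "bdd_below (J ` admissible)" using J_lower_bound by (auto intro!: bdd_belowI2)
  have w: "w \<le> J \<mu>" if "\<mu> \<in> admissible" for \<mu> unfolding w_def using bdd that by (rule cINF_lower)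
  have "\<exists>\<mu>\<in>admissible. J \<mu> < w + 1 / Suc n" for n
    using cINF_less_iff[OF _ bdd, of "w + 1 / Suc n"] admissible_null unfolding w_def by auto
  then obtain \<nu>s where \<nu>s: "\<And>n. \<nu>s n \<in> admissible" "\<And>n. J (\<nu>s n) < w + 1 / Suc n" by metis
  have small: "J (\<nu>s n) < w + 1 / Suc N" if "N \<le> n" for n N
  proof -
    have "1 / real (Suc n) \<le> 1 / real (Suc N)" using that by (intro divide_left_mono) auto
    then show ?thesis using \<nu>s(2)[of n] by linarith
  qed
  obtain \<nu> where conv: "strongly_converges \<nu>s \<nu>"
  proof (rule strongly_complete)
    show "\<nu>s n \<in> \<E>" for n using \<nu>s(1) by (rule admissibleD)
    fix e :: real assume "0 < e"
    then have e4: "0 < e / 4" by simp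
    obtain N where N: "1 / real (Suc N) < e / 4" by (rule nat_approx_posE[OF e4]) (rule that)
    have "sqdist (\<nu>s n) (\<nu>s m) < e" if "N \<le> n" "N \<le> m" for n m
      using J_parallelogram[OF \<nu>s(1) \<nu>s(1), of n m] small[OF that(1)] small[OF that(2)] N
        w[OF admissible_scale(1)[OF admissible_msum(1)[OF \<nu>s(1)[of n] \<nu>s(1)[of m]], of "1/2"]] by simp
    then show "\<exists>N. \<forall>n\<ge>N. \<forall>m\<ge>N. sqdist (\<nu>s n) (\<nu>s m) < e" by blast
  qed (rule that)
  have on: "\<nu>s n \<in> \<E>_on A" for n using \<nu>s(1) by (rule admissibleD)
  have \<nu>on: "\<nu> \<in> \<E>_on A" by (rule closed[OF conv on])
  \<comment> \<open>The value of \<open>2 * Q \<nu>\<close> for which \<open>J \<nu> = w\<close>.\<close>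
  define b where "b = w - mutual \<nu> \<nu> + 2 * P \<nu>"
  have ev: "\<forall>\<^sub>F n in sequentially. 2 * Q (\<nu>s n) \<le> b + e" if e: "0 < e" for e
  proof -
    have e4: "0 < e / 4" using e by simp
    obtain N where N: "1 / real (Suc N) < e / 4" by (rule nat_approx_posE[OF e4]) (rule that)
    have "\<forall>\<^sub>F n in sequentially. mutual \<nu> \<nu> - e / 4 < mutual (\<nu>s n) (\<nu>s n)"
      using energy_strong_limit[OF conv] by (rule order_tendstoD(1)) (use e in simp)
    then show ?thesis
      using p_usc[OF conv on \<nu>on e4] eventually_ge_at_top[of N]
    proof eventually_elim
      case (elim n)
      have "P (\<nu>s n) \<le> P \<nu> + e / 4"
        using elim(2) e P_nonneg[of \<nu>] unfolding p_finite(1)[OF on] p_finite(1)[OF \<nu>on]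
        by (simp add: ennreal_plus[symmetric] del: ennreal_plus)
      then show ?case
        using small[OF elim(3)] elim(1) N unfolding b_def J_def by linarith
    qed
  qed
  have bound: "(\<integral>\<^sup>+x. q x \<partial>\<nu>) \<le> ennreal ((b + e) / 2)" if e: "0 < e" for e
  proof -
    have "\<forall>\<^sub>F n in sequentially. (\<integral>\<^sup>+x. q x \<partial>\<nu>s n) \<le> ennreal ((b + e) / 2)"
      using ev[OF e] by eventually_elim (auto simp: admissibleD(6)[OF \<nu>s(1)] intro!: ennreal_leI)
    then have "liminf (\<lambda>n. \<integral>\<^sup>+x. q x \<partial>\<nu>s n) \<le> ennreal ((b + e) / 2)"
      by (intro Liminf_le) auto
    then show ?thesis using liminf_integral_lsc[OF conv q_lsc] by (rule order_trans[rotated])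
  qed
  have "(\<integral>\<^sup>+x. q x \<partial>\<nu>) < \<infinity>" using bound[of 1] by (auto intro: le_less_trans)
  then have adm: "\<nu> \<in> admissible" using \<nu>on unfolding admissible_def by simp
  have be: "0 \<le> b + e" if e: "0 < e" for e
  proof -
    obtain n where "2 * Q (\<nu>s n) \<le> b + e" using eventually_happens'[OF sequentially_bot ev[OF e]] by blast
    then show ?thesis using Q_nonneg[of "\<nu>s n"] by simp
  qed
  have "2 * Q \<nu> \<le> b + e" if e: "0 < e" for e
    using bound[OF e] be[OF e] unfolding admissibleD(6)[OF adm] by (simp add: ennreal_le_iff)
  then have "2 * Q \<nu> \<le> b" by (rule field_le_epsilon)
  then have "J \<nu> \<le> w" unfolding J_def b_def by simp
  then show thesis using that[OF adm] w by (blast intro: order_trans)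
qed

text \<open>
  Moving from \<open>\<nu>\<close> to \<open>\<nu> + t \<mu>\<close> gives the inequality for all \<open>\<mu>\<close>. In the direction of \<open>\<nu>\<close> itself the
  admissible cone also contains \<open>(1 - t) \<nu>\<close>, which gives the reverse inequality.
\<close>

lemma minimizer_imp_variational:
  assumes \<nu>: "\<nu> \<in> admissible" and min: "\<And>\<mu>. \<mu> \<in> admissible \<Longrightarrow> J \<nu> \<le> J \<mu>"
  shows "variational \<nu>"
proof -
  note D = admissibleD[OF \<nu>]
  have ge: "0 \<le> slope \<nu> \<mu>" if \<mu>: "\<mu> \<in> admissible" for \<mu>
  proof (rule nonneg_of_small_quadratic[OF _ mutual_nonneg])
    fix t :: real assume t: "0 < t" "t \<le> 1"
    let ?t = "scale_measure (ennreal t) \<mu>"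
    have at: "?t \<in> admissible" "P ?t = t * P \<mu>" "Q ?t = t * Q \<mu>" using admissible_scale[OF \<mu>] t by auto
    note E = admissibleD(2)[OF \<mu>] admissibleD(2)[OF at(1)]
    have "J (msum \<nu> ?t) = J \<nu> + (t\<^sup>2 * mutual \<mu> \<mu> + 2 * t * slope \<nu> \<mu>)"
      unfolding J_def slope_def using admissible_msum[OF \<nu> at(1)] at E D(2) t mutual_commute[OF E(1) D(2)]
      by (simp add: mutual_msum mutual_scale finite_energy_pos_msum algebra_simps power2_eq_square)
    then show "0 \<le> t\<^sup>2 * mutual \<mu> \<mu> + 2 * t * slope \<nu> \<mu>"
      using min[OF admissible_msum(1)[OF \<nu> at(1)]] by simp
  qed
  have "0 \<le> - slope \<nu> \<nu>"
  proof (rule nonneg_of_small_quadratic[OF _ mutual_nonneg])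
    fix t :: real assume t: "0 < t" "t \<le> 1"
    let ?t = "scale_measure (ennreal (1 - t)) \<nu>"
    have "J ?t = J \<nu> + (t\<^sup>2 * mutual \<nu> \<nu> + 2 * t * (- slope \<nu> \<nu>))"
      unfolding J_def slope_def using admissible_scale[OF \<nu>, of "1 - t"] t D(2)
      by (simp add: mutual_scale finite_energy_pos_scale algebra_simps power2_eq_square)
    then show "0 \<le> t\<^sup>2 * mutual \<nu> \<nu> + 2 * t * (- slope \<nu> \<nu>)"
      using min[OF admissible_scale(1)[OF \<nu>], of "1 - t"] t by simp
  qed
  then show ?thesis using ge \<nu> unfolding variational_def by force
qed

lemma variational_gap:
  assumes \<nu>: "\<nu> \<in> admissible" "variational \<nu>" and \<mu>: "\<mu> \<in> admissible"
  shows "J \<nu> + sqdist \<mu> \<nu> \<le> J \<mu>"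
proof -
  have "J \<mu> = J \<nu> + sqdist \<mu> \<nu> + 2 * slope \<nu> \<mu> - 2 * slope \<nu> \<nu>"
    unfolding J_def sqdist_def slope_def
    using mutual_commute[OF admissibleD(2)[OF \<mu>] admissibleD(2)[OF \<nu>(1)]] by simp
  then show ?thesis using \<nu>(2) \<mu> unfolding variational_def by simp
qed

theorem unique_minimizer:
  obtains \<nu> where "\<nu> \<in> admissible"
    "\<And>\<mu>. \<mu> \<in> admissible \<Longrightarrow> J \<nu> \<le> J \<mu>"
    "\<And>\<mu>. \<mu> \<in> admissible \<Longrightarrow> (\<forall>\<tau>\<in>admissible. J \<mu> \<le> J \<tau>) \<longleftrightarrow> \<mu> = \<nu>"
    "\<And>\<mu>. \<mu> \<in> admissible \<Longrightarrow> variational \<mu> \<longleftrightarrow> \<mu> = \<nu>"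
proof -
  obtain \<nu> where \<nu>: "\<nu> \<in> admissible" and min: "\<And>\<mu>. \<mu> \<in> admissible \<Longrightarrow> J \<nu> \<le> J \<mu>"
    by (rule minimizer_exists) (rule that)
  have var: "variational \<nu>" by (rule minimizer_imp_variational[OF \<nu> min])
  have uniq: "\<mu> = \<nu>" if \<mu>: "\<mu> \<in> admissible" and le: "J \<mu> \<le> J \<nu>" for \<mu>
  proof (rule energy_radon_diff(4)[OF admissibleD(2)[OF \<mu>] admissibleD(2)[OF \<nu>]])
    show "sqdist \<mu> \<nu> = 0"
      using variational_gap[OF \<nu> var \<mu>] le energy_radon_diff(3)[OF admissibleD(2)[OF \<mu>] admissibleD(2)[OF \<nu>]] by simp
  qed
  have "(\<forall>\<tau>\<in>admissible. J \<mu> \<le> J \<tau>) \<longleftrightarrow> \<mu> = \<nu>" if "\<mu> \<in> admissible" for \<mu>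
    using uniq[OF that] min \<nu> by blast
  moreover have "variational \<mu> \<longleftrightarrow> \<mu> = \<nu>" if \<mu>: "\<mu> \<in> admissible" for \<mu>
    using uniq[OF \<mu>] var variational_gap[OF \<mu> _ \<nu>] energy_radon_diff(3)[OF admissibleD(2)[OF \<nu>] admissibleD(2)[OF \<mu>]]
    by force
  ultimately show thesis using that \<nu> min by blast
qed

lemma nn_integral_potential:
  assumes "\<nu> \<in> admissible" "\<mu> \<in> admissible"
  shows "(\<integral>\<^sup>+x. \<U> \<nu> x + q x \<partial>\<mu>) = ennreal (mutual \<nu> \<mu> + Q \<mu>)"
proof -
  note D = admissibleD[OF assms(1)] and E = admissibleD[OF assms(2)]
  have [measurable]: "\<U> \<nu> \<in> borel_measurable \<mu>" "q \<in> borel_measurable \<mu>"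
    using pos_potential_measurable'[OF D(3) E(4)] q_measurable E(4) by (simp_all cong: measurable_cong_sets)
  have "(\<integral>\<^sup>+x. \<U> \<nu> x \<partial>\<mu>) = ennreal (mutual \<nu> \<mu>)"
    using pos_energy_eq[OF E(3) D(3)] pos_energy_mutual[OF E(2) D(2)] mutual_commute[OF E(2) D(2)] by simp
  then show ?thesis by (simp add: nn_integral_add E(6) mutual_nonneg Q_nonneg)
qed

lemma slope_nonneg_iff:
  assumes "\<nu> \<in> admissible" "\<mu> \<in> admissible"
  shows "0 \<le> slope \<nu> \<mu> \<longleftrightarrow> (\<integral>\<^sup>+x. p x \<partial>\<mu>) \<le> (\<integral>\<^sup>+x. \<U> \<nu> x + q x \<partial>\<mu>)"
    and "slope \<nu> \<mu> = 0 \<longleftrightarrow> (\<integral>\<^sup>+x. p x \<partial>\<mu>) = (\<integral>\<^sup>+x. \<U> \<nu> x + q x \<partial>\<mu>)"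
proof -
  have "0 \<le> mutual \<nu> \<mu> + Q \<mu>" using mutual_nonneg Q_nonneg by simp
  then show "0 \<le> slope \<nu> \<mu> \<longleftrightarrow> (\<integral>\<^sup>+x. p x \<partial>\<mu>) \<le> (\<integral>\<^sup>+x. \<U> \<nu> x + q x \<partial>\<mu>)"
    and "slope \<nu> \<mu> = 0 \<longleftrightarrow> (\<integral>\<^sup>+x. p x \<partial>\<mu>) = (\<integral>\<^sup>+x. \<U> \<nu> x + q x \<partial>\<mu>)"
    unfolding nn_integral_potential[OF assms] admissibleD(7)[OF assms(2)] slope_def
    using P_nonneg[of \<mu>] by (auto simp del: ennreal_plus)
qed

lemma field_measurable:
  assumes "\<nu> \<in> admissible" "sets \<mu> = sets borel"
  shows "(\<lambda>x. \<U> \<nu> x + q x) \<in> borel_measurable \<mu>" "p \<in> borel_measurable \<mu>" "q \<in> borel_measurable \<mu>"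
  using pos_potential_measurable'[OF admissibleD(3)[OF assms(1)] assms(2)] p_measurable q_measurable assms(2)
  by (simp_all cong: measurable_cong_sets)

text \<open>
  The restriction of \<open>\<nu>\<close> to the set where \<open>U\<^sup>\<nu> + q < p\<close> is a competitor whose slope is nonnegative, so
  this set is null. Then \<open>p \<le> U\<^sup>\<nu> + q\<close> almost everywhere, and both sides have the same integral.
\<close>

lemma variational_AE_eq:
  assumes \<nu>: "\<nu> \<in> admissible" and var: "variational \<nu>"
  shows "AE x in \<nu>. \<U> \<nu> x + q x = p x"
proof -
  note D = admissibleD[OF \<nu>]
  let ?u = "\<lambda>x. \<U> \<nu> x + q x"
  note [measurable] = field_measurable[OF \<nu> D(4)] field_measurable[OF \<nu> refl]
  let ?B = "{x. ?u x < p x}"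
  have B: "?B \<in> sets borel" by measurable
  have [measurable]: "?B \<in> sets \<nu>" using B D(4) by simp
  let ?r = "restrict_to \<nu> ?B"
  have r: "?r \<in> admissible" by (rule admissible_restrict[OF \<nu> B])
  have "(\<integral>\<^sup>+x. p x \<partial>?r) \<le> (\<integral>\<^sup>+x. ?u x \<partial>?r)"
    using var r slope_nonneg_iff(1)[OF \<nu> r] unfolding variational_def by blast
  moreover have "AE x in ?r. ?u x \<le> p x"
    by (subst AE_density) (auto simp: indicator_def)
  moreover have "(\<integral>\<^sup>+x. ?u x \<partial>?r) \<noteq> \<infinity>" using nn_integral_potential[OF \<nu> r] by simp
  ultimately have "AE x in ?r. ?u x = p x"
    using field_measurable[OF \<nu> admissibleD(4)[OF r]] by (intro AE_eq_of_nn_integral_eq)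
  then have "AE x in \<nu>. x \<in> ?B \<longrightarrow> ?u x = p x"
    by (subst (asm) AE_density) (auto simp: indicator_def elim: eventually_mono)
  then have ge: "AE x in \<nu>. p x \<le> ?u x" by eventually_elim (auto simp: not_less[symmetric])
  have "(\<integral>\<^sup>+x. ?u x \<partial>\<nu>) \<le> (\<integral>\<^sup>+x. p x \<partial>\<nu>)"
    using var slope_nonneg_iff(2)[OF \<nu> \<nu>] unfolding variational_def by simp
  then have "AE x in \<nu>. p x = ?u x"
    using ge D(7) field_measurable[OF \<nu> D(4)] by (intro AE_eq_of_nn_integral_eq) simp_all
  then show ?thesis by eventually_elim simp
qed

lemma AE_pq_finite:
  assumes "\<mu> \<in> admissible"
  shows "AE x in \<mu>. p x < \<infinity>" "AE x in \<mu>. q x < \<infinity>"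
proof -
  note D = admissibleD[OF assms]
  note m = field_measurable[OF assms D(4)]
  show "AE x in \<mu>. p x < \<infinity>" "AE x in \<mu>. q x < \<infinity>"
    using nn_integral_PInf_AE[OF m(2)] nn_integral_PInf_AE[OF m(3)] D(6,7) by (auto simp: less_top)
qed

text \<open>
  If the inequality failed on a set of positive inner capacity, a measure of finite energy carried by
  a compact part of that set would be a direction of descent; the hypothesis on compact sets makes it
  admissible. Conversely, an inequality that holds nearly everywhere can be integrated against any
  admissible measure.
\<close>

theorem variational_iff_potential:
  assumes \<nu>: "\<nu> \<in> admissible"
    and adm: "\<And>K \<mu>. compact K \<Longrightarrow> K \<subseteq> A \<Longrightarrow> \<mu> \<in> \<E>_on K \<Longrightarrow> (\<integral>\<^sup>+x. q x \<partial>\<mu>) < \<infinity>"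
  shows "variational \<nu> \<longleftrightarrow>
    nearly_everywhere \<kappa> A (\<lambda>x. (p x < \<infinity> \<or> q x < \<infinity>) \<and> p x \<le> \<U> \<nu> x + q x) \<and>
    (AE x in \<nu>. (p x < \<infinity> \<or> q x < \<infinity>) \<and> \<U> \<nu> x + q x = p x)"
    (is "_ \<longleftrightarrow> nearly_everywhere \<kappa> A ?N \<and> ?E")
proof
  let ?u = "\<lambda>x. \<U> \<nu> x + q x"
  note D = admissibleD[OF \<nu>]
  assume var: "variational \<nu>"
  have "nearly_everywhere \<kappa> A ?N"
  proof (rule nearly_everywhereI)
    fix K \<mu> assume K: "compact K" "K \<subseteq> {x\<in>A. \<not> ?N x}" and \<mu>: "\<mu> \<in> \<E>_on K" "emeasure \<mu> K = 1"
    have KA: "K \<subseteq> A" using K(2) by blast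
    have "AE x in \<mu>. x \<in> K" using \<mu>(1) by (simp add: finite_energy_on_iff)
    moreover have "AE x in \<mu>. x \<in> A" using calculation by eventually_elim (use KA in blast)
    moreover have am: "\<mu> \<in> admissible"
      by (rule admissibleI) (use \<mu>(1) adm[OF K(1) KA \<mu>(1)] calculation in \<open>auto simp: finite_energy_on_iff\<close>)
    moreover note AE_pq_finite[OF am]
    ultimately have lt: "AE x in \<mu>. ?u x < p x"
      by (elim AE_mp) (use K(2) in \<open>auto intro!: AE_I2 simp: not_le\<close>)
    have le: "AE x in \<mu>. ?u x \<le> p x" using lt by eventually_elim simp
    have "(\<integral>\<^sup>+x. p x \<partial>\<mu>) \<le> (\<integral>\<^sup>+x. ?u x \<partial>\<mu>)"
      using var am slope_nonneg_iff(1)[OF \<nu> am] unfolding variational_def by blast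
    then have "AE x in \<mu>. ?u x = p x"
      using le nn_integral_potential[OF \<nu> am] field_measurable[OF \<nu> admissibleD(4)[OF am]]
      by (intro AE_eq_of_nn_integral_eq) simp_all
    then have "AE x in \<mu>. False" using lt by eventually_elim simp
    then have "emeasure \<mu> (space \<mu>) = 0" by (simp add: AE_iff_null null_sets_def)
    then show False using \<mu>(2) emeasure_space[of \<mu> K] by simp
  qed
  moreover have ?E
    using variational_AE_eq[OF \<nu> var] AE_pq_finite[OF \<nu>] by eventually_elim simp
  ultimately show "nearly_everywhere \<kappa> A ?N \<and> ?E" ..
next
  let ?u = "\<lambda>x. \<U> \<nu> x + q x"
  assume NE: "nearly_everywhere \<kappa> A ?N \<and> ?E"
  note [measurable] = field_measurable[OF \<nu> refl]
  have N: "{x. \<not> ?N x} \<in> sets borel" by measurable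
  have "0 \<le> slope \<nu> \<mu>" if \<mu>: "\<mu> \<in> admissible" for \<mu>
  proof -
    have "AE x in \<mu>. ?N x"
      by (rule AE_of_nearly_everywhere[OF admissibleD(1)[OF \<mu>] N]) (use NE in simp)
    then have "(\<integral>\<^sup>+x. p x \<partial>\<mu>) \<le> (\<integral>\<^sup>+x. ?u x \<partial>\<mu>)"
      by (intro nn_integral_mono_AE) (auto elim: eventually_mono)
    then show ?thesis using slope_nonneg_iff(1)[OF \<nu> \<mu>] by simp
  qed
  moreover have "(\<integral>\<^sup>+x. p x \<partial>\<nu>) = (\<integral>\<^sup>+x. ?u x \<partial>\<nu>)"
    using NE by (intro nn_integral_cong_AE) (auto elim: eventually_mono)
  then have "slope \<nu> \<nu> = 0" using slope_nonneg_iff(2)[OF \<nu> \<nu>] by simp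
  ultimately show "variational \<nu>" unfolding variational_def by blast
qed

end

section \<open>The two kinds of external field\<close>

context perfect_kernel
begin

lemma nn_integral_pos_potential:
  assumes "\<mu> \<in> \<E>" "\<alpha> \<in> \<E>"
  shows "(\<integral>\<^sup>+x. \<U> \<alpha> x \<partial>\<mu>) = ennreal (mutual \<mu> \<alpha>)"
  using pos_energy_eq[of \<mu> \<alpha>] pos_energy_mutual[OF assms] assms by (simp add: radon_finite_energy_pos)

lemma Cauchy_Schwarz_sqrt:
  assumes "a \<in> \<E>" "b \<in> \<E>"
  shows "mutual a b \<le> sqrt (mutual a a) * sqrt (mutual b b)"
  using Cauchy_Schwarz[OF assms] real_le_rsqrt unfolding real_sqrt_mult[symmetric] by blast

lemma self_energy_restrict_le:
  assumes \<mu>: "\<mu> \<in> \<E>" and B: "B \<in> sets borel"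
  shows "mutual (restrict_to \<mu> B) (restrict_to \<mu> B) \<le> mutual (restrict_to \<mu> B) \<mu>"
    and "mutual (restrict_to \<mu> B) (restrict_to \<mu> B) \<le> mutual \<mu> \<mu>"
proof -
  note R = finite_energy_pos_restrict[OF \<mu> B]
  show 1: "mutual (restrict_to \<mu> B) (restrict_to \<mu> B) \<le> mutual (restrict_to \<mu> B) \<mu>"
    using mutual_restrict_le[OF \<mu> R B] mutual_commute[OF \<mu> R] by simp
  show "mutual (restrict_to \<mu> B) (restrict_to \<mu> B) \<le> mutual \<mu> \<mu>"
    using 1 mutual_restrict_le[OF \<mu> \<mu> B] by simp
qed

text \<open>
  For \<open>\<alpha>\<close> of finite energy, \<open>\<mu> \<mapsto> \<integral> U\<^sup>\<alpha> d\<mu> = I(\<alpha>, \<mu>)\<close> is strongly continuous by the Cauchy--Schwarz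
  inequality.
\<close>

lemma gauss_problem_finite_energy_field:
  assumes cl: "closedin (strong_topology \<kappa>) (of_pos ` \<E>_on A)"
    and \<alpha>: "\<alpha> \<in> \<E>" and q: "\<And>t. open {x. t < q x}"
  shows "gauss_problem \<kappa> A (\<U> \<alpha>) q (sqrt (mutual \<alpha> \<alpha>))"
proof unfold_locales
  show "\<U> \<alpha> \<in> borel_measurable borel"
    by (rule pos_potential_measurable[OF radon_finite_energy_pos[OF \<alpha>]])
  show "open {x. t < q x}" for t by (rule q)
  show "\<nu> \<in> \<E>_on A"
    if "strongly_converges \<nu>s \<nu>" "\<And>n. \<nu>s n \<in> \<E>_on A" for \<nu>s \<nu>
    using strongly_closed[OF cl that] .
  show "0 \<le> sqrt (mutual \<alpha> \<alpha>)" using mutual_nonneg by simp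
  show "(\<integral>\<^sup>+x. \<U> \<alpha> x \<partial>\<mu>) \<le> ennreal (sqrt (mutual \<alpha> \<alpha>) * sqrt (mutual \<mu> \<mu>))"
    if "\<mu> \<in> \<E>_on A" for \<mu>
  proof -
    have \<mu>: "\<mu> \<in> \<E>" using that by (simp add: finite_energy_on_iff)
    show ?thesis
      unfolding nn_integral_pos_potential[OF \<mu> \<alpha>]
      using Cauchy_Schwarz_sqrt[OF \<mu> \<alpha>] by (intro ennreal_leI) (simp add: mult.commute)
  qed
  show "\<forall>\<^sub>F n in sequentially. (\<integral>\<^sup>+x. \<U> \<alpha> x \<partial>\<nu>s n) \<le> (\<integral>\<^sup>+x. \<U> \<alpha> x \<partial>\<nu>) + ennreal e"
    if conv: "strongly_converges \<nu>s \<nu>" and e: "0 < e" for \<nu>s \<nu> and e :: real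
  proof -
    note D = strongly_convergesD[OF conv]
    have "\<forall>\<^sub>F n in sequentially. mutual (\<nu>s n) \<alpha> < mutual \<nu> \<alpha> + e"
      using mutual_strong_limit[OF conv \<alpha>] by (rule order_tendstoD(2)) (use e in simp)
    then show ?thesis
      unfolding nn_integral_pos_potential[OF D(1) \<alpha>] nn_integral_pos_potential[OF D(2) \<alpha>]
      by eventually_elim
        (use e mutual_nonneg in \<open>simp add: ennreal_plus[symmetric] ennreal_leI del: ennreal_plus\<close>)
  qed
qed

text \<open>
  Otherwise suitable probability measures on \<open>K\<close> would tend to zero strongly, hence vaguely, although
  no mass can escape from a compact set.
\<close>

lemma mass_le_norm_on_compact:
  assumes K: "compact K"
  obtains C where "0 \<le> C" "\<And>\<mu>. \<mu> \<in> \<E>_on K \<Longrightarrow> emeasure \<mu> K \<le> ennreal (C * sqrt (mutual \<mu> \<mu>))"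
proof -
  have Kb: "K \<in> sets borel" using K by (rule borel_compact)
  have "\<exists>n::nat. \<forall>\<mu>\<in>\<E>_on K. emeasure \<mu> K \<le> ennreal (real n * sqrt (mutual \<mu> \<mu>))"
  proof (rule ccontr)
    assume "\<not> ?thesis"
    then have "\<forall>n::nat. \<exists>\<mu>\<in>\<E>_on K. ennreal (real n * sqrt (mutual \<mu> \<mu>)) < emeasure \<mu> K"
      by (simp add: not_le)
    then have "\<exists>\<mu>\<in>\<E>_on K. ennreal (real (Suc n) * sqrt (mutual \<mu> \<mu>)) < emeasure \<mu> K" for n
      by blast
    then obtain \<mu> where \<mu>: "\<And>n. \<mu> n \<in> \<E>_on K"
      "\<And>n. ennreal (real (Suc n) * sqrt (mutual (\<mu> n) (\<mu> n))) < emeasure (\<mu> n) K" by metis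
    have E: "\<mu> n \<in> \<E>" for n using \<mu>(1) by (simp add: finite_energy_on_iff)
    define m where "m n = enn2real (emeasure (\<mu> n) K)" for n
    have em: "emeasure (\<mu> n) K = ennreal (m n)" for n
      using compact_finite_radon[OF radon_finite_energy_pos[OF E] K] unfolding m_def by simp
    have m: "real (Suc n) * sqrt (mutual (\<mu> n) (\<mu> n)) < m n" for n
      using \<mu>(2)[of n] mutual_nonneg unfolding em by (simp add: ennreal_less_iff del: of_nat_Suc)
    have mpos: "0 < m n" for n
      using m[of n] mutual_nonneg[of "\<mu> n" "\<mu> n"]
      by (intro le_less_trans[OF _ m]) simp
    define \<sigma> where "\<sigma> n = scale_measure (ennreal (1 / m n)) (\<mu> n)" for n
    have \<sigma>E: "\<sigma> n \<in> \<E>" for n unfolding \<sigma>_def by (rule finite_energy_pos_scale[OF E])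
    have en: "sqdist (\<sigma> n) (null_measure borel) = (sqrt (mutual (\<mu> n) (\<mu> n)) / m n)\<^sup>2" for n
      unfolding sqdist_def using \<sigma>E[of n] mpos[of n] E[of n] mutual_nonneg[of "\<mu> n" "\<mu> n"] finite_energy_pos_null
        finite_energy_pos_scale[OF E, of "1 / m n" n]
      by (simp add: \<sigma>_def mutual_scale power_divide power2_eq_square[of "m n"])
    have lim: "(\<lambda>n. sqrt (mutual (\<mu> n) (\<mu> n)) / m n) \<longlonglongrightarrow> 0"
    proof (rule tendsto_sandwich[OF _ _ tendsto_const LIMSEQ_inverse_real_of_nat])
      show "\<forall>\<^sub>F n in sequentially. 0 \<le> sqrt (mutual (\<mu> n) (\<mu> n)) / m n"
        using mpos mutual_nonneg by (auto intro!: always_eventually divide_nonneg_pos)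
      show "\<forall>\<^sub>F n in sequentially. sqrt (mutual (\<mu> n) (\<mu> n)) / m n \<le> inverse (real (Suc n))"
      proof (rule always_eventually, rule allI)
        fix n
        show "sqrt (mutual (\<mu> n) (\<mu> n)) / m n \<le> inverse (real (Suc n))"
          using m[of n] mpos[of n] by (simp add: field_simps)
      qed
    qed
    have conv: "strongly_converges \<sigma> (null_measure borel)"
      unfolding strongly_converges_def using \<sigma>E finite_energy_pos_null tendsto_power[OF lim, of 2] by (auto simp: en)
    have "\<forall>\<^sub>F n in sequentially. (\<integral>\<^sup>+x. indicator K x * 1 \<partial>\<sigma> n) \<le> (\<integral>\<^sup>+x. indicator K x * 1 \<partial>null_measure borel) + ennreal (1/2)"
    proof (rule eventually_integral_usc_on_compact[OF conv K, where M=1])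
      have "{x \<in> K. 1 < t} = (if 1 < t then K else {})" for t :: ennreal by auto
      then show "usc_on K (\<lambda>_. 1)" unfolding usc_on_def by simp
    qed auto
    then obtain n where "(\<integral>\<^sup>+x. indicator K x * 1 \<partial>\<sigma> n) \<le> ennreal (1/2)"
      using eventually_happens'[OF sequentially_bot] by fastforce
    moreover have "(\<integral>\<^sup>+x. indicator K x * 1 \<partial>\<sigma> n) = 1"
    proof -
      have "K \<in> sets (\<sigma> n)" using Kb sets_radon[OF radon_finite_energy_pos[OF \<sigma>E]] by simp
      then show ?thesis using mpos[of n] by (simp add: \<sigma>_def em ennreal_mult[symmetric])
    qed
    moreover have "ennreal (1/2) < 1" unfolding ennreal_1[symmetric] by (rule ennreal_lessI) simp_all
    ultimately show False by simp
  qed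
  then obtain n :: nat where "\<forall>\<mu>\<in>\<E>_on K. emeasure \<mu> K \<le> ennreal (real n * sqrt (mutual \<mu> \<mu>))" by blast
  then show thesis by (intro that[of "real n"]) auto
qed

lemma finite_energy_on_compact_closed:
  assumes conv: "strongly_converges \<nu>s \<nu>" and K: "compact K"
    and on: "\<And>n. \<nu>s n \<in> \<E>_on K"
  shows "\<nu> \<in> \<E>_on K"
proof -
  note D = strongly_convergesD[OF conv]
  have op: "open (- K)" using compact_imp_closed[OF K] by (simp add: open_Compl)
  have "emeasure (\<nu>s n) (- K) = 0" for n
  proof -
    have s: "sets (\<nu>s n) = sets borel" by (rule sets_radon[OF radon_finite_energy_pos[OF D(1)]])
    have "AE x in \<nu>s n. x \<in> K" using on by (simp add: finite_energy_on_iff)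
    then have "emeasure (\<nu>s n) {x \<in> space (\<nu>s n). x \<in> - K} = 0"
      by (intro emeasure_eq_0_AE) auto
    then show ?thesis using sets_eq_imp_space_eq[OF s] by (simp add: Compl_eq)
  qed
  then have "emeasure \<nu> (- K) = 0" using liminf_emeasure_open[OF conv op] by (simp add: Liminf_const)
  then have "AE x in \<nu>. x \<in> K"
    using op sets_radon[OF radon_finite_energy_pos[OF D(2)]] by (intro AE_I[of _ _ "- K"]) auto
  then show ?thesis using D(2) by (simp add: finite_energy_on_iff)
qed

lemma nn_integral_on:
  assumes "AE x in \<mu>. x \<in> K"
  shows "(\<integral>\<^sup>+x. u x \<partial>\<mu>) = (\<integral>\<^sup>+x. indicator K x * u x \<partial>\<mu>)"
  using assms by (intro nn_integral_cong_AE) (auto elim: eventually_mono)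

text \<open>
  The minimizer \<open>\<nu>\<close> of the problem on \<open>K\<close> with the field \<open>- U\<^sup>\<alpha>\<close> has a potential that
  equals \<open>U\<^sup>\<alpha> \<le> M\<close> almost everywhere with respect to \<open>\<nu>\<close>. The maximum principle bounds its potential on
  the whole space, and integration against the finite measure \<open>\<alpha>\<close> bounds its norm independently of
  \<open>K\<close>. As \<open>\<integral> U\<^sup>\<alpha> d\<mu> \<le> I(\<nu>, \<mu>)\<close> for every competitor \<open>\<mu>\<close>, the Cauchy--Schwarz inequality applies.
\<close>

lemma potential_integral_bound_compact:
  assumes \<alpha>: "radon \<alpha>" "emeasure \<alpha> UNIV < \<infinity>"
    and K: "compact K" and usc: "usc_on K (\<U> \<alpha>)"
    and M: "0 < M" "\<And>x. x \<in> K \<Longrightarrow> \<U> \<alpha> x \<le> ennreal M"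
    and h: "0 \<le> h" "ugaheri_principle \<kappa> h"
    and \<mu>: "\<mu> \<in> \<E>_on K"
  shows "(\<integral>\<^sup>+x. \<U> \<alpha> x \<partial>\<mu>)
    \<le> ennreal (sqrt (h * M * measure \<alpha> UNIV) * sqrt (mutual \<mu> \<mu>))"
proof -
  let ?p = "\<U> \<alpha>"
  have pm: "?p \<in> borel_measurable borel" by (rule pos_potential_measurable[OF \<alpha>(1)])
  have Kb: "K \<in> sets borel" using K by (rule borel_compact)
  obtain C where C: "0 \<le> C" "\<And>\<mu>. \<mu> \<in> \<E>_on K \<Longrightarrow> emeasure \<mu> K \<le> ennreal (C * sqrt (mutual \<mu> \<mu>))"
    by (rule mass_le_norm_on_compact[OF K]) (rule that)
  have on: "AE x in \<mu>. x \<in> K" if "\<mu> \<in> \<E>_on K" for \<mu> using that by (simp add: finite_energy_on_iff)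
  interpret G: gauss_problem \<kappa> K ?p "\<lambda>_. 0" "M * C"
  proof unfold_locales
    show "?p \<in> borel_measurable borel" by (rule pm)
    show "open {x::'a. t < (0::ennreal)}" for t by simp
    show "\<nu> \<in> \<E>_on K"
      if "strongly_converges \<nu>s \<nu>" "\<And>n. \<nu>s n \<in> \<E>_on K" for \<nu>s \<nu>
      by (rule finite_energy_on_compact_closed[OF that(1) K that(2)])
    show "0 \<le> M * C" using M(1) C(1) by simp
    fix \<mu> assume \<mu>: "\<mu> \<in> \<E>_on K"
    have Km: "K \<in> sets \<mu>"
      using \<mu> Kb sets_radon[OF radon_finite_energy_pos] by (auto simp: finite_energy_on_iff)
    have "(\<integral>\<^sup>+x. ?p x \<partial>\<mu>) \<le> (\<integral>\<^sup>+x. ennreal M * indicator K x \<partial>\<mu>)"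
      unfolding nn_integral_on[OF on[OF \<mu>], where u = ?p] using M(2) by (intro nn_integral_mono) (auto simp: indicator_def)
    also have "\<dots> = ennreal M * emeasure \<mu> K" using Km by (simp add: nn_integral_cmult)
    also have "\<dots> \<le> ennreal M * ennreal (C * sqrt (mutual \<mu> \<mu>))" by (intro mult_left_mono C(2)[OF \<mu>]) simp
    also have "\<dots> = ennreal (M * C * sqrt (mutual \<mu> \<mu>))"
      using M(1) C(1) mutual_nonneg by (simp add: ennreal_mult[symmetric] mult.assoc)
    finally show "(\<integral>\<^sup>+x. ?p x \<partial>\<mu>) \<le> ennreal (M * C * sqrt (mutual \<mu> \<mu>))" .
  next
    fix \<nu>s \<nu> and e :: real
    assume conv: "strongly_converges \<nu>s \<nu>" and o: "\<And>n. \<nu>s n \<in> \<E>_on K" "\<nu> \<in> \<E>_on K"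
      and e: "0 < e"
    show "\<forall>\<^sub>F n in sequentially. (\<integral>\<^sup>+x. ?p x \<partial>\<nu>s n) \<le> (\<integral>\<^sup>+x. ?p x \<partial>\<nu>) + ennreal e"
      using eventually_integral_usc_on_compact[OF conv K pm usc _ M(2) e] M(1)
      unfolding nn_integral_on[OF on[OF o(1)], where u = ?p] nn_integral_on[OF on[OF o(2)], where u = ?p] by simp
  qed
  obtain \<nu> where \<nu>: "\<nu> \<in> G.admissible" and min: "\<And>\<mu>. \<mu> \<in> G.admissible \<Longrightarrow> G.J \<nu> \<le> G.J \<mu>"
    by (rule G.minimizer_exists) (rule that)
  have var: "G.variational \<nu>" by (rule G.minimizer_imp_variational[OF \<nu> min])
  note D = G.admissibleD[OF \<nu>]
  have "AE x in \<nu>. \<U> \<nu> x \<le> ennreal M"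
    using G.variational_AE_eq[OF \<nu> var] D(5) by eventually_elim (use M(2) in auto)
  then have U: "\<U> \<nu> x \<le> ennreal (h * M)" for x
    using h(2) D(2) M(1) unfolding ugaheri_principle_def by blast
  have "ennreal (G.P \<nu>) = (\<integral>\<^sup>+x. \<U> \<nu> x \<partial>\<alpha>)"
    using D(7) pos_energy_commute[OF D(3) \<alpha>(1)] by (simp add: pos_energy_eq D(3) \<alpha>(1))
  also have "\<dots> \<le> (\<integral>\<^sup>+x. ennreal (h * M) \<partial>\<alpha>)" using U by (intro nn_integral_mono)
  also have "\<dots> = ennreal (h * M) * ennreal (measure \<alpha> UNIV)"
    using \<alpha>(2) by (simp add: space_radon[OF \<alpha>(1)] emeasure_eq_ennreal_measure less_top)
  also have "\<dots> = ennreal (h * M * measure \<alpha> UNIV)" using h(1) M(1) by (simp add: ennreal_mult)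
  finally have "G.P \<nu> \<le> h * M * measure \<alpha> UNIV" using h(1) M(1) by (simp add: ennreal_le_iff)
  moreover have "mutual \<nu> \<nu> = G.P \<nu>" using var unfolding G.variational_def G.slope_def G.Q_def by simp
  ultimately have norm: "mutual \<nu> \<nu> \<le> h * M * measure \<alpha> UNIV" by simp
  have \<mu>a: "\<mu> \<in> G.admissible" using \<mu> unfolding G.admissible_def by simp
  have "G.P \<mu> \<le> mutual \<nu> \<mu>"
    using var \<mu>a unfolding G.variational_def G.slope_def G.Q_def by simp
  also have "\<dots> \<le> sqrt (mutual \<nu> \<nu>) * sqrt (mutual \<mu> \<mu>)"
    by (rule Cauchy_Schwarz_sqrt[OF D(2) G.admissibleD(2)[OF \<mu>a]])
  also have "\<dots> \<le> sqrt (h * M * measure \<alpha> UNIV) * sqrt (mutual \<mu> \<mu>)"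
    using norm mutual_nonneg by (intro mult_right_mono real_sqrt_le_mono) simp_all
  finally show ?thesis unfolding G.admissibleD(7)[OF \<mu>a] by (rule ennreal_leI)
qed

lemma finite_energy_on_restrict:
  assumes \<mu>: "\<mu> \<in> \<E>_on A" and B: "B \<in> sets borel"
  shows "restrict_to \<mu> B \<in> \<E>_on (A \<inter> B)"
proof -
  have E: "\<mu> \<in> \<E>" and A: "AE x in \<mu>. x \<in> A" using \<mu> by (auto simp: finite_energy_on_iff)
  note s = sets_radon[OF radon_finite_energy_pos[OF E]]
  have "AE x in restrict_to \<mu> B. x \<in> B"
    using B s by (subst AE_density) (auto intro!: borel_measurable_indicator split: split_indicator_asm)
  then have "AE x in restrict_to \<mu> B. x \<in> A \<inter> B"
    using AE_restrict_to[OF s B A] by eventually_elim simp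
  then show ?thesis using finite_energy_pos_restrict[OF E B] by (simp add: finite_energy_on_iff)
qed

text \<open>
  Exhausting by compact sets extends the preceding bound from compact subsets to \<open>A\<close>. It also controls
  the integrals of \<open>U\<^sup>\<alpha>\<close> outside a large compact set, where by tightness little energy is left, while
  on that compact set \<open>U\<^sup>\<alpha>\<close> is upper semicontinuous.
\<close>

lemma gauss_problem_bounded_field:
  assumes cl: "closedin (strong_topology \<kappa>) (of_pos ` \<E>_on A)"
    and \<alpha>: "radon \<alpha>" "emeasure \<alpha> UNIV < \<infinity>"
    and usc: "\<And>K. compact K \<Longrightarrow> K \<subseteq> A \<Longrightarrow> usc_on K (\<U> \<alpha>)"
    and M: "0 < M" "\<And>x. x \<in> A \<Longrightarrow> \<U> \<alpha> x \<le> ennreal M"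
    and h: "0 \<le> h" "ugaheri_principle \<kappa> h"
    and q: "\<And>t. open {x. t < q x}"
  shows "gauss_problem \<kappa> A (\<U> \<alpha>) q (sqrt (h * M * measure \<alpha> UNIV))" (is "gauss_problem \<kappa> A ?p q ?C")
proof unfold_locales
  show pm: "?p \<in> borel_measurable borel" by (rule pos_potential_measurable[OF \<alpha>(1)])
  show "open {x. t < q x}" for t by (rule q)
  show "\<nu> \<in> \<E>_on A"
    if "strongly_converges \<nu>s \<nu>" "\<And>n. \<nu>s n \<in> \<E>_on A" for \<nu>s \<nu>
    using strongly_closed[OF cl that] .
  show C0: "0 \<le> ?C" using h(1) M(1) by simp
  have bound: "(\<integral>\<^sup>+x. ?p x \<partial>\<mu>) \<le> ennreal (?C * sqrt (mutual \<mu> \<mu>))" if \<mu>: "\<mu> \<in> \<E>_on A" for \<mu>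
  proof -
    have E: "\<mu> \<in> \<E>" and AE: "AE x in \<mu>. x \<in> A" using \<mu> by (auto simp: finite_energy_on_iff)
    note r = radon_finite_energy_pos[OF E]
    obtain K :: "nat \<Rightarrow> 'a set" where K: "\<And>n. compact (K n)" "\<And>n. K n \<subseteq> A" "incseq K"
      "(\<integral>\<^sup>+x. ?p x \<partial>\<mu>) = (SUP n. \<integral>\<^sup>+x. indicator (K n) x * ?p x \<partial>\<mu>)"
      by (rule integral_compact_exhaustion[OF lc r AE pm]) (rule that)
    have "(\<integral>\<^sup>+x. indicator (K n) x * ?p x \<partial>\<mu>) \<le> ennreal (?C * sqrt (mutual \<mu> \<mu>))" for n
    proof -
      have Kb: "K n \<in> sets borel" using K(1) by (rule borel_compact)
      let ?r = "restrict_to \<mu> (K n)"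
      have "?r \<in> \<E>_on (K n)"
        using finite_energy_on_restrict[OF \<mu> Kb] K(2)[of n] by (simp add: Int_absorb1)
      then have "(\<integral>\<^sup>+x. ?p x \<partial>?r) \<le> ennreal (?C * sqrt (mutual ?r ?r))"
        using K(2) by (intro potential_integral_bound_compact[OF \<alpha> K(1) usc[OF K(1,2)] M(1) M(2) h]) auto
      also have "\<dots> \<le> ennreal (?C * sqrt (mutual \<mu> \<mu>))"
        using self_energy_restrict_le(2)[OF E Kb] C0 by (intro ennreal_leI mult_left_mono real_sqrt_le_mono)
      finally show ?thesis unfolding nn_integral_restrict_to[OF sets_radon[OF r] Kb pm] .
    qed
    then show ?thesis unfolding K(4) by (intro SUP_least)
  qed
  then show "(\<integral>\<^sup>+x. ?p x \<partial>\<mu>) \<le> ennreal (?C * sqrt (mutual \<mu> \<mu>))" if "\<mu> \<in> \<E>_on A" for \<mu>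
    using that .
  fix \<nu>s \<nu> and e :: real
  assume conv: "strongly_converges \<nu>s \<nu>" and on: "\<And>n. \<nu>s n \<in> \<E>_on A" "\<nu> \<in> \<E>_on A"
    and e: "0 < e"
  show "\<forall>\<^sub>F n in sequentially. (\<integral>\<^sup>+x. ?p x \<partial>\<nu>s n) \<le> (\<integral>\<^sup>+x. ?p x \<partial>\<nu>) + ennreal e"
  proof (rule ccontr)
    assume "\<not> ?thesis"
    from not_eventually_sequentiallyD[OF this]
    obtain s :: "nat \<Rightarrow> nat"
      where s: "strict_mono s" "\<And>n. \<not> (\<integral>\<^sup>+x. ?p x \<partial>\<nu>s (s n)) \<le> (\<integral>\<^sup>+x. ?p x \<partial>\<nu>) + ennreal e"
      by blast
    \<comment> \<open>Outside \<open>K\<close> a norm of at most \<open>d\<close> costs \<open>e / 2\<close>; the summand \<open>1\<close> covers a vanishing constant.\<close>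
    define d where "d = e / (2 * (?C + 1))"
    have "0 < e / (2 * (c + 1))" "c * (e / (2 * (c + 1))) \<le> e / 2" if "0 \<le> c" for c
    proof -
      have "0 < c + 1" using that by simp
      then show "0 < e / (2 * (c + 1))" "c * (e / (2 * (c + 1))) \<le> e / 2"
        using e that by (simp_all add: field_simps)
    qed
    from this[OF C0] have d: "0 < d" "?C * d \<le> e / 2" unfolding d_def .
    have AE: "AE x in \<nu>s n. x \<in> A" "AE x in \<nu>. x \<in> A" for n using on by (auto simp: finite_energy_on_iff)
    have AE': "AE x in (\<nu>s \<circ> s) n. x \<in> A" for n unfolding comp_def by (rule AE(1))
    have d2: "0 < d\<^sup>2" using d(1) by simp
    obtain K r where K: "compact K" "K \<subseteq> A" and r: "strict_mono r"
      and small: "\<And>i::nat. mutual (restrict_to ((\<nu>s \<circ> s) (r i)) (- K)) ((\<nu>s \<circ> s) (r i)) \<le> d\<^sup>2"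
      by (rule strong_tightness[OF strongly_converges_subseq[OF conv s(1)] AE' AE(2) d2]) (rule that)
    have Kb: "K \<in> sets borel" using K(1) by (rule borel_compact)
    have conv': "strongly_converges (\<nu>s \<circ> s \<circ> r) \<nu>"
      using strongly_converges_subseq[OF strongly_converges_subseq[OF conv s(1)] r] .
    have "\<forall>\<^sub>F n in sequentially. (\<integral>\<^sup>+x. indicator K x * ?p x \<partial>(\<nu>s \<circ> s \<circ> r) n) \<le> (\<integral>\<^sup>+x. indicator K x * ?p x \<partial>\<nu>) + ennreal (e / 2)"
      using K(2) e M by (intro eventually_integral_usc_on_compact[OF conv' K(1) pm usc[OF K], of M]) auto
    then obtain i where i: "(\<integral>\<^sup>+x. indicator K x * ?p x \<partial>\<nu>s (s (r i))) \<le> (\<integral>\<^sup>+x. indicator K x * ?p x \<partial>\<nu>) + ennreal (e / 2)"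
      using eventually_happens'[OF sequentially_bot] by fastforce
    let ?\<mu> = "\<nu>s (s (r i))"
    have E: "?\<mu> \<in> \<E>" using on(1) by (simp add: finite_energy_on_iff)
    note s\<mu> = sets_radon[OF radon_finite_energy_pos[OF E]]
    have [measurable]: "?p \<in> borel_measurable ?\<mu>" "K \<in> sets ?\<mu>" "- K \<in> sets ?\<mu>"
      using pm Kb s\<mu> by (simp_all add: borel_comp cong: measurable_cong_sets)
    let ?r = "restrict_to ?\<mu> (- K)"
    have "?r \<in> \<E>_on A"
      using finite_energy_on_restrict[OF on(1) borel_comp[OF Kb], of "s (r i)"]
      by (auto simp: finite_energy_on_iff elim: eventually_mono)
    then have "(\<integral>\<^sup>+x. ?p x \<partial>?r) \<le> ennreal (?C * sqrt (mutual ?r ?r))" by (rule bound)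
    also have "\<dots> \<le> ennreal (?C * d)"
    proof (intro ennreal_leI mult_left_mono C0)
      have "mutual ?r ?r \<le> d\<^sup>2"
        using self_energy_restrict_le(1)[OF E borel_comp[OF Kb]] small[of i] by simp
      then show "sqrt (mutual ?r ?r) \<le> d" using d(1) by (intro real_le_lsqrt) auto
    qed
    also have "\<dots> \<le> ennreal (e / 2)" using d(2) by (rule ennreal_leI)
    finally have tail: "(\<integral>\<^sup>+x. indicator (- K) x * ?p x \<partial>?\<mu>) \<le> ennreal (e / 2)"
      unfolding nn_integral_restrict_to[OF s\<mu> borel_comp[OF Kb] pm] .
    have "(\<integral>\<^sup>+x. ?p x \<partial>?\<mu>) = (\<integral>\<^sup>+x. indicator K x * ?p x \<partial>?\<mu>) + (\<integral>\<^sup>+x. indicator (- K) x * ?p x \<partial>?\<mu>)"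
      by (subst nn_integral_add[symmetric]) (auto intro!: nn_integral_cong simp: indicator_def)
    also have "\<dots> \<le> ((\<integral>\<^sup>+x. indicator K x * ?p x \<partial>\<nu>) + ennreal (e / 2)) + ennreal (e / 2)"
      by (intro add_mono i tail)
    also have "\<dots> = (\<integral>\<^sup>+x. indicator K x * ?p x \<partial>\<nu>) + ennreal e"
      using e by (simp add: add.assoc ennreal_plus[symmetric] del: ennreal_plus)
    also have "\<dots> \<le> (\<integral>\<^sup>+x. ?p x \<partial>\<nu>) + ennreal e"
      by (intro add_right_mono nn_integral_mono) (auto simp: indicator_def)
    finally show False using s(2) by blast
  qed
qed

end

section \<open>Inner pseudo-balayage\<close>

lemma finite_nn_integral_real:
  fixes g :: "'b \<Rightarrow> ennreal"
  assumes g: "g \<in> borel_measurable \<mu>" and fin: "(\<integral>\<^sup>+x. g x \<partial>\<mu>) < \<infinity>"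
  shows "integrable \<mu> (\<lambda>x. enn2real (g x))"
    and "(\<integral>x. enn2real (g x) \<partial>\<mu>) = enn2real (\<integral>\<^sup>+x. g x \<partial>\<mu>)"
    and "AE x in \<mu>. g x < \<infinity>"
proof -
  show AE: "AE x in \<mu>. g x < \<infinity>" using nn_integral_PInf_AE[OF g] fin by (auto simp: less_top)
  have eq: "(\<integral>\<^sup>+x. ennreal (enn2real (g x)) \<partial>\<mu>) = (\<integral>\<^sup>+x. g x \<partial>\<mu>)"
    using AE by (intro nn_integral_cong_AE) (auto elim: eventually_mono)
  have m: "(\<lambda>x. enn2real (g x)) \<in> borel_measurable \<mu>" using g by measurable
  show "integrable \<mu> (\<lambda>x. enn2real (g x))"
    using m fin eq by (intro integrableI_bounded) simp_all
  show "(\<integral>x. enn2real (g x) \<partial>\<mu>) = enn2real (\<integral>\<^sup>+x. g x \<partial>\<mu>)"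
    unfolding eq[symmetric] by (rule integral_eq_nn_integral) (use m in auto)
qed

text \<open>
  Moving the negative part to the other side turns comparisons of extended reals into comparisons
  without subtraction; they agree also at points where exactly one of the two potentials is infinite.
\<close>

lemma potential_le_iff:
  "potential_defined \<kappa> \<omega> x \<and> potential \<kappa> \<omega> x \<le> enn2ereal u \<longleftrightarrow>
   (pos_potential \<kappa> (pos_part \<omega>) x < \<infinity> \<or> pos_potential \<kappa> (neg_part \<omega>) x < \<infinity>) \<and>
    pos_potential \<kappa> (pos_part \<omega>) x \<le> u + pos_potential \<kappa> (neg_part \<omega>) x"
  unfolding potential_defined_def potential_def
  by (cases "pos_potential \<kappa> (pos_part \<omega>) x"; cases "pos_potential \<kappa> (neg_part \<omega>) x"; cases u)
     (auto simp: ennreal_plus[symmetric] ennreal_le_iff top_unique simp del: ennreal_plus)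

lemma potential_eq_iff:
  "potential_defined \<kappa> \<omega> x \<and> enn2ereal u = potential \<kappa> \<omega> x \<longleftrightarrow>
   (pos_potential \<kappa> (pos_part \<omega>) x < \<infinity> \<or> pos_potential \<kappa> (neg_part \<omega>) x < \<infinity>) \<and>
    u + pos_potential \<kappa> (neg_part \<omega>) x = pos_potential \<kappa> (pos_part \<omega>) x"
  unfolding potential_defined_def potential_def
  by (cases "pos_potential \<kappa> (pos_part \<omega>) x"; cases "pos_potential \<kappa> (neg_part \<omega>) x"; cases u)
     (auto simp: ennreal_plus[symmetric] simp del: ennreal_plus)

locale signed_field_problem =
  gauss_problem \<kappa> A "pos_potential \<kappa> (pos_part \<omega>)" "pos_potential \<kappa> (neg_part \<omega>)" C
  for \<kappa> :: "'a::{t2_space, second_countable_topology} \<Rightarrow> 'a \<Rightarrow> ennreal" and A \<omega> C +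
  assumes \<omega>: "\<omega> \<in> signed_radon"
    and compact_admissible: "\<And>K \<mu>. compact K \<Longrightarrow> K \<subseteq> A \<Longrightarrow> \<mu> \<in> finite_energy_on \<kappa> K
      \<Longrightarrow> (\<integral>\<^sup>+x. pos_potential \<kappa> (neg_part \<omega>) x \<partial>\<mu>) < \<infinity>"
begin

abbreviation p where "p \<equiv> \<U> (pos_part \<omega>)"
abbreviation q where "q \<equiv> \<U> (neg_part \<omega>)"
abbreviation f where "f \<equiv> \<lambda>x. - potential \<kappa> \<omega> x"

lemma radon_parts: "radon (pos_part \<omega>)" "radon (neg_part \<omega>)"
  using \<omega> unfolding signed_radon_def by auto

lemma potential_measurable:
  assumes "\<sigma> \<in> signed_radon" "sets \<mu> = sets borel"
  shows "(\<lambda>x. real_of_ereal (potential \<kappa> \<sigma> x)) \<in> borel_measurable \<mu>"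
proof -
  have [measurable]: "\<U> (pos_part \<sigma>) \<in> borel_measurable \<mu>" "\<U> (neg_part \<sigma>) \<in> borel_measurable \<mu>"
    using assms pos_potential_measurable' unfolding signed_radon_def by auto
  show ?thesis unfolding potential_def by measurable
qed

lemma finite_potential:
  assumes "p x < \<infinity>" "q x < \<infinity>"
  shows "potential \<kappa> \<omega> x = ereal (enn2real (p x) - enn2real (q x))"
  using assms unfolding potential_def by (cases "p x"; cases "q x") auto

lemma gauss_class_eq: "gauss_class \<kappa> f A = admissible"
proof -
  have "ext_integrable \<mu> f \<longleftrightarrow> (\<integral>\<^sup>+x. q x \<partial>\<mu>) < \<infinity>" if on: "\<mu> \<in> \<E>_on A" for \<mu>
  proof -
    have s: "sets \<mu> = sets borel"
      using on sets_radon[OF radon_finite_energy_pos] by (simp add: finite_energy_on_iff)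
    have pm: "p \<in> borel_measurable \<mu>" and qm: "q \<in> borel_measurable \<mu>"
      using pos_potential_measurable' radon_parts s by auto
    have "(\<integral>\<^sup>+x. p x \<partial>\<mu>) < \<infinity>" using p_finite(1)[OF on] by simp
    note pf = finite_nn_integral_real[OF pm this]
    show ?thesis
    proof
      assume fin: "(\<integral>\<^sup>+x. q x \<partial>\<mu>) < \<infinity>"
      note qf = finite_nn_integral_real[OF qm fin]
      have eq: "AE x in \<mu>. f x = ereal (enn2real (q x) - enn2real (p x))"
        using pf(3) qf(3) by eventually_elim (simp add: finite_potential)
      have "integrable \<mu> (\<lambda>x. enn2real (q x) - enn2real (p x))" using pf(1) qf(1) by (rule Bochner_Integration.integrable_diff[rotated])
      moreover have "AE x in \<mu>. enn2real (q x) - enn2real (p x) = real_of_ereal (f x)"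
        using eq by eventually_elim simp
      moreover have "(\<lambda>x. real_of_ereal (f x)) \<in> borel_measurable \<mu>"
        using potential_measurable[OF \<omega> s] by (simp add: borel_measurable_uminus)
      ultimately have "integrable \<mu> (\<lambda>x. real_of_ereal (f x))"
        using integrable_cong_AE_imp by blast
      moreover have "AE x in \<mu>. \<bar>f x\<bar> \<noteq> \<infinity>" using eq by eventually_elim simp
      ultimately show "ext_integrable \<mu> f" unfolding ext_integrable_def by simp
    next
      assume "ext_integrable \<mu> f"
      then have fin: "AE x in \<mu>. \<bar>f x\<bar> \<noteq> \<infinity>" and int: "integrable \<mu> (\<lambda>x. real_of_ereal (f x))"
        unfolding ext_integrable_def by auto
      have "AE x in \<mu>. q x = ennreal (real_of_ereal (f x) + enn2real (p x))"
        using fin pf(3)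
      proof eventually_elim
        case (elim x)
        then have "q x < \<infinity>" unfolding potential_def by (cases "p x"; cases "q x") auto
        then show ?case using elim(2) finite_potential[of x] by simp
      qed
      then have "(\<integral>\<^sup>+x. q x \<partial>\<mu>) = (\<integral>\<^sup>+x. ennreal (real_of_ereal (f x) + enn2real (p x)) \<partial>\<mu>)"
        by (rule nn_integral_cong_AE)
      also have "\<dots> \<le> (\<integral>\<^sup>+x. ennreal (norm (real_of_ereal (f x) + enn2real (p x))) \<partial>\<mu>)"
        by (intro nn_integral_mono ennreal_leI) simp
      also have "\<dots> < \<infinity>"
        using Bochner_Integration.integrable_add[OF int pf(1)] by (simp add: integrable_iff_bounded)
      finally show "(\<integral>\<^sup>+x. q x \<partial>\<mu>) < \<infinity>" .
    qed
  qed
  then show ?thesis unfolding gauss_class_def admissible_def by blast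
qed

lemma finite_AE:
  assumes \<nu>: "\<nu> \<in> admissible" and \<mu>: "\<mu> \<in> admissible"
  shows "integrable \<mu> (\<lambda>x. enn2real (p x))" "(\<integral>x. enn2real (p x) \<partial>\<mu>) = P \<mu>" "AE x in \<mu>. p x < \<infinity>"
    and "integrable \<mu> (\<lambda>x. enn2real (q x))" "(\<integral>x. enn2real (q x) \<partial>\<mu>) = Q \<mu>" "AE x in \<mu>. q x < \<infinity>"
    and "integrable \<mu> (\<lambda>x. enn2real (\<U> \<nu> x))"
      "(\<integral>x. enn2real (\<U> \<nu> x) \<partial>\<mu>) = mutual \<nu> \<mu>" "AE x in \<mu>. \<U> \<nu> x < \<infinity>"
proof -
  note D = admissibleD[OF \<nu>] and E = admissibleD[OF \<mu>]
  have m: "p \<in> borel_measurable \<mu>" "q \<in> borel_measurable \<mu>" "\<U> \<nu> \<in> borel_measurable \<mu>"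
    using pos_potential_measurable' radon_parts D(3) E(4) by auto
  have U: "(\<integral>\<^sup>+x. \<U> \<nu> x \<partial>\<mu>) = ennreal (mutual \<nu> \<mu>)"
    unfolding nn_integral_pos_potential[OF E(2) D(2)] by (simp add: mutual_commute[OF E(2) D(2)])
  show "integrable \<mu> (\<lambda>x. enn2real (p x))" "(\<integral>x. enn2real (p x) \<partial>\<mu>) = P \<mu>" "AE x in \<mu>. p x < \<infinity>"
    using finite_nn_integral_real[OF m(1)] E(7) P_nonneg by simp_all
  show "integrable \<mu> (\<lambda>x. enn2real (q x))" "(\<integral>x. enn2real (q x) \<partial>\<mu>) = Q \<mu>" "AE x in \<mu>. q x < \<infinity>"
    using finite_nn_integral_real[OF m(2)] E(6) Q_nonneg by simp_all
  show "integrable \<mu> (\<lambda>x. enn2real (\<U> \<nu> x))"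
      "(\<integral>x. enn2real (\<U> \<nu> x) \<partial>\<mu>) = mutual \<nu> \<mu>" "AE x in \<mu>. \<U> \<nu> x < \<infinity>"
    using finite_nn_integral_real[OF m(3)] U mutual_nonneg by simp_all
qed

lemma gauss_eq_J:
  assumes \<mu>: "\<mu> \<in> admissible" shows "gauss \<kappa> f \<mu> = J \<mu>"
proof -
  note E = admissibleD[OF \<mu>] and F = finite_AE[OF \<mu> \<mu>]
  have "energy \<kappa> (of_pos \<mu>) = ereal (mutual \<mu> \<mu>)"
    unfolding energy_def energy_plus_def energy_minus_def of_pos_def
    using E(3) pos_energy_mutual[OF E(2) E(2)] mutual_nonneg by (simp add: radon_null zero_ennreal.rep_eq)
  then have 1: "(strong_norm \<kappa> (of_pos \<mu>))\<^sup>2 = mutual \<mu> \<mu>"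
    unfolding strong_norm_def using mutual_nonneg by simp
  have "ext_integral \<mu> f = (\<integral>x. enn2real (q x) - enn2real (p x) \<partial>\<mu>)"
    unfolding ext_integral_def
  proof (rule integral_cong_AE)
    show "(\<lambda>x. real_of_ereal (f x)) \<in> borel_measurable \<mu>"
      using potential_measurable[OF \<omega> E(4)] by (simp add: borel_measurable_uminus)
    show "(\<lambda>x. enn2real (q x) - enn2real (p x)) \<in> borel_measurable \<mu>" using F(1,4) by simp
    show "AE x in \<mu>. real_of_ereal (f x) = enn2real (q x) - enn2real (p x)"
      using F(3,6) by eventually_elim (simp add: finite_potential)
  qed
  also have "\<dots> = Q \<mu> - P \<mu>" using F by simp
  finally show ?thesis using 1 unfolding gauss_def J_def by simp
qed

lemma potential_signed_diff:
  assumes \<nu>: "radon \<nu>" and fin: "\<U> \<nu> x < \<infinity>" "p x < \<infinity>" "q x < \<infinity>"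
  shows "potential \<kappa> (signed_diff (of_pos \<nu>) \<omega>) x
    = ereal (enn2real (\<U> \<nu> x) - enn2real (p x) + enn2real (q x))"
proof -
  define \<sigma> where "\<sigma> = signed_diff (of_pos \<nu>) \<omega>"
  have \<sigma>eq: "\<sigma> = radon_diff (msum \<nu> (neg_part \<omega>)) (pos_part \<omega>)"
    unfolding \<sigma>_def signed_diff_def of_pos_def by (simp add: msum_null_left sets_radon radon_parts)
  have r: "radon (msum \<nu> (neg_part \<omega>))" by (rule radon_msum[OF \<nu> radon_parts(2)])
  note jd = radon_diff_jordan[OF lc r radon_parts(1), folded \<sigma>eq]
  obtain m where m: "radon m" "msum \<nu> (neg_part \<omega>) = msum (pos_part \<sigma>) m" "pos_part \<omega> = msum (neg_part \<sigma>) m"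
    using jd(2) by blast
  have rs: "radon (pos_part \<sigma>)" "radon (neg_part \<sigma>)" using jd(1) unfolding signed_radon_def by auto
  have 1: "\<U> \<nu> x + q x = \<U> (pos_part \<sigma>) x + \<U> m x"
    using arg_cong[OF m(2), of "\<lambda>\<mu>. \<U> \<mu> x"] \<nu> radon_parts rs m(1) by (simp add: pos_potential_msum)
  have 2: "p x = \<U> (neg_part \<sigma>) x + \<U> m x"
    using arg_cong[OF m(3), of "\<lambda>\<mu>. \<U> \<mu> x"] rs m(1) by (simp add: pos_potential_msum)
  have f2: "\<U> (neg_part \<sigma>) x < \<infinity>" "\<U> m x < \<infinity>" using 2 fin(2) by (auto simp: less_top)
  have "\<U> \<nu> x + q x < \<infinity>" using fin by simp
  then have f1: "\<U> (pos_part \<sigma>) x < \<infinity>" unfolding 1 by (auto simp: less_top)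
  have "enn2real (\<U> \<nu> x) + enn2real (q x) = enn2real (\<U> (pos_part \<sigma>) x) + enn2real (\<U> m x)"
    using arg_cong[OF 1, of enn2real] fin f1 f2 by (simp add: enn2real_plus less_top)
  moreover have "enn2real (p x) = enn2real (\<U> (neg_part \<sigma>) x) + enn2real (\<U> m x)"
    using arg_cong[OF 2, of enn2real] f2 by (simp add: enn2real_plus less_top)
  moreover have "potential \<kappa> \<sigma> x = ereal (enn2real (\<U> (pos_part \<sigma>) x) - enn2real (\<U> (neg_part \<sigma>) x))"
    using f1 f2(1) unfolding potential_def
    by (cases "\<U> (pos_part \<sigma>) x"; cases "\<U> (neg_part \<sigma>) x") auto
  ultimately show ?thesis unfolding \<sigma>_def[symmetric] by simp
qed

lemma signed_diff_integral:
  assumes \<nu>: "\<nu> \<in> admissible" and \<mu>: "\<mu> \<in> admissible"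
  shows "ext_integrable \<mu> (potential \<kappa> (signed_diff (of_pos \<nu>) \<omega>))"
    and "ext_integral \<mu> (potential \<kappa> (signed_diff (of_pos \<nu>) \<omega>)) = slope \<nu> \<mu>"
proof -
  note F = finite_AE[OF \<nu> \<mu>] and D = admissibleD[OF \<nu>] and E = admissibleD[OF \<mu>]
  let ?\<sigma> = "signed_diff (of_pos \<nu>) \<omega>"
  let ?g = "\<lambda>x. enn2real (\<U> \<nu> x) - enn2real (p x) + enn2real (q x)"
  have eq: "AE x in \<mu>. potential \<kappa> ?\<sigma> x = ereal (?g x)"
    using F(3,6,9) by eventually_elim (rule potential_signed_diff[OF D(3)])
  have "?\<sigma> \<in> signed_radon"
    unfolding signed_diff_def of_pos_def
    by (rule radon_diff_jordan(1)[OF lc]) (auto intro!: radon_msum D(3) radon_parts radon_null)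
  then have m: "(\<lambda>x. real_of_ereal (potential \<kappa> ?\<sigma> x)) \<in> borel_measurable \<mu>"
    by (rule potential_measurable[OF _ E(4)])
  have int: "integrable \<mu> ?g" using F by simp
  have eq': "AE x in \<mu>. ?g x = real_of_ereal (potential \<kappa> ?\<sigma> x)" using eq by eventually_elim simp
  have "integrable \<mu> (\<lambda>x. real_of_ereal (potential \<kappa> ?\<sigma> x))"
    using int m eq' by (rule integrable_cong_AE_imp)
  moreover have "AE x in \<mu>. \<bar>potential \<kappa> ?\<sigma> x\<bar> \<noteq> \<infinity>" using eq by eventually_elim simp
  ultimately show "ext_integrable \<mu> (potential \<kappa> ?\<sigma>)" unfolding ext_integrable_def by simp
  have "ext_integral \<mu> (potential \<kappa> ?\<sigma>) = (\<integral>x. ?g x \<partial>\<mu>)"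
    unfolding ext_integral_def
    by (rule integral_cong_AE) (use m int eq' in \<open>auto elim: eventually_mono\<close>)
  also have "\<dots> = slope \<nu> \<mu>" unfolding slope_def using F by simp
  finally show "ext_integral \<mu> (potential \<kappa> ?\<sigma>) = slope \<nu> \<mu>" .
qed

lemma gauss_inf_eq_J:
  assumes "\<nu> \<in> admissible" "\<And>\<mu>. \<mu> \<in> admissible \<Longrightarrow> J \<nu> \<le> J \<mu>"
  shows "gauss_inf \<kappa> f A = ereal (J \<nu>)" "J \<nu> \<le> 0"
proof -
  show "gauss_inf \<kappa> f A = ereal (J \<nu>)"
    unfolding gauss_inf_def gauss_class_eq using assms
    by (intro antisym INF_lower2[of \<nu>] INF_greatest) (simp_all add: gauss_eq_J)
  have "J (null_measure borel) = 0"
    unfolding J_def P_def Q_def using finite_energy_pos_null by simp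
  then show "J \<nu> \<le> 0" using assms(2)[OF admissible_null] by simp
qed

end

theorem theorem2p1:
  fixes \<kappa> :: "'a::{t2_space, second_countable_topology} \<Rightarrow> 'a \<Rightarrow> ennreal"
    and A :: "'a set"
    and \<omega> :: "'a signed"
    and f :: "'a \<Rightarrow> ereal"
  assumes "locally_compact_space (euclidean :: 'a topology)"
    and "perfect \<kappa>"
    and "inner_capacity \<kappa> A > 0"
    and "closedin (strong_topology \<kappa>) (of_pos ` finite_energy_on \<kappa> A)"
    and "\<omega> \<in> signed_radon"
    and "\<omega> \<noteq> zero_signed"
    and "\<omega> \<in> finite_energy \<kappa> \<or>
         (emeasure (pos_part \<omega>) UNIV < \<infinity> \<and>
          (\<forall>K. compact K \<and> K \<subseteq> A \<longrightarrow> usc_on K (pos_potential \<kappa> (pos_part \<omega>))) \<and>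
          (SUP x\<in>A. pos_potential \<kappa> (total_variation \<omega>) x) < \<infinity> \<and>
          (\<exists>h\<ge>1. ugaheri_principle \<kappa> h))"
    and "f = (\<lambda>x. - potential \<kappa> \<omega> x)"
  shows "\<exists>\<omega>A\<in>gauss_class \<kappa> f A.
    (ereal (gauss \<kappa> f \<omega>A) = gauss_inf \<kappa> f A \<and>
     gauss_inf \<kappa> f A \<in> {-\<infinity><..0} \<and>
     (\<forall>\<nu>\<in>gauss_class \<kappa> f A.
        (\<forall>\<mu>\<in>gauss_class \<kappa> f A. gauss \<kappa> f \<nu> \<le> gauss \<kappa> f \<mu>) \<longleftrightarrow> \<nu> = \<omega>A)) \<and>
    (\<forall>\<nu>\<in>gauss_class \<kappa> f A.
       ((\<forall>\<mu>\<in>gauss_class \<kappa> f A.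
           ext_integrable \<mu> (potential \<kappa> (signed_diff (of_pos \<nu>) \<omega>)) \<and>
           0 \<le> ext_integral \<mu> (potential \<kappa> (signed_diff (of_pos \<nu>) \<omega>))) \<and>
        ext_integral \<nu> (potential \<kappa> (signed_diff (of_pos \<nu>) \<omega>)) = 0) \<longleftrightarrow> \<nu> = \<omega>A) \<and>
    (\<forall>\<nu>\<in>gauss_class \<kappa> f A.
       (nearly_everywhere \<kappa> A
          (\<lambda>x. potential_defined \<kappa> \<omega> x \<and>
               potential \<kappa> \<omega> x \<le> enn2ereal (pos_potential \<kappa> \<nu> x)) \<and>
        (AE x in \<nu>. potential_defined \<kappa> \<omega> x \<and>
               enn2ereal (pos_potential \<kappa> \<nu> x) = potential \<kappa> \<omega> x)) \<longleftrightarrow> \<nu> = \<omega>A)"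
proof -
  interpret perfect_kernel \<kappa>
    using assms(1,2) by unfold_locales
  have r: "radon (pos_part \<omega>)" "radon (neg_part \<omega>)"
    using assms(5) unfolding signed_radon_def by auto
  have on: "AE x in \<mu>. x \<in> K" "\<mu> \<in> finite_energy_pos \<kappa>" if "\<mu> \<in> finite_energy_on \<kappa> K" for \<mu> K
    using that by (simp_all add: finite_energy_on_iff)
  note q = pos_potential_lsc[OF r(2)]
  have "\<exists>C. signed_field_problem \<kappa> A \<omega> C"
  proof (cases "\<omega> \<in> finite_energy \<kappa>")
    case True
    note parts = finite_energy_parts[OF True]
    have "(\<integral>\<^sup>+x. pos_potential \<kappa> (neg_part \<omega>) x \<partial>\<mu>) < \<infinity>" if "\<mu> \<in> finite_energy_on \<kappa> K" for \<mu> K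
      unfolding nn_integral_pos_potential[OF on(2)[OF that] parts(2)] by simp
    then show ?thesis
      using gauss_problem_finite_energy_field[OF assms(4) parts(1) q] assms(5)
      by (intro exI signed_field_problem.intro signed_field_problem_axioms.intro) blast+
  next
    case False
    then obtain h where fin: "emeasure (pos_part \<omega>) UNIV < \<infinity>"
      and usc: "\<And>K. compact K \<Longrightarrow> K \<subseteq> A \<Longrightarrow> usc_on K (pos_potential \<kappa> (pos_part \<omega>))"
      and sup: "(SUP x\<in>A. pos_potential \<kappa> (total_variation \<omega>) x) < \<infinity>"
      and h: "1 \<le> h" "ugaheri_principle \<kappa> h"
      using assms(7) by blast
    \<comment> \<open>The maximum principle applies only to positive bounds, hence the summand \<open>1\<close>.\<close>
    define M where "M = enn2real (SUP x\<in>A. pos_potential \<kappa> (total_variation \<omega>) x) + 1"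
    have M: "0 < M" unfolding M_def by (simp add: add_nonneg_pos)
    have sumM: "pos_potential \<kappa> (pos_part \<omega>) x + pos_potential \<kappa> (neg_part \<omega>) x \<le> ennreal M" if "x \<in> A" for x
    proof -
      have "pos_potential \<kappa> (total_variation \<omega>) x \<le> (SUP x\<in>A. pos_potential \<kappa> (total_variation \<omega>) x)"
        using that by (rule SUP_upper)
      also have "\<dots> = ennreal (enn2real (SUP x\<in>A. pos_potential \<kappa> (total_variation \<omega>) x))"
        using sup by simp
      also have "\<dots> \<le> ennreal M" unfolding M_def by (intro ennreal_leI) simp
      finally show ?thesis unfolding total_variation_def by (simp add: pos_potential_msum r)
    qed
    have pM: "pos_potential \<kappa> (pos_part \<omega>) x \<le> ennreal M"
      and qM: "pos_potential \<kappa> (neg_part \<omega>) x \<le> ennreal M" if "x \<in> A" for x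
      using order_trans[OF add_increasing2[OF zero_le order_refl] sumM[OF that]]
        order_trans[OF add_increasing[OF zero_le order_refl] sumM[OF that]] .
    have adm: "(\<integral>\<^sup>+x. pos_potential \<kappa> (neg_part \<omega>) x \<partial>\<mu>) < \<infinity>"
      if K: "compact K" "K \<subseteq> A" and \<mu>: "\<mu> \<in> finite_energy_on \<kappa> K" for K \<mu>
    proof -
      note r\<mu> = radon_finite_energy_pos[OF on(2)[OF \<mu>]]
      have Km: "K \<in> sets \<mu>" using borel_compact[OF K(1)] sets_radon[OF r\<mu>] by simp
      have "(\<integral>\<^sup>+x. pos_potential \<kappa> (neg_part \<omega>) x \<partial>\<mu>) \<le> (\<integral>\<^sup>+x. ennreal M * indicator K x \<partial>\<mu>)"
        using on(1)[OF \<mu>] by (intro nn_integral_mono_AE, eventually_elim) (use qM K(2) in auto)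
      also have "\<dots> = ennreal M * emeasure \<mu> K" using Km by (simp add: nn_integral_cmult)
      also have "\<dots> < \<infinity>" using compact_finite_radon[OF r\<mu> K(1)] by (simp add: ennreal_mult_less_top)
      finally show ?thesis .
    qed
    have "gauss_problem \<kappa> A (pos_potential \<kappa> (pos_part \<omega>)) (pos_potential \<kappa> (neg_part \<omega>))
        (sqrt (h * M * measure (pos_part \<omega>) UNIV))"
      using h by (intro gauss_problem_bounded_field assms(4) r(1) fin usc M pM q) auto
    then show ?thesis
      using adm assms(5)
      by (intro exI signed_field_problem.intro signed_field_problem_axioms.intro) blast+
  qed
  then obtain C where "signed_field_problem \<kappa> A \<omega> C" ..
  then interpret signed_field_problem \<kappa> A \<omega> C .
  obtain \<tau> where \<tau>: "\<tau> \<in> admissible" and min: "\<And>\<mu>. \<mu> \<in> admissible \<Longrightarrow> J \<tau> \<le> J \<mu>"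
    and i: "\<And>\<mu>. \<mu> \<in> admissible \<Longrightarrow> (\<forall>\<rho>\<in>admissible. J \<mu> \<le> J \<rho>) \<longleftrightarrow> \<mu> = \<tau>"
    and ii: "\<And>\<mu>. \<mu> \<in> admissible \<Longrightarrow> variational \<mu> \<longleftrightarrow> \<mu> = \<tau>"
    by (rule unique_minimizer) (rule that)
  note inf = gauss_inf_eq_J[OF \<tau> min]
  note iii = variational_iff_potential[OF _ compact_admissible, folded potential_le_iff potential_eq_iff]
  show ?thesis
    unfolding assms(8) gauss_class_eq
    by (intro bexI[OF _ \<tau>] conjI ballI)
      (use inf \<tau> i ii iii signed_diff_integral in \<open>simp_all add: gauss_eq_J variational_def\<close>)
qed

end
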